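(* Let $F$ be an h-conformal semi-invariant submersion from a hyperkähler manifold $(M,I,J,K,g_M)$ onto a Riemannian manifold $(N,g_N)$ such that $(I,J,K)$ is an h-conformal semi-invariant basis. Then: (i) the distribution $\mathcal{D}_2$ is always integrable; (ii) the following conditions are equivalent: (a) the distribution $\mathcal{D}_1$ is integrable; (b) $(\nabla F_* )(W,IV)-(\nabla F_* )(V,IW)\in\Gamma(F_*\mu^I)$ for all $V,W\in\Gamma(\mathcal{D}_1)$; (c) $(\nabla F_* )(W,JV)-(\nabla F_* )(V,JW)\in\Gamma(F_*\mu^J)$ for all $V,W\in\Gamma(\mathcal{D}_1)$; (d) $(\nabla F_* )(W,KV)-(\nabla F_* )(V,KW)\in\Gamma(F_*\mu^K)$ for all $V,W\in\Gamma(\mathcal{D}_1)$.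
   Context: All manifolds and maps are $C^\infty$; $\Gamma(\cdot)$ denotes smooth sections. A hyperkähler manifold $(M,I,J,K,g_M)$ is a Riemannian manifold with global sections $I,J,K$ of $\mathrm{End}(TM)$ satisfying $I^2=J^2=K^2=-\mathrm{id}$, $IJ=-JI=K$, $JK=-KJ=I$, $KI=-IK=J$, $g_M(RX,RY)=g_M(X,Y)$ and $\nabla R=0$ for $R\in\{I,J,K\}$, where $\nabla$ is the Levi-Civita connection of $g_M$. A horizontally conformal submersion $F:(M,g_M)\to(N,g_N)$ with dilation $\lambda:M\to(0,\infty)$ is a surjective submersion with $g_N(F_*X,F_*Y)=\lambda^2g_M(X,Y)$ for all $X,Y\in(\ker F_* )^{\perp}$. It is an h-conformal semi-invariant submersion with h-conformal semi-invariant basis $(I,J,K)$ if there is a distribution $\mathcal{D}_1\subset\ker F_*$ such that, for every $R\in\{I,J,K\}$, $\ker F_*=\mathcal{D}_1\oplus\mathcal{D}_2$, $R(\mathcal{D}_1)=\mathcal{D}_1$, $R(\mathcal{D}_2)\subset(\ker F_* )^{\perp}$, where $\mathcal{D}_2$ is the orthogonal complement of $\mathcal{D}_1$ in $\ker F_*$. Let $\mu^R$ be the orthogonal complement of $R\mathcal{D}_2$ in $(\ker F_* )^{\perp}$. The second fundamental form of $F$ is $(\nabla F_* )(X,Y)=\nabla^F_XF_*Y-F_*(\nabla_XY)$, with $\nabla^F$ the pullback connection on $F^{*}TN$; $F_*\mu^R$ is the image of $\mu^R$, a subbundle of $F^{*}TN$. *)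

theory Defs
  imports "HOL-Analysis.Analysis"
begin

section \<open>Smooth maps between open subsets of Euclidean spaces\<close>

text \<open>Only meaningful for open \<open>S\<close>, which is how it is used below.  All iterated directional
  derivatives of \<open>f\<close> up to order \<open>k\<close> exist and are continuous on \<open>S\<close>.\<close>

primrec Ck_on :: "nat \<Rightarrow> 'e::euclidean_space set \<Rightarrow> ('e \<Rightarrow> 'v::real_normed_vector) \<Rightarrow> bool" where
  "Ck_on 0 S f \<longleftrightarrow> continuous_on S f"
| "Ck_on (Suc k) S f \<longleftrightarrow>
     (\<forall>x\<in>S. f differentiable (at x)) \<and> (\<forall>v. Ck_on k S (\<lambda>x. frechet_derivative f (at x) v))"

definition smooth_on :: "'e::euclidean_space set \<Rightarrow> ('e \<Rightarrow> 'v::real_normed_vector) \<Rightarrow> bool" where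
  "smooth_on S f \<longleftrightarrow> (\<forall>k. Ck_on k S f)"


section \<open>Smooth manifolds\<close>

text \<open>The underlying set of a manifold is a whole type \<open>'a\<close> (Hausdorff and second countable by type
  class, where this is required), modelled on the Euclidean space \<open>'e\<close>.  A chart is a pair of its
  domain and its coordinate map; the values of the map outside the domain are irrelevant.\<close>

type_synonym ('a, 'e) chart = "'a set \<times> ('a \<Rightarrow> 'e)"

abbreviation cdom :: "('a, 'e) chart \<Rightarrow> 'a set" where "cdom c \<equiv> fst c"
abbreviation cmap :: "('a, 'e) chart \<Rightarrow> 'a \<Rightarrow> 'e" where "cmap c \<equiv> snd c"
abbreviation cinv :: "('a, 'e) chart \<Rightarrow> 'e \<Rightarrow> 'a" where "cinv c \<equiv> inv_into (fst c) (snd c)"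
abbreviation cimg :: "('a, 'e) chart \<Rightarrow> 'e set" where "cimg c \<equiv> snd c ` fst c"

definition is_chart :: "('a::topological_space, 'e::euclidean_space) chart \<Rightarrow> bool" where
  "is_chart c \<longleftrightarrow> open (cdom c) \<and> open (cimg c) \<and> homeomorphism (cdom c) (cimg c) (cmap c) (cinv c)"

definition compatible_charts ::
  "('a::topological_space, 'e::euclidean_space) chart \<Rightarrow> ('a, 'e) chart \<Rightarrow> bool" where
  "compatible_charts c d \<longleftrightarrow>
     smooth_on (cmap c ` (cdom c \<inter> cdom d)) (cmap d \<circ> cinv c) \<and>
     smooth_on (cmap d ` (cdom c \<inter> cdom d)) (cmap c \<circ> cinv d)"

text \<open>A smooth structure is a maximal smooth atlas.\<close>

definition smooth_structure :: "('a::topological_space, 'e::euclidean_space) chart set \<Rightarrow> bool" where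
  "smooth_structure A \<longleftrightarrow>
     (\<forall>c\<in>A. is_chart c) \<and>
     (\<Union>c\<in>A. cdom c) = UNIV \<and>
     (\<forall>c\<in>A. \<forall>d\<in>A. compatible_charts c d) \<and>
     (\<forall>c. is_chart c \<and> (\<forall>d\<in>A. compatible_charts c d) \<longrightarrow> c \<in> A)"

definition smooth_fun ::
  "('a::topological_space, 'e::euclidean_space) chart set \<Rightarrow> ('a \<Rightarrow> real) \<Rightarrow> bool" where
  "smooth_fun A f \<longleftrightarrow> (\<forall>c\<in>A. smooth_on (cimg c) (f \<circ> cinv c))"

definition smooth_map ::
  "('a::topological_space, 'e::euclidean_space) chart set \<Rightarrow>
   ('b::topological_space, 'f::euclidean_space) chart set \<Rightarrow> ('a \<Rightarrow> 'b) \<Rightarrow> bool" where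
  "smooth_map A B F \<longleftrightarrow> continuous_on UNIV F \<and>
     (\<forall>c\<in>A. \<forall>d\<in>B. smooth_on (cmap c ` (cdom c \<inter> F -` cdom d)) (cmap d \<circ> F \<circ> cinv c))"


section \<open>Tangent vectors\<close>

text \<open>Every point \<open>p\<close> gets a fixed reference chart \<open>chart_at A p\<close>, and a tangent vector at \<open>p\<close> is
  represented by its coordinate vector in that chart.  So the tangent space at \<open>p\<close> is the vector
  space \<open>'e\<close>, and a vector field is a function \<open>'a \<Rightarrow> 'e\<close>.  The reference chart depends on \<open>p\<close> in an
  arbitrary, in general discontinuous, way; therefore smoothness is always tested after passing to
  the coordinates of one and the same chart \<open>c\<close> by means of \<open>dchart\<close>.\<close>

definition chart_at :: "('a, 'e) chart set \<Rightarrow> 'a \<Rightarrow> ('a, 'e) chart" where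
  "chart_at A p = (SOME c. c \<in> A \<and> p \<in> cdom c)"

text \<open>\<open>dchart A c p v\<close> is the coordinate vector, in the chart \<open>c\<close> around \<open>p\<close>, of the tangent vector
  \<open>v\<close> at \<open>p\<close>; conversely \<open>coord_vec A c u p\<close> is the tangent vector at \<open>p\<close> with coordinate vector
  \<open>u\<close> in the chart \<open>c\<close>, so that \<open>coord_vec A c u\<close> for \<open>u \<in> Basis\<close> is a coordinate vector field.\<close>

definition dchart ::
  "('a, 'e::euclidean_space) chart set \<Rightarrow> ('a, 'e) chart \<Rightarrow> 'a \<Rightarrow> 'e \<Rightarrow> 'e" where
  "dchart A c p v =
     frechet_derivative (cmap c \<circ> cinv (chart_at A p)) (at (cmap (chart_at A p) p)) v"

definition coord_vec ::
  "('a, 'e::euclidean_space) chart set \<Rightarrow> ('a, 'e) chart \<Rightarrow> 'e \<Rightarrow> 'a \<Rightarrow> 'e" where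
  "coord_vec A c u p = frechet_derivative (cmap (chart_at A p) \<circ> cinv c) (at (cmap c p)) u"

text \<open>The differential \<open>F\<^sub>*\<close> at \<open>p\<close>, and the derivative of a function in the direction of a tangent
  vector \<open>v\<close> at \<open>p\<close>.\<close>

definition differential ::
  "('a, 'e::euclidean_space) chart set \<Rightarrow> ('b, 'f::euclidean_space) chart set \<Rightarrow>
   ('a \<Rightarrow> 'b) \<Rightarrow> 'a \<Rightarrow> 'e \<Rightarrow> 'f" where
  "differential A B F p v =
     frechet_derivative (cmap (chart_at B (F p)) \<circ> F \<circ> cinv (chart_at A p))
       (at (cmap (chart_at A p) p)) v"

definition dir_deriv ::
  "('a, 'e::euclidean_space) chart set \<Rightarrow> 'a \<Rightarrow> 'e \<Rightarrow> ('a \<Rightarrow> real) \<Rightarrow> real" where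
  "dir_deriv A p v f = frechet_derivative (f \<circ> cinv (chart_at A p)) (at (cmap (chart_at A p) p)) v"


section \<open>Vector fields, sections of pullback bundles, and distributions\<close>

definition vf_coords ::
  "('a, 'e::euclidean_space) chart set \<Rightarrow> ('a, 'e) chart \<Rightarrow> ('a \<Rightarrow> 'e) \<Rightarrow> 'e \<Rightarrow> 'e" where
  "vf_coords A c X x = dchart A c (cinv c x) (X (cinv c x))"

definition vector_fields_on ::
  "('a::topological_space, 'e::euclidean_space) chart set \<Rightarrow> 'a set \<Rightarrow> ('a \<Rightarrow> 'e) set" where
  "vector_fields_on A U = {X. \<forall>c\<in>A. smooth_on (cmap c ` (cdom c \<inter> U)) (vf_coords A c X)}"

abbreviation vector_fields ::
  "('a::topological_space, 'e::euclidean_space) chart set \<Rightarrow> ('a \<Rightarrow> 'e) set" where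
  "vector_fields A \<equiv> vector_fields_on A UNIV"

text \<open>Smooth sections \<open>s\<close> of the pullback bundle \<open>F\<^sup>*TN\<close>: \<open>s p\<close> is a tangent vector at \<open>F p\<close>.\<close>

definition pullback_sections ::
  "('a::topological_space, 'e::euclidean_space) chart set \<Rightarrow>
   ('b::topological_space, 'f::euclidean_space) chart set \<Rightarrow> ('a \<Rightarrow> 'b) \<Rightarrow> ('a \<Rightarrow> 'f) set" where
  "pullback_sections A B F = {s. \<forall>c\<in>A. \<forall>d\<in>B. smooth_on (cmap c ` (cdom c \<inter> F -` cdom d))
     (\<lambda>x. dchart B d (F (cinv c x)) (s (cinv c x)))}"

definition sections_in :: "('a \<Rightarrow> 'v) set \<Rightarrow> ('a \<Rightarrow> 'v set) \<Rightarrow> ('a \<Rightarrow> 'v) set" where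
  "sections_in Sec E = {s \<in> Sec. \<forall>p. s p \<in> E p}"

text \<open>The bracket in the coordinates of the reference chart at \<open>p\<close>; sign convention
  \<open>[X,Y]f = X(Yf) - Y(Xf)\<close>.\<close>

definition lie_bracket ::
  "('a, 'e::euclidean_space) chart set \<Rightarrow> ('a \<Rightarrow> 'e) \<Rightarrow> ('a \<Rightarrow> 'e) \<Rightarrow> 'a \<Rightarrow> 'e" where
  "lie_bracket A X Y p = (let c = chart_at A p; x = cmap c p in
     frechet_derivative (vf_coords A c Y) (at x) (vf_coords A c X x) -
     frechet_derivative (vf_coords A c X) (at x) (vf_coords A c Y x))"

text \<open>A distribution is a smooth subbundle of the tangent bundle: a subspace of each tangent space,
  locally spanned by a smooth frame.\<close>

definition distribution ::
  "('a::topological_space, 'e::euclidean_space) chart set \<Rightarrow> ('a \<Rightarrow> 'e set) \<Rightarrow> bool" where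
  "distribution A D \<longleftrightarrow> (\<forall>p. \<exists>U k. \<exists>X :: nat \<Rightarrow> 'a \<Rightarrow> 'e. open U \<and> p \<in> U \<and>
     (\<forall>i<k. X i \<in> vector_fields_on A U) \<and>
     (\<forall>q\<in>U. D q = span ((\<lambda>i. X i q) ` {..<k}) \<and> dim (D q) = k))"

text \<open>In the slice chart \<open>c\<close> the set \<open>S\<close> is the slice through some \<open>a\<close> in the coordinate directions
  \<open>E\<close>; the tangent space of \<open>S\<close> at \<open>q\<close> consists of the vectors whose \<open>c\<close>-coordinates outside \<open>E\<close>
  vanish.\<close>

definition slice_chart ::
  "('a::topological_space, 'e::euclidean_space) chart set \<Rightarrow> 'a set \<Rightarrow> ('a, 'e) chart \<Rightarrow> 'e set \<Rightarrow> bool"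
  where
  "slice_chart A S c E \<longleftrightarrow> c \<in> A \<and> E \<subseteq> Basis \<and>
     (\<exists>a. cmap c ` (cdom c \<inter> S) = {x \<in> cimg c. \<forall>b\<in>Basis - E. x \<bullet> b = a \<bullet> b})"

definition slice_tangent ::
  "('a, 'e::euclidean_space) chart set \<Rightarrow> ('a, 'e) chart \<Rightarrow> 'e set \<Rightarrow> 'a \<Rightarrow> 'e set" where
  "slice_tangent A c E q = {v. \<forall>b\<in>Basis - E. dchart A c q v \<bullet> b = 0}"

text \<open>A nonempty embedded submanifold whose tangent space at each of its points \<open>q\<close> is \<open>D q\<close>.\<close>

definition integral_manifold ::
  "('a::topological_space, 'e::euclidean_space) chart set \<Rightarrow> ('a \<Rightarrow> 'e set) \<Rightarrow> 'a set \<Rightarrow> bool" where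
  "integral_manifold A D S \<longleftrightarrow> S \<noteq> {} \<and>
     (\<forall>q\<in>S. \<exists>c E. q \<in> cdom c \<and> slice_chart A S c E \<and> slice_tangent A c E q = D q)"

text \<open>Integrability means that every point lies on an integral manifold.  Using embedded rather than
  immersed integral manifolds makes no difference here, since an immersed submanifold is locally
  embedded.\<close>

definition integrable_distribution ::
  "('a::topological_space, 'e::euclidean_space) chart set \<Rightarrow> ('a \<Rightarrow> 'e set) \<Rightarrow> bool" where
  "integrable_distribution A D \<longleftrightarrow>
     distribution A D \<and> (\<forall>p. \<exists>S. p \<in> S \<and> integral_manifold A D S)"


section \<open>Riemannian metrics and connections\<close>

definition riemannian_metric ::
  "('a::topological_space, 'e::euclidean_space) chart set \<Rightarrow> ('a \<Rightarrow> 'e \<Rightarrow> 'e \<Rightarrow> real) \<Rightarrow> bool" where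
  "riemannian_metric A g \<longleftrightarrow>
     (\<forall>p. bilinear (g p) \<and> (\<forall>u v. g p u v = g p v u) \<and> (\<forall>v. v \<noteq> 0 \<longrightarrow> g p v v > 0)) \<and>
     (\<forall>c\<in>A. \<forall>u v. smooth_on (cimg c)
        (\<lambda>x. g (cinv c x) (coord_vec A c u (cinv c x)) (coord_vec A c v (cinv c x))))"

definition riemannian_manifold ::
  "('a::topological_space, 'e::euclidean_space) chart set \<Rightarrow> ('a \<Rightarrow> 'e \<Rightarrow> 'e \<Rightarrow> real) \<Rightarrow> bool" where
  "riemannian_manifold A g \<longleftrightarrow> smooth_structure A \<and> riemannian_metric A g"

text \<open>\<open>nab X s\<close> is the covariant derivative of \<open>s\<close> along \<open>X\<close>, for a bundle over the manifold \<open>A\<close> with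
  \<open>Sec\<close> as its set of smooth sections.  Its values on non-smooth arguments are irrelevant.\<close>

definition connection ::
  "('a::topological_space, 'e::euclidean_space) chart set \<Rightarrow> ('a \<Rightarrow> 'v::real_vector) set \<Rightarrow>
   (('a \<Rightarrow> 'e) \<Rightarrow> ('a \<Rightarrow> 'v) \<Rightarrow> 'a \<Rightarrow> 'v) \<Rightarrow> bool" where
  "connection A Sec nab \<longleftrightarrow>
     (\<forall>X\<in>vector_fields A. \<forall>s\<in>Sec. nab X s \<in> Sec) \<and>
     (\<forall>X\<in>vector_fields A. \<forall>Y\<in>vector_fields A. \<forall>s\<in>Sec. \<forall>p.
        nab (\<lambda>q. X q + Y q) s p = nab X s p + nab Y s p) \<and>
     (\<forall>f X. \<forall>s\<in>Sec. \<forall>p. smooth_fun A f \<and> X \<in> vector_fields A \<longrightarrow>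
        nab (\<lambda>q. f q *\<^sub>R X q) s p = f p *\<^sub>R nab X s p) \<and>
     (\<forall>X\<in>vector_fields A. \<forall>s\<in>Sec. \<forall>t\<in>Sec. \<forall>p.
        nab X (\<lambda>q. s q + t q) p = nab X s p + nab X t p) \<and>
     (\<forall>f X. \<forall>s\<in>Sec. \<forall>p. smooth_fun A f \<and> X \<in> vector_fields A \<longrightarrow>
        nab X (\<lambda>q. f q *\<^sub>R s q) p = dir_deriv A p (X p) f *\<^sub>R s p + f p *\<^sub>R nab X s p)"

definition levi_civita ::
  "('a::topological_space, 'e::euclidean_space) chart set \<Rightarrow> ('a \<Rightarrow> 'e \<Rightarrow> 'e \<Rightarrow> real) \<Rightarrow>
   (('a \<Rightarrow> 'e) \<Rightarrow> ('a \<Rightarrow> 'e) \<Rightarrow> 'a \<Rightarrow> 'e) \<Rightarrow> bool" where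
  "levi_civita A g nab \<longleftrightarrow> connection A (vector_fields A) nab \<and>
     (\<forall>X\<in>vector_fields A. \<forall>Y\<in>vector_fields A. \<forall>p.
        nab X Y p - nab Y X p = lie_bracket A X Y p) \<and>
     (\<forall>X\<in>vector_fields A. \<forall>Y\<in>vector_fields A. \<forall>Z\<in>vector_fields A. \<forall>p.
        dir_deriv A p (X p) (\<lambda>q. g q (Y q) (Z q)) =
          g p (nab X Y p) (Z p) + g p (Y p) (nab X Z p))"

text \<open>The connection on \<open>F\<^sup>*TN\<close> determined by \<open>\<nabla>\<^sup>F\<^sub>X (Z \<circ> F) = (\<nabla>\<^sup>N\<^bsub>F\<^sub>*X\<^esub> Z) \<circ> F\<close>.  As \<open>nabN\<close> takes vector
  fields and not vectors, the tangent vector \<open>F\<^sub>*X\<close> at \<open>F p\<close> is extended to an arbitrary vector field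
  \<open>Y\<close>.\<close>

definition pullback_connection ::
  "('a::topological_space, 'e::euclidean_space) chart set \<Rightarrow>
   ('b::topological_space, 'f::euclidean_space) chart set \<Rightarrow> ('a \<Rightarrow> 'b) \<Rightarrow>
   (('b \<Rightarrow> 'f) \<Rightarrow> ('b \<Rightarrow> 'f) \<Rightarrow> 'b \<Rightarrow> 'f) \<Rightarrow>
   (('a \<Rightarrow> 'e) \<Rightarrow> ('a \<Rightarrow> 'f) \<Rightarrow> 'a \<Rightarrow> 'f) \<Rightarrow> bool" where
  "pullback_connection A B F nabN nabF \<longleftrightarrow> connection A (pullback_sections A B F) nabF \<and>
     (\<forall>X\<in>vector_fields A. \<forall>Y\<in>vector_fields B. \<forall>Z\<in>vector_fields B. \<forall>p.
        Y (F p) = differential A B F p (X p) \<longrightarrow> nabF X (\<lambda>q. Z (F q)) p = nabN Y Z (F p))"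

definition second_fundamental_form ::
  "('a, 'e::euclidean_space) chart set \<Rightarrow> ('b, 'f::euclidean_space) chart set \<Rightarrow> ('a \<Rightarrow> 'b) \<Rightarrow>
   (('a \<Rightarrow> 'e) \<Rightarrow> ('a \<Rightarrow> 'e) \<Rightarrow> 'a \<Rightarrow> 'e) \<Rightarrow> (('a \<Rightarrow> 'e) \<Rightarrow> ('a \<Rightarrow> 'f) \<Rightarrow> 'a \<Rightarrow> 'f) \<Rightarrow>
   ('a \<Rightarrow> 'e) \<Rightarrow> ('a \<Rightarrow> 'e) \<Rightarrow> 'a \<Rightarrow> 'f" where
  "second_fundamental_form A B F nabM nabF X Y p =
     nabF X (\<lambda>q. differential A B F q (Y q)) p - differential A B F p (nabM X Y p)"


section \<open>Hyperkaehler manifolds\<close>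

text \<open>A global section of \<open>End(TM)\<close>.\<close>

definition endo_field ::
  "('a::topological_space, 'e::euclidean_space) chart set \<Rightarrow> ('a \<Rightarrow> 'e \<Rightarrow> 'e) \<Rightarrow> bool" where
  "endo_field A R \<longleftrightarrow> (\<forall>p. linear (R p)) \<and>
     (\<forall>c\<in>A. \<forall>u. smooth_on (cimg c)
        (\<lambda>x. dchart A c (cinv c x) (R (cinv c x) (coord_vec A c u (cinv c x)))))"

text \<open>\<open>\<nabla>R = 0\<close>, where \<open>(\<nabla>\<^sub>XR)Y = \<nabla>\<^sub>X(RY) - R(\<nabla>\<^sub>XY)\<close>.\<close>

definition parallel_endo ::
  "('a::topological_space, 'e::euclidean_space) chart set \<Rightarrow>
   (('a \<Rightarrow> 'e) \<Rightarrow> ('a \<Rightarrow> 'e) \<Rightarrow> 'a \<Rightarrow> 'e) \<Rightarrow> ('a \<Rightarrow> 'e \<Rightarrow> 'e) \<Rightarrow> bool" where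
  "parallel_endo A nab R \<longleftrightarrow> (\<forall>X\<in>vector_fields A. \<forall>Y\<in>vector_fields A. \<forall>p.
     nab X (\<lambda>q. R q (Y q)) p - R p (nab X Y p) = 0)"

definition hyperkaehler ::
  "('a::topological_space, 'e::euclidean_space) chart set \<Rightarrow> ('a \<Rightarrow> 'e \<Rightarrow> 'e \<Rightarrow> real) \<Rightarrow>
   (('a \<Rightarrow> 'e) \<Rightarrow> ('a \<Rightarrow> 'e) \<Rightarrow> 'a \<Rightarrow> 'e) \<Rightarrow>
   ('a \<Rightarrow> 'e \<Rightarrow> 'e) \<Rightarrow> ('a \<Rightarrow> 'e \<Rightarrow> 'e) \<Rightarrow> ('a \<Rightarrow> 'e \<Rightarrow> 'e) \<Rightarrow> bool" where
  "hyperkaehler A g nab I J K \<longleftrightarrow>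
     riemannian_manifold A g \<and> levi_civita A g nab \<and>
     (\<forall>R\<in>{I, J, K}. endo_field A R \<and> (\<forall>p v. R p (R p v) = - v) \<and>
        (\<forall>p u v. g p (R p u) (R p v) = g p u v) \<and> parallel_endo A nab R) \<and>
     (\<forall>p v. I p (J p v) = K p v \<and> J p (I p v) = - K p v) \<and>
     (\<forall>p v. J p (K p v) = I p v \<and> K p (J p v) = - I p v) \<and>
     (\<forall>p v. K p (I p v) = J p v \<and> I p (K p v) = - J p v)"


section \<open>Conformal submersions\<close>

definition vertical ::
  "('a, 'e::euclidean_space) chart set \<Rightarrow> ('b, 'f::euclidean_space) chart set \<Rightarrow> ('a \<Rightarrow> 'b) \<Rightarrow>
   'a \<Rightarrow> 'e set" where
  "vertical A B F p = {v. differential A B F p v = 0}"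

text \<open>The fibrewise orthogonal complement of \<open>D\<close> in \<open>E\<close>.\<close>

definition orth_compl_in ::
  "('a \<Rightarrow> 'e \<Rightarrow> 'e \<Rightarrow> real) \<Rightarrow> ('a \<Rightarrow> 'e set) \<Rightarrow> ('a \<Rightarrow> 'e set) \<Rightarrow> 'a \<Rightarrow> 'e set" where
  "orth_compl_in g E D p = {v \<in> E p. \<forall>w\<in>D p. g p v w = 0}"

abbreviation horizontal ::
  "('a, 'e::euclidean_space) chart set \<Rightarrow> ('b, 'f::euclidean_space) chart set \<Rightarrow>
   ('a \<Rightarrow> 'e \<Rightarrow> 'e \<Rightarrow> real) \<Rightarrow> ('a \<Rightarrow> 'b) \<Rightarrow> 'a \<Rightarrow> 'e set" where
  "horizontal A B g F \<equiv> orth_compl_in g (\<lambda>p. UNIV) (vertical A B F)"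

definition horizontally_conformal_submersion ::
  "('a::topological_space, 'e::euclidean_space) chart set \<Rightarrow> ('a \<Rightarrow> 'e \<Rightarrow> 'e \<Rightarrow> real) \<Rightarrow>
   ('b::topological_space, 'f::euclidean_space) chart set \<Rightarrow> ('b \<Rightarrow> 'f \<Rightarrow> 'f \<Rightarrow> real) \<Rightarrow>
   ('a \<Rightarrow> 'b) \<Rightarrow> ('a \<Rightarrow> real) \<Rightarrow> bool" where
  "horizontally_conformal_submersion A gM B gN F lam \<longleftrightarrow>
     smooth_map A B F \<and> surj F \<and> (\<forall>p. surj (differential A B F p)) \<and>
     smooth_fun A lam \<and> (\<forall>p. lam p > 0) \<and>
     (\<forall>p. \<forall>X\<in>horizontal A B gM F p. \<forall>Y\<in>horizontal A B gM F p.
        gN (F p) (differential A B F p X) (differential A B F p Y) = (lam p)\<^sup>2 * gM p X Y)"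

abbreviation D2 ::
  "('a, 'e::euclidean_space) chart set \<Rightarrow> ('a \<Rightarrow> 'e \<Rightarrow> 'e \<Rightarrow> real) \<Rightarrow>
   ('b, 'f::euclidean_space) chart set \<Rightarrow> ('a \<Rightarrow> 'b) \<Rightarrow> ('a \<Rightarrow> 'e set) \<Rightarrow> 'a \<Rightarrow> 'e set" where
  "D2 A gM B F D1 \<equiv> orth_compl_in gM (vertical A B F) D1"

text \<open>\<open>(I, J, K)\<close> is an h-conformal semi-invariant basis, with the distribution \<open>D1\<close> as witness.\<close>

definition h_conformal_semi_invariant ::
  "('a::topological_space, 'e::euclidean_space) chart set \<Rightarrow> ('a \<Rightarrow> 'e \<Rightarrow> 'e \<Rightarrow> real) \<Rightarrow>
   ('b::topological_space, 'f::euclidean_space) chart set \<Rightarrow> ('b \<Rightarrow> 'f \<Rightarrow> 'f \<Rightarrow> real) \<Rightarrow>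
   ('a \<Rightarrow> 'b) \<Rightarrow> ('a \<Rightarrow> real) \<Rightarrow>
   ('a \<Rightarrow> 'e \<Rightarrow> 'e) \<Rightarrow> ('a \<Rightarrow> 'e \<Rightarrow> 'e) \<Rightarrow> ('a \<Rightarrow> 'e \<Rightarrow> 'e) \<Rightarrow> ('a \<Rightarrow> 'e set) \<Rightarrow> bool" where
  "h_conformal_semi_invariant A gM B gN F lam I J K D1 \<longleftrightarrow>
     horizontally_conformal_submersion A gM B gN F lam \<and>
     distribution A D1 \<and> (\<forall>p. D1 p \<subseteq> vertical A B F p) \<and>
     (\<forall>p. vertical A B F p = {u + v |u v. u \<in> D1 p \<and> v \<in> D2 A gM B F D1 p} \<and>
          D1 p \<inter> D2 A gM B F D1 p = {0}) \<and>
     (\<forall>R\<in>{I, J, K}. \<forall>p. R p ` D1 p = D1 p \<and>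
        R p ` D2 A gM B F D1 p \<subseteq> horizontal A B gM F p)"

text \<open>The bundle \<open>\<mu>\<^sup>R\<close> and its image \<open>F\<^sub>*\<mu>\<^sup>R\<close> in \<open>F\<^sup>*TN\<close>.\<close>

definition mu_bundle ::
  "('a, 'e::euclidean_space) chart set \<Rightarrow> ('a \<Rightarrow> 'e \<Rightarrow> 'e \<Rightarrow> real) \<Rightarrow>
   ('b, 'f::euclidean_space) chart set \<Rightarrow> ('a \<Rightarrow> 'b) \<Rightarrow> ('a \<Rightarrow> 'e set) \<Rightarrow> ('a \<Rightarrow> 'e \<Rightarrow> 'e) \<Rightarrow>
   'a \<Rightarrow> 'e set" where
  "mu_bundle A gM B F D1 R =
     orth_compl_in gM (horizontal A B gM F) (\<lambda>p. R p ` D2 A gM B F D1 p)"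

definition push_mu_bundle ::
  "('a, 'e::euclidean_space) chart set \<Rightarrow> ('a \<Rightarrow> 'e \<Rightarrow> 'e \<Rightarrow> real) \<Rightarrow>
   ('b, 'f::euclidean_space) chart set \<Rightarrow> ('a \<Rightarrow> 'b) \<Rightarrow> ('a \<Rightarrow> 'e set) \<Rightarrow> ('a \<Rightarrow> 'e \<Rightarrow> 'e) \<Rightarrow>
   'a \<Rightarrow> 'f set" where
  "push_mu_bundle A gM B F D1 R p = differential A B F p ` mu_bundle A gM B F D1 R p"

text \<open>\<open>(\<nabla>F\<^sub>*)(W,RV) - (\<nabla>F\<^sub>*)(V,RW) \<in> \<Gamma>(F\<^sub>*\<mu>\<^sup>R)\<close> for all \<open>V, W \<in> \<Gamma>(D1)\<close>.\<close>

definition sff_condition ::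
  "('a::topological_space, 'e::euclidean_space) chart set \<Rightarrow> ('a \<Rightarrow> 'e \<Rightarrow> 'e \<Rightarrow> real) \<Rightarrow>
   ('b::topological_space, 'f::euclidean_space) chart set \<Rightarrow> ('a \<Rightarrow> 'b) \<Rightarrow>
   (('a \<Rightarrow> 'e) \<Rightarrow> ('a \<Rightarrow> 'e) \<Rightarrow> 'a \<Rightarrow> 'e) \<Rightarrow> (('a \<Rightarrow> 'e) \<Rightarrow> ('a \<Rightarrow> 'f) \<Rightarrow> 'a \<Rightarrow> 'f) \<Rightarrow>
   ('a \<Rightarrow> 'e set) \<Rightarrow> ('a \<Rightarrow> 'e \<Rightarrow> 'e) \<Rightarrow> bool" where
  "sff_condition A gM B F nabM nabF D1 R \<longleftrightarrow>
     (\<forall>V\<in>sections_in (vector_fields A) D1. \<forall>W\<in>sections_in (vector_fields A) D1.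
        (\<lambda>p. second_fundamental_form A B F nabM nabF W (\<lambda>q. R q (V q)) p -
             second_fundamental_form A B F nabM nabF V (\<lambda>q. R q (W q)) p)
        \<in> sections_in (pullback_sections A B F) (push_mu_bundle A gM B F D1 R))"

end

theory Submission
  imports Defs
begin

text \<open>
Let \<open>R\<close> be one of \<open>I\<close>, \<open>J\<close>, \<open>K\<close>.  It is parallel and isometric, it preserves \<open>D1\<close> and makes \<open>D2\<close> horizontal, and
  the bracket of vertical fields is vertical (\<open>lie_bracket_vertical\<close>).  For \<open>Z, W\<close> in \<open>D2\<close> and \<open>X\<close> in \<open>D1\<close>
  this gives \<open>g(\<nabla>\<^sub>ZW, X) = - g(RW, \<nabla>\<^sub>R\<^sub>X Z)\<close>, and the right-hand side is symmetric in \<open>Z\<close> and \<open>W\<close>; so \<open>[Z, W]\<close> is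
  orthogonal to \<open>D1\<close>, and \<open>D2\<close> is involutive (\<open>perp_involutive\<close>).  For \<open>V, W\<close> in \<open>D1\<close> the images \<open>F\<^sub>*(RV)\<close> and
  \<open>F\<^sub>*(RW)\<close> vanish, so that \<open>(\<nabla>F\<^sub>*)(W, RV) - (\<nabla>F\<^sub>*)(V, RW) = F\<^sub>*(R[V, W])\<close> (\<open>sff_difference\<close>); only the
  \<open>D2\<close>-part \<open>w\<close> of \<open>[V, W]\<close> contributes, and \<open>F\<^sub>*(Rw)\<close> lies in \<open>F\<^sub>*\<mu>\<^sup>R\<close> only for \<open>w = 0\<close>.  Hence each of the three
  conditions says that \<open>D1\<close> is involutive (\<open>sff_condition_iff_integrable\<close>).

  The rest is Frobenius' theorem, in both directions, and the fact that \<open>D2\<close> is a smooth subbundle.  The latter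
  holds since \<open>D2\<close> is locally the kernel of a smooth family of linear maps of constant rank (\<open>kernel_frame\<close>).  That
  an integrable distribution is involutive is read off in slice charts (\<open>integrable_imp_involutive\<close>).

  For the converse (\<open>frobenius\<close>), represent the distribution in a chart as a graph over the coordinate directions
  \<open>E\<close>, with the frame \<open>a\<^sub>c\<close> lying above them.  The brackets \<open>[a\<^sub>c, a\<^sub>d]\<close> lie in the distribution and have no
  coordinates in \<open>E\<close>, so they vanish.  A slice chart is the inverse of a map \<open>\<Phi>\<close> with \<open>\<partial>\<^sub>c\<Phi> = a\<^sub>c \<circ> \<Phi>\<close> for all \<open>c\<close> in
  \<open>E\<close>.  Let \<open>m\<^sub>s\<close> multiply the coordinates in \<open>E\<close> by \<open>s\<close>, so that \<open>Q = m\<^sub>0\<close> is the projection along \<open>span E\<close>.  Following \<open>\<Phi>\<close>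
  along the segment from \<open>Q x\<close> to \<open>x\<close>, one is led to the single integral equation
  \<open>\<Phi>(x) = Q x + \<Sum>\<^sub>c x\<^sub>c \<integral>\<^sub>0\<^sup>1 a\<^sub>c(\<Phi>(m\<^sub>s x)) ds\<close>, which Picard iteration solves in \<open>C\<^sup>1\<close> (\<open>C1_fixed_point\<close>).  The derivatives
  of \<open>\<Phi>\<close> solve linear equations of the same kind, which makes \<open>\<Phi>\<close> smooth (\<open>linear_integral_Ck\<close>).  As the fields
  commute, \<open>a\<^sub>c \<circ> \<Phi>\<close> solves the same linear equation as \<open>\<partial>\<^sub>c\<Phi>\<close>, and uniqueness identifies them
  (\<open>commuting_fields_integrate\<close>).
\<close>

section \<open>Calculus of continuously differentiable maps\<close>

abbreviation ddir :: "'e::euclidean_space \<Rightarrow> ('e \<Rightarrow> 'v::real_normed_vector) \<Rightarrow> 'e \<Rightarrow> 'v" where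
  "ddir v f \<equiv> (\<lambda>x. frechet_derivative f (at x) v)"

lemma ddir_eq: "(f has_derivative f') (at x) \<Longrightarrow> ddir v f x = f' v"
  using frechet_derivative_at by metis

lemma Ck_on_subset: "Ck_on k S f \<Longrightarrow> T \<subseteq> S \<Longrightarrow> Ck_on k T f"
  by (induction k arbitrary: f) (auto intro: continuous_on_subset)

lemma frechet_derivative_cong_open:
  assumes "open S" "x \<in> S" "\<And>y. y \<in> S \<Longrightarrow> f y = g y"
  shows "frechet_derivative f (at x) = frechet_derivative g (at x)"
proof -
  have "(f has_derivative D) (at x) \<longleftrightarrow> (g has_derivative D) (at x)" for D
    using has_derivative_transform_within_open[OF _ assms(1,2)] assms(3) by metis
  then show ?thesis unfolding frechet_derivative_def by simp
qed

lemma Ck_on_has_derivative: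
  "Ck_on (Suc k) S f \<Longrightarrow> x \<in> S \<Longrightarrow> (f has_derivative frechet_derivative f (at x)) (at x)"
  using frechet_derivative_works by auto

lemma Ck_on_cong:
  assumes "open S" "\<And>x. x \<in> S \<Longrightarrow> f x = g x" "Ck_on k S f"
  shows "Ck_on k S g"
  using assms
proof (induction k arbitrary: f g)
  case 0
  then show ?case using continuous_on_cong by force
next
  case (Suc k)
  have "g differentiable at x" if "x \<in> S" for x
  proof -
    have "(f has_derivative frechet_derivative f (at x)) (at x)"
      using Ck_on_has_derivative[OF Suc.prems(3) that] .
    then show ?thesis
      using has_derivative_transform_within_open[OF _ Suc.prems(1) that] Suc.prems(2)
      unfolding differentiable_def by blast
  qed
  moreover have "Ck_on k S (ddir v g)" for v
  proof (rule Suc.IH[OF Suc.prems(1)])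
    show "ddir v f x = ddir v g x" if "x \<in> S" for x
      using frechet_derivative_cong_open[OF Suc.prems(1) that, of f g] Suc.prems(2) by simp
    show "Ck_on k S (ddir v f)" using Suc.prems by simp
  qed
  ultimately show ?case by simp
qed

lemma Ck_on_Suc_imp: "Ck_on (Suc k) S f \<Longrightarrow> Ck_on k S f"
proof (induction k arbitrary: f)
  case 0
  then show ?case
    by (auto intro!: continuous_at_imp_continuous_on differentiable_imp_continuous_within)
qed auto

lemma Ck_on_mono: "Ck_on k S f \<Longrightarrow> j \<le> k \<Longrightarrow> Ck_on j S f"
proof (induction k)
  case (Suc k)
  then show ?case using Ck_on_Suc_imp le_Suc_eq by metis
qed simp

lemma Ck_on_continuous: "Ck_on k S f \<Longrightarrow> continuous_on S f"
  using Ck_on_mono[of k S f 0] by simp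

lemma Ck_on_local:
  assumes "\<And>x. x \<in> S \<Longrightarrow> \<exists>T. open T \<and> x \<in> T \<and> Ck_on k T f"
  shows "Ck_on k S f"
  using assms
proof (induction k arbitrary: f)
  case 0
  show ?case
    unfolding Ck_on.simps
  proof (rule continuous_at_imp_continuous_on, rule ballI)
    fix x assume "x \<in> S"
    from 0[OF this] obtain T where "open T" "x \<in> T" "continuous_on T f" by auto
    then show "isCont f x" using continuous_on_eq_continuous_at by blast
  qed
next
  case (Suc k)
  have "f differentiable at x" if "x \<in> S" for x using Suc.prems[OF that] by auto
  moreover have "Ck_on k S (ddir v f)" for v
  proof (rule Suc.IH)
    fix x assume "x \<in> S"
    from Suc.prems[OF this] obtain T where "open T" "x \<in> T" "Ck_on (Suc k) T f" by blast
    then show "\<exists>T. open T \<and> x \<in> T \<and> Ck_on k T (ddir v f)" by auto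
  qed
  ultimately show ?case by simp
qed

lemma Ck_on_SucI:
  assumes "open S" "\<And>x. x \<in> S \<Longrightarrow> (f has_derivative f' x) (at x)" "\<And>v. Ck_on k S (\<lambda>x. f' x v)"
  shows "Ck_on (Suc k) S f"
proof -
  have "Ck_on k S (ddir v f)" for v
    by (rule Ck_on_cong[OF assms(1) _ assms(3)[of v]]) (simp add: ddir_eq[OF assms(2)])
  then show ?thesis using assms(2) by (auto simp: differentiable_def)
qed

lemma Ck_on_const [simp]: "Ck_on k S (\<lambda>x. c)"
  by (induction k arbitrary: c) auto

lemma Ck_on_add:
  assumes "open S" "Ck_on k S f" "Ck_on k S g"
  shows "Ck_on k S (\<lambda>x. f x + g x)"
  using assms(2,3)
proof (induction k arbitrary: f g)
  case 0
  then show ?case by (auto intro: continuous_on_add)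
next
  case (Suc k)
  show ?case
  proof (rule Ck_on_SucI[OF assms(1)])
    show "((\<lambda>x. f x + g x) has_derivative (\<lambda>v. ddir v f x + ddir v g x)) (at x)" if "x \<in> S" for x
      by (intro has_derivative_add Ck_on_has_derivative[OF Suc.prems(1) that]
          Ck_on_has_derivative[OF Suc.prems(2) that])
    show "Ck_on k S (\<lambda>x. ddir v f x + ddir v g x)" for v
      using Suc.prems by (intro Suc.IH) auto
  qed
qed

lemma Ck_on_bilinear:
  assumes "bounded_bilinear pr" and S: "open S" and "Ck_on k S f" "Ck_on k S g"
  shows "Ck_on k S (\<lambda>x. pr (f x) (g x))"
  using assms(3,4)
proof (induction k arbitrary: f g)
  case 0
  then show ?case using bounded_bilinear.continuous_on[OF assms(1)] by auto
next
  case (Suc k)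
  show ?case
  proof (rule Ck_on_SucI[OF S])
    show "((\<lambda>x. pr (f x) (g x)) has_derivative
        (\<lambda>v. pr (f x) (ddir v g x) + pr (ddir v f x) (g x))) (at x)" if "x \<in> S" for x
      by (intro bounded_bilinear.FDERIV[OF assms(1)] Ck_on_has_derivative[OF Suc.prems(1) that]
          Ck_on_has_derivative[OF Suc.prems(2) that])
    show "Ck_on k S (\<lambda>x. pr (f x) (ddir v g x) + pr (ddir v f x) (g x))" for v
      using Suc.prems Ck_on_Suc_imp[OF Suc.prems(1)] Ck_on_Suc_imp[OF Suc.prems(2)]
      by (intro Ck_on_add S Suc.IH) auto
  qed
qed

lemmas Ck_on_scaleR = Ck_on_bilinear[OF bounded_bilinear_scaleR]
lemmas Ck_on_mult = Ck_on_bilinear[OF bounded_bilinear_mult]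
lemmas Ck_on_inner = Ck_on_bilinear[OF bounded_bilinear_inner]

lemma Ck_on_sum:
  assumes "open S" "\<And>i. i \<in> I \<Longrightarrow> Ck_on k S (f i)"
  shows "Ck_on k S (\<lambda>x. \<Sum>i\<in>I. f i x)"
  using assms(2) by (induction I rule: infinite_finite_induct) (auto intro!: Ck_on_add[OF assms(1)])

lemma Ck_on_bounded_linear:
  assumes "bounded_linear h" "open S" "Ck_on k S f"
  shows "Ck_on k S (\<lambda>x. h (f x))"
  using assms(3)
proof (induction k arbitrary: f)
  case 0
  then show ?case using bounded_linear.continuous_on[OF assms(1)] by auto
next
  case (Suc k)
  show ?case
  proof (rule Ck_on_SucI[OF assms(2)])
    show "((\<lambda>x. h (f x)) has_derivative (\<lambda>v. h (ddir v f x))) (at x)" if "x \<in> S" for x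
      by (intro bounded_linear.has_derivative[OF assms(1)] Ck_on_has_derivative[OF Suc.prems that])
    show "Ck_on k S (\<lambda>x. h (ddir v f x))" for v
      using Suc.prems by (intro Suc.IH) auto
  qed
qed

lemma Ck_on_ident [simp]: "Ck_on k S (\<lambda>x. x)"
  by (cases k) auto

lemma Ck_on_linear: "linear h \<Longrightarrow> open S \<Longrightarrow> Ck_on k S f \<Longrightarrow> Ck_on k S (\<lambda>x. h (f x))"
  for f :: "'e::euclidean_space \<Rightarrow> 'v::euclidean_space"
  by (rule Ck_on_bounded_linear) (auto simp: linear_conv_bounded_linear)

lemma Ck_on_minus: "open S \<Longrightarrow> Ck_on k S f \<Longrightarrow> Ck_on k S (\<lambda>x. - f x)"
  using Ck_on_bounded_linear[OF bounded_linear_minus[OF bounded_linear_ident]] by auto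

lemma Ck_on_diff: "open S \<Longrightarrow> Ck_on k S f \<Longrightarrow> Ck_on k S g \<Longrightarrow> Ck_on k S (\<lambda>x. f x - g x)"
  using Ck_on_add[OF _ _ Ck_on_minus] by fastforce

lemma linear_Basis_expansion:
  fixes u :: "'e::euclidean_space"
  assumes "linear h"
  shows "h u = (\<Sum>b\<in>Basis. (u \<bullet> b) *\<^sub>R h b)"
proof -
  have "h u = h (\<Sum>b\<in>Basis. (u \<bullet> b) *\<^sub>R b)" by (simp only: euclidean_representation)
  then show ?thesis by (simp only: linear_sum[OF assms] linear_scale[OF assms])
qed

lemma norm_Basis_combination_le:
  fixes u :: "'e::euclidean_space" and z :: "'e \<Rightarrow> 'v::real_normed_vector"
  shows "norm (\<Sum>i\<in>Basis. (u \<bullet> i) *\<^sub>R z i) \<le> (\<Sum>i\<in>Basis. norm (z i)) * norm u"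
  unfolding sum_distrib_right
proof (rule order_trans[OF norm_sum], rule sum_mono)
  fix i :: 'e assume "i \<in> Basis"
  from mult_left_mono[OF Basis_le_norm[OF this, of u] norm_ge_zero[of "z i"]]
  show "norm ((u \<bullet> i) *\<^sub>R z i) \<le> norm (z i) * norm u" by (simp add: mult.commute)
qed

lemma norm_Basis_combination_bound:
  fixes u :: "'e::euclidean_space" and z :: "'e \<Rightarrow> 'v::real_normed_vector"
  assumes "\<And>i. i \<in> Basis \<Longrightarrow> norm (z i) \<le> K"
  shows "norm (\<Sum>i\<in>Basis. (u \<bullet> i) *\<^sub>R z i) \<le> real DIM('e) * K * norm u"
  by (rule order_trans[OF norm_Basis_combination_le mult_right_mono[OF sum_bounded_above norm_ge_zero]]) (rule assms)

text \<open>Expanding the argument in a basis reduces \<open>x \<mapsto> L x (f x)\<close> to sums and products.  Derivatives of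
  composites, \<open>x \<mapsto> Dg(f x)(h x)\<close>, have this form.\<close>

lemma Ck_on_linear_family:
  fixes L :: "'e::euclidean_space \<Rightarrow> 'w::euclidean_space \<Rightarrow> 'v::real_normed_vector"
  assumes S: "open S" and lin: "\<And>x. x \<in> S \<Longrightarrow> linear (L x)"
    and L: "\<And>b. b \<in> Basis \<Longrightarrow> Ck_on k S (\<lambda>x. L x b)" and f: "Ck_on k S f"
  shows "Ck_on k S (\<lambda>x. L x (f x))"
proof (rule Ck_on_cong[OF S])
  show "(\<Sum>b\<in>Basis. (f x \<bullet> b) *\<^sub>R L x b) = L x (f x)" if "x \<in> S" for x
    by (rule linear_Basis_expansion[OF lin[OF that], symmetric])
  show "Ck_on k S (\<lambda>x. \<Sum>b\<in>Basis. (f x \<bullet> b) *\<^sub>R L x b)"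
    using assms by (intro Ck_on_sum Ck_on_scaleR Ck_on_inner) auto
qed

lemma Ck_on_Suc_BasisI:
  fixes f :: "'e::euclidean_space \<Rightarrow> 'v::real_normed_vector"
  assumes S: "open S" and f: "\<And>x. x \<in> S \<Longrightarrow> (f has_derivative f' x) (at x)"
    and "\<And>b. b \<in> Basis \<Longrightarrow> Ck_on k S (\<lambda>x. f' x b)"
  shows "Ck_on (Suc k) S f"
proof (rule Ck_on_SucI[OF S f])
  show "Ck_on k S (\<lambda>x. f' x v)" for v
    by (rule Ck_on_linear_family[OF S has_derivative_linear[OF f] assms(3) Ck_on_const])
qed

lemma Ck_on_compose:
  fixes f :: "'e::euclidean_space \<Rightarrow> 'f::euclidean_space" and g :: "'f \<Rightarrow> 'v::real_normed_vector"
  assumes S: "open S" and "Ck_on k T g" "Ck_on k S f" "f ` S \<subseteq> T"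
  shows "Ck_on k S (\<lambda>x. g (f x))"
  using assms(2,3)
proof (induction k arbitrary: g)
  case 0
  then show ?case using continuous_on_compose2[OF _ _ assms(4)] by auto
next
  case (Suc k)
  have fT: "f x \<in> T" if "x \<in> S" for x using that assms(4) by auto
  show ?case
  proof (rule Ck_on_SucI[OF S])
    show "((\<lambda>x. g (f x)) has_derivative (\<lambda>v. ddir (ddir v f x) g (f x))) (at x)" if "x \<in> S" for x
      using diff_chain_at[OF Ck_on_has_derivative[OF Suc.prems(2) that]
          Ck_on_has_derivative[OF Suc.prems(1) fT[OF that]]] by (simp add: o_def)
    show "Ck_on k S (\<lambda>x. ddir (ddir v f x) g (f x))" for v
    proof (rule Ck_on_linear_family[OF S])
      show "linear (\<lambda>w. ddir w g (f x))" if "x \<in> S" for x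
        using Suc.prems(1) fT[OF that] by (auto intro: linear_frechet_derivative)
      show "Ck_on k S (\<lambda>x. ddir b g (f x))" for b
        using Suc.prems Ck_on_Suc_imp[OF Suc.prems(2)] by (intro Suc.IH) auto
      show "Ck_on k S (ddir v f)" using Suc.prems by auto
    qed
  qed
qed

lemma Ck_on_Pair:
  fixes f :: "'e::euclidean_space \<Rightarrow> 'v::euclidean_space" and g :: "'e \<Rightarrow> 'w::euclidean_space"
  assumes "open S" "Ck_on k S f" "Ck_on k S g"
  shows "Ck_on k S (\<lambda>x. (f x, g x))"
proof -
  have "Ck_on k S (\<lambda>x. (f x, 0) + (0, g x))"
    using assms by (intro Ck_on_add Ck_on_bounded_linear[where h = "\<lambda>v. (v, 0)"]
        Ck_on_bounded_linear[where h = "\<lambda>v. (0, v)"])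
      (auto intro!: bounded_linear_Pair bounded_linear_ident bounded_linear_zero)
  then show ?thesis by simp
qed

lemma smooth_onI: "(\<And>k. Ck_on k S f) \<Longrightarrow> smooth_on S f" by (simp add: smooth_on_def)

lemma smooth_onD: "smooth_on S f \<Longrightarrow> Ck_on k S f" by (simp add: smooth_on_def)

lemma smooth_on_subset: "smooth_on S f \<Longrightarrow> T \<subseteq> S \<Longrightarrow> smooth_on T f"
  unfolding smooth_on_def using Ck_on_subset by blast

lemma smooth_on_cong: "open S \<Longrightarrow> (\<And>x. x \<in> S \<Longrightarrow> f x = g x) \<Longrightarrow> smooth_on S f \<Longrightarrow> smooth_on S g"
  unfolding smooth_on_def using Ck_on_cong by metis

lemma smooth_on_local:
  assumes "\<And>x. x \<in> S \<Longrightarrow> \<exists>T. open T \<and> x \<in> T \<and> smooth_on T f"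
  shows "smooth_on S f"
proof (intro smooth_onI Ck_on_local)
  fix k x assume "x \<in> S"
  from assms[OF this] obtain T where "open T" "x \<in> T" "smooth_on T f" by blast
  then show "\<exists>T. open T \<and> x \<in> T \<and> Ck_on k T f" using smooth_onD by blast
qed

lemma smooth_on_has_derivative:
  "smooth_on S f \<Longrightarrow> x \<in> S \<Longrightarrow> (f has_derivative frechet_derivative f (at x)) (at x)"
  using smooth_onD Ck_on_has_derivative by blast

lemma smooth_on_ddir: "smooth_on S f \<Longrightarrow> smooth_on S (ddir v f)"
  unfolding smooth_on_def using Ck_on.simps(2) by blast

lemma smooth_on_const: "smooth_on S (\<lambda>x. c)" by (simp add: smooth_on_def)
lemma smooth_on_ident: "smooth_on S (\<lambda>x. x)" by (simp add: smooth_on_def)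

lemma smooth_on_add:
  "open S \<Longrightarrow> smooth_on S f \<Longrightarrow> smooth_on S g \<Longrightarrow> smooth_on S (\<lambda>x. f x + g x)"
  by (simp add: smooth_on_def Ck_on_add)
lemma smooth_on_diff:
  "open S \<Longrightarrow> smooth_on S f \<Longrightarrow> smooth_on S g \<Longrightarrow> smooth_on S (\<lambda>x. f x - g x)"
  by (simp add: smooth_on_def Ck_on_diff)
lemma smooth_on_scaleR:
  "open S \<Longrightarrow> smooth_on S f \<Longrightarrow> smooth_on S g \<Longrightarrow> smooth_on S (\<lambda>x. f x *\<^sub>R g x)"
  by (simp add: smooth_on_def Ck_on_scaleR)
lemma smooth_on_inner:
  "open S \<Longrightarrow> smooth_on S f \<Longrightarrow> smooth_on S g \<Longrightarrow> smooth_on S (\<lambda>x. f x \<bullet> g x)"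
  by (simp add: smooth_on_def Ck_on_inner)
lemma smooth_on_sum:
  "open S \<Longrightarrow> (\<And>i. i \<in> I \<Longrightarrow> smooth_on S (f i)) \<Longrightarrow> smooth_on S (\<lambda>x. \<Sum>i\<in>I. f i x)"
  by (simp add: smooth_on_def Ck_on_sum)
lemma smooth_on_linear:
  fixes f :: "'e::euclidean_space \<Rightarrow> 'v::euclidean_space"
  shows "linear h \<Longrightarrow> open S \<Longrightarrow> smooth_on S f \<Longrightarrow> smooth_on S (\<lambda>x. h (f x))"
  by (simp add: smooth_on_def Ck_on_linear)
lemma smooth_on_linear_family:
  fixes L :: "'e::euclidean_space \<Rightarrow> 'w::euclidean_space \<Rightarrow> 'v::real_normed_vector"
  assumes "open S" and "\<And>x. x \<in> S \<Longrightarrow> linear (L x)"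
    and "\<And>b. b \<in> Basis \<Longrightarrow> smooth_on S (\<lambda>x. L x b)" and "smooth_on S f"
  shows "smooth_on S (\<lambda>x. L x (f x))"
proof (rule smooth_onI)
  show "Ck_on k S (\<lambda>x. L x (f x))" for k
    by (rule Ck_on_linear_family[OF assms(1,2) smooth_onD[OF assms(3)] smooth_onD[OF assms(4)]])
qed
lemma smooth_on_compose:
  fixes f :: "'e::euclidean_space \<Rightarrow> 'f::euclidean_space" and g :: "'f \<Rightarrow> 'v::real_normed_vector"
  assumes "open S" "smooth_on T g" "smooth_on S f" "f ` S \<subseteq> T"
  shows "smooth_on S (\<lambda>x. g (f x))"
  using assms Ck_on_compose[OF assms(1) _ _ assms(4)] unfolding smooth_on_def by blast
lemma smooth_on_Pair:
  fixes f :: "'e::euclidean_space \<Rightarrow> 'v::euclidean_space" and g :: "'e \<Rightarrow> 'w::euclidean_space"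
  shows "open S \<Longrightarrow> smooth_on S f \<Longrightarrow> smooth_on S g \<Longrightarrow> smooth_on S (\<lambda>x. (f x, g x))"
  by (simp add: smooth_on_def Ck_on_Pair)

section \<open>Integrals along rays\<close>

text \<open>The map \<open>m\<^sub>s\<close>: it multiplies the coordinates in \<open>E\<close> by \<open>s\<close>.  For \<open>s\<close> from \<open>0\<close> to \<open>1\<close> the point \<open>m\<^sub>s x\<close> runs along the
  segment (the ray) from the projection \<open>Q x = m\<^sub>0 x\<close> to \<open>x\<close>.\<close>

definition contr :: "'e::euclidean_space set \<Rightarrow> real \<Rightarrow> 'e \<Rightarrow> 'e" where
  "contr E s x = (\<Sum>b\<in>Basis. ((if b \<in> E then s else 1) * (x \<bullet> b)) *\<^sub>R b)"

lemma contr_inner: "b \<in> Basis \<Longrightarrow> contr E s x \<bullet> b = (if b \<in> E then s else 1) * (x \<bullet> b)"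
  by (simp add: contr_def inner_sum_left_Basis)

lemma contr_1 [simp]: "contr E 1 x = x"
  by (rule euclidean_eqI) (simp add: contr_inner)

lemma contr_contr: "contr E s (contr E t x) = contr E (s * t) x"
  by (rule euclidean_eqI) (simp add: contr_inner)

lemma contr_zero [simp]: "contr E s 0 = 0"
  by (rule euclidean_eqI) (simp add: contr_inner)

lemma linear_contr: "linear (contr E s)"
  by (rule linearI; rule euclidean_eqI) (simp_all add: contr_inner algebra_simps)

lemma contr_Basis: "b \<in> Basis \<Longrightarrow> contr E s b = (if b \<in> E then s else 1) *\<^sub>R b"
  by (rule euclidean_eqI) (auto simp: contr_inner inner_Basis)

lemma norm_contr_le: "0 \<le> s \<Longrightarrow> s \<le> 1 \<Longrightarrow> norm (contr E s x) \<le> norm x"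
  by (rule norm_le_componentwise) (auto simp: contr_inner abs_mult mult_left_le_one_le)

lemma contr_in_ball: "0 \<le> s \<Longrightarrow> s \<le> 1 \<Longrightarrow> x \<in> ball 0 \<delta> \<Longrightarrow> contr E s x \<in> ball 0 \<delta>"
  using norm_contr_le[of s E x] by auto

lemma continuous_on_contr [continuous_intros]:
  assumes "continuous_on S f" "continuous_on S g"
  shows "continuous_on S (\<lambda>x. contr E (f x) (g x))"
proof -
  have "continuous_on S (\<lambda>x. (if b \<in> E then f x else 1) * (g x \<bullet> b))" for b
    using assms by (cases "b \<in> E") (auto intro!: continuous_intros)
  then show ?thesis unfolding contr_def
    by (intro continuous_on_sum continuous_on_scaleR continuous_on_const)
qed

lemma continuous_on_contracted:
  assumes "continuous_on (ball 0 \<delta>) f"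
  shows "continuous_on (ball 0 \<delta> \<times> {0..1}) (\<lambda>p. f (contr E (snd p) (fst p)))"
proof (rule continuous_on_compose2[OF assms])
  show "continuous_on (ball 0 \<delta> \<times> {0..1}) (\<lambda>p::'a \<times> real. contr E (snd p) (fst p))"
    by (rule continuous_on_contr[OF continuous_on_snd[OF continuous_on_id] continuous_on_fst[OF continuous_on_id]])
  show "(\<lambda>p. contr E (snd p) (fst p)) ` (ball 0 \<delta> \<times> {0..1}) \<subseteq> ball 0 \<delta>"
  proof (rule image_subsetI)
    fix p :: "'a \<times> real" assume "p \<in> ball 0 \<delta> \<times> {0..1}"
    then show "contr E (snd p) (fst p) \<in> ball 0 \<delta>"
      using contr_in_ball[of "snd p" "fst p" \<delta> E] by (cases p) simp
  qed
qed

text \<open>The weight \<open>s\<^sup>j\<close> makes the operators closed under differentiation: a derivative in a direction of \<open>E\<close>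
  turns \<open>f \<circ> m\<^sub>s\<close> into \<open>s\<close> times the derivative of \<open>f\<close> and so raises \<open>j\<close> by one (see \<open>ray_int_ddir\<close>).\<close>

definition ray_int :: "'e::euclidean_space set \<Rightarrow> nat \<Rightarrow> ('e \<Rightarrow> 'w::euclidean_space) \<Rightarrow> 'e \<Rightarrow> 'w" where
  "ray_int E j f x = integral {0..1} (\<lambda>s. s ^ j *\<^sub>R f (contr E s x))"

lemma ray_int_integrand_continuous:
  fixes f :: "'e::euclidean_space \<Rightarrow> 'w::euclidean_space"
  assumes "continuous_on (ball 0 \<delta>) f" "x \<in> ball 0 \<delta>"
  shows "continuous_on {0..1} (\<lambda>s. s ^ j *\<^sub>R f (contr E s x))"
proof (rule continuous_on_scaleR)
  show "continuous_on {0..1} (\<lambda>s. f (contr E s x))"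
    by (rule continuous_on_compose2[OF assms(1)])
      (use contr_in_ball[OF _ _ assms(2)] in \<open>auto intro!: continuous_intros\<close>)
qed (intro continuous_intros)

lemma ray_int_integrable:
  fixes f :: "'e::euclidean_space \<Rightarrow> 'w::euclidean_space"
  assumes "continuous_on (ball 0 \<delta>) f" "x \<in> ball 0 \<delta>"
  shows "(\<lambda>s. s ^ j *\<^sub>R f (contr E s x)) integrable_on {0..1}"
  by (rule integrable_continuous_interval[OF ray_int_integrand_continuous[OF assms]])

lemma ray_int_cong:
  assumes "\<And>y. y \<in> ball 0 \<delta> \<Longrightarrow> f y = g y" "x \<in> ball 0 \<delta>"
  shows "ray_int E j f x = ray_int E j g x"
  unfolding ray_int_def using contr_in_ball[OF _ _ assms(2)] assms(1)
  by (intro integral_cong) auto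

lemma ray_int_bound:
  assumes "continuous_on (ball 0 \<delta>) f" "x \<in> ball 0 \<delta>" "\<And>y. y \<in> ball 0 \<delta> \<Longrightarrow> norm (f y) \<le> D"
  shows "norm (ray_int E j f x) \<le> D"
proof -
  have "norm (integral (cbox 0 1) (\<lambda>s. s ^ j *\<^sub>R f (contr E s x))) \<le> D * Henstock_Kurzweil_Integration.content (cbox 0 (1::real))"
  proof (rule integrable_bound)
    show "0 \<le> D" using order_trans[OF norm_ge_zero assms(3)[OF assms(2)]] .
    show "(\<lambda>s. s ^ j *\<^sub>R f (contr E s x)) integrable_on cbox 0 1"
      using ray_int_integrable[OF assms(1,2)] by simp
    fix s :: real assume "s \<in> cbox 0 1"
    then have s: "0 \<le> s" "s \<le> 1" by auto
    have "\<bar>s\<bar> ^ j * norm (f (contr E s x)) \<le> 1 * D"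
      using s assms(3)[OF contr_in_ball[OF s assms(2)]] by (intro mult_mono) (auto simp: power_le_one)
    then show "norm (s ^ j *\<^sub>R f (contr E s x)) \<le> D" by (simp add: power_abs)
  qed
  then show ?thesis by (simp add: ray_int_def)
qed

lemma ray_int_diff:
  assumes "continuous_on (ball 0 \<delta>) f" "continuous_on (ball 0 \<delta>) g" "x \<in> ball 0 \<delta>"
  shows "ray_int E j (\<lambda>y. f y - g y) x = ray_int E j f x - ray_int E j g x"
  unfolding ray_int_def scaleR_diff_right
  by (rule integral_diff) (rule ray_int_integrable; fact)+

lemma ray_int_add:
  assumes "continuous_on (ball 0 \<delta>) f" "continuous_on (ball 0 \<delta>) g" "x \<in> ball 0 \<delta>"
  shows "ray_int E j (\<lambda>y. f y + g y) x = ray_int E j f x + ray_int E j g x"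
  unfolding ray_int_def scaleR_add_right
  by (rule integral_add) (rule ray_int_integrable; fact)+

lemma ray_int_continuous:
  assumes "continuous_on (ball 0 \<delta>) f"
  shows "continuous_on (ball 0 \<delta>) (ray_int E j f)"
proof -
  have "continuous_on (ball 0 \<delta>) (\<lambda>x. integral (cbox 0 1) (\<lambda>s. s ^ j *\<^sub>R f (contr E s x)))"
  proof (rule integral_continuous_on_param)
    have "continuous_on (ball 0 \<delta> \<times> cbox 0 1) (\<lambda>p. f (contr E (snd p) (fst p)))"
      unfolding cbox_interval by (rule continuous_on_contracted[OF assms])
    then show "continuous_on (ball 0 \<delta> \<times> cbox 0 1) (\<lambda>(x, s). s ^ j *\<^sub>R f (contr E s x))"
      unfolding case_prod_beta by (intro continuous_on_scaleR continuous_intros)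
  qed
  then show ?thesis by (simp add: ray_int_def[abs_def])
qed

abbreviation shift :: "'e set \<Rightarrow> 'e \<Rightarrow> nat \<Rightarrow> nat" where
  "shift E v j \<equiv> (if v \<in> E then Suc j else j)"

text \<open>Differentiation under the integral sign.\<close>

lemma ray_int_has_derivative:
  fixes f :: "'e::euclidean_space \<Rightarrow> 'w::euclidean_space"
  assumes f: "Ck_on (Suc 0) (ball 0 \<delta>) f" and x: "x \<in> ball 0 \<delta>"
  shows "(ray_int E j f has_derivative
    (\<lambda>v. \<Sum>b\<in>Basis. (v \<bullet> b) *\<^sub>R ray_int E (shift E b j) (ddir b f) x)) (at x)"
proof -
  define fx where "fx y s = Blinfun (\<lambda>v. s ^ j *\<^sub>R frechet_derivative f (at (contr E s y)) (contr E s v))" for y s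
  have der: "((\<lambda>y. s ^ j *\<^sub>R f (contr E s y)) has_derivative
      (\<lambda>v. s ^ j *\<^sub>R frechet_derivative f (at (contr E s y)) (contr E s v))) (at y)"
    if y: "y \<in> ball 0 \<delta>" and s: "0 \<le> s" "s \<le> 1" for y s
  proof -
    have l: "(contr E s has_derivative contr E s) (at y)"
      by (rule linear_imp_has_derivative[OF linear_contr])
    have "(f has_derivative frechet_derivative f (at (contr E s y))) (at (contr E s y))"
      by (rule Ck_on_has_derivative[OF f contr_in_ball[OF s y]])
    from diff_chain_at[OF l this] show ?thesis
      by (intro has_derivative_scaleR_right) (simp add: o_def)
  qed
  have fx: "blinfun_apply (fx y s) v = s ^ j *\<^sub>R frechet_derivative f (at (contr E s y)) (contr E s v)"
    if y: "y \<in> ball 0 \<delta>" and s: "0 \<le> s" "s \<le> 1" for y s v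
    unfolding fx_def bounded_linear_Blinfun_apply[OF has_derivative_bounded_linear[OF der[OF that]]] ..
  have fxb: "blinfun_apply (fx y s) b = s ^ shift E b j *\<^sub>R ddir b f (contr E s y)"
    if y: "y \<in> ball 0 \<delta>" and s: "0 \<le> s" "s \<le> 1" and b: "b \<in> Basis" for y s b
  proof -
    have "linear (frechet_derivative f (at (contr E s y)))"
      by (rule has_derivative_linear[OF Ck_on_has_derivative[OF f contr_in_ball[OF s y]]])
    from linear_scale[OF this] show ?thesis using fx[OF y s, of b] by (simp add: contr_Basis[OF b])
  qed
  have cb: "continuous_on (ball 0 \<delta>) (ddir b f)" for b using f by auto
  have cont: "continuous_on (ball 0 \<delta> \<times> cbox 0 1) (\<lambda>(y, s). fx y s)"
  proof (rule continuous_on_blinfun_componentwise)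
    fix b :: 'e assume b: "b \<in> Basis"
    have "continuous_on (ball 0 \<delta> \<times> {0..1}) (\<lambda>p. snd p ^ shift E b j *\<^sub>R ddir b f (contr E (snd p) (fst p)))"
    proof (rule continuous_on_scaleR)
      show "continuous_on (ball 0 \<delta> \<times> {0..1}) (\<lambda>p. ddir b f (contr E (snd p) (fst p)))"
        by (rule continuous_on_contracted[OF cb])
    qed (intro continuous_intros)
    then show "continuous_on (ball 0 \<delta> \<times> cbox 0 1) (\<lambda>p. blinfun_apply (case p of (y, s) \<Rightarrow> fx y s) b)"
      unfolding cbox_interval
    proof (rule continuous_on_eq)
      fix p :: "'e \<times> real" assume "p \<in> ball 0 \<delta> \<times> {0..1}"
      then have p: "fst p \<in> ball 0 \<delta>" "0 \<le> snd p" "snd p \<le> 1" by auto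
      show "snd p ^ shift E b j *\<^sub>R ddir b f (contr E (snd p) (fst p))
          = blinfun_apply (case p of (y, s) \<Rightarrow> fx y s) b"
        using fxb[OF p b] by (simp add: case_prod_beta)
    qed
  qed
  have int: "(\<lambda>s. s ^ j *\<^sub>R f (contr E s y)) integrable_on cbox 0 1" if "y \<in> ball 0 \<delta>" for y
    using ray_int_integrable[OF Ck_on_continuous[OF f] that] by simp
  have lr: "((\<lambda>y. integral (cbox 0 1) (\<lambda>s. s ^ j *\<^sub>R f (contr E s y))) has_derivative
      blinfun_apply (integral (cbox 0 1) (fx x))) (at x within ball 0 \<delta>)"
  proof (rule leibniz_rule[OF _ int cont x])
    fix y and s :: real assume y: "y \<in> ball (0::'e) \<delta>" and "s \<in> cbox 0 1"
    then have s: "0 \<le> s" "s \<le> 1" by simp_all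
    have "blinfun_apply (fx y s) = (\<lambda>v. s ^ j *\<^sub>R frechet_derivative f (at (contr E s y)) (contr E s v))"
      by (rule ext) (rule fx[OF y s])
    then show "((\<lambda>y. s ^ j *\<^sub>R f (contr E s y)) has_derivative blinfun_apply (fx y s)) (at y within ball 0 \<delta>)"
      using has_derivative_at_withinI[OF der[OF y s]] by (simp only:)
  qed (simp_all add: convex_ball)
  have at: "at x within ball 0 \<delta> = at x" by (rule at_within_open[OF x open_ball])
  have "blinfun_apply (integral (cbox 0 1) (fx x)) v
      = (\<Sum>b\<in>Basis. (v \<bullet> b) *\<^sub>R ray_int E (shift E b j) (ddir b f) x)" for v
  proof -
    let ?I = "integral (cbox 0 1) (fx x)"
    have "continuous_on (cbox 0 1) (\<lambda>s. case (x, s) of (y, s) \<Rightarrow> fx y s)"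
    proof (rule continuous_on_compose2[OF cont])
      show "continuous_on (cbox 0 1) (Pair x)" by (intro continuous_intros)
      show "Pair x ` cbox 0 1 \<subseteq> ball 0 \<delta> \<times> cbox 0 1" using x by auto
    qed
    then have ci: "fx x integrable_on cbox 0 1" unfolding prod.case by (rule integrable_continuous)
    have Ib: "blinfun_apply ?I b = ray_int E (shift E b j) (ddir b f) x" if b: "b \<in> Basis" for b
    proof -
      have "integral (cbox 0 1) ((\<lambda>T. blinfun_apply T b) \<circ> fx x) = blinfun_apply ?I b"
        by (rule integral_linear[OF ci]) (rule blinfun.bounded_linear_left)
      moreover have "integral (cbox 0 1) ((\<lambda>T. blinfun_apply T b) \<circ> fx x)
          = integral (cbox 0 1) (\<lambda>s. s ^ shift E b j *\<^sub>R ddir b f (contr E s x))"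
      proof (rule integral_cong)
        fix s :: real assume "s \<in> cbox 0 1"
        then have "0 \<le> s" "s \<le> 1" by simp_all
        then show "((\<lambda>T. blinfun_apply T b) \<circ> fx x) s = s ^ shift E b j *\<^sub>R ddir b f (contr E s x)"
          unfolding o_def by (rule fxb[OF x _ _ b])
      qed
      ultimately show ?thesis unfolding ray_int_def cbox_interval by (rule trans[OF sym])
    qed
    have "blinfun_apply ?I v = blinfun_apply ?I (\<Sum>b\<in>Basis. (v \<bullet> b) *\<^sub>R b)"
      by (simp only: euclidean_representation)
    also have "\<dots> = (\<Sum>b\<in>Basis. (v \<bullet> b) *\<^sub>R blinfun_apply ?I b)"
      by (simp only: blinfun.sum_right blinfun.scaleR_right)
    also have "\<dots> = (\<Sum>b\<in>Basis. (v \<bullet> b) *\<^sub>R ray_int E (shift E b j) (ddir b f) x)"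
      by (rule sum.cong[OF refl]) (simp only: Ib)
    finally show ?thesis .
  qed
  then have "blinfun_apply (integral (cbox 0 1) (fx x))
      = (\<lambda>v. \<Sum>b\<in>Basis. (v \<bullet> b) *\<^sub>R ray_int E (shift E b j) (ddir b f) x)"
    by (rule ext)
  moreover have "(\<lambda>y. integral (cbox 0 1) (\<lambda>s. s ^ j *\<^sub>R f (contr E s y))) = ray_int E j f"
    unfolding cbox_interval ray_int_def[abs_def] ..
  ultimately show ?thesis using lr unfolding at by (simp only:)
qed

lemma ray_int_ddir:
  assumes "Ck_on (Suc 0) (ball 0 \<delta>) f" "x \<in> ball 0 \<delta>" "b \<in> Basis"
  shows "ddir b (ray_int E j f) x = ray_int E (shift E b j) (ddir b f) x"
proof -
  have "ddir b (ray_int E j f) x = (\<Sum>b'\<in>Basis. (b \<bullet> b') *\<^sub>R ray_int E (shift E b' j) (ddir b' f) x)"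
    by (rule ddir_eq[OF ray_int_has_derivative[OF assms(1,2)]])
  also have "\<dots> = (\<Sum>b'\<in>Basis. if b' = b then ray_int E (shift E b j) (ddir b f) x else 0)"
    by (rule sum.cong) (use assms(3) in \<open>auto simp: inner_Basis\<close>)
  finally show ?thesis using assms(3) by simp
qed

lemma ray_int_Ck_on:
  "Ck_on k (ball 0 \<delta>) f \<Longrightarrow> Ck_on k (ball 0 \<delta>) (ray_int E j f)"
proof (induction k arbitrary: f j)
  case 0
  then show ?case using ray_int_continuous by auto
next
  case (Suc k)
  have f1: "Ck_on (Suc 0) (ball 0 \<delta>) f" by (rule Ck_on_mono[OF Suc.prems]) simp
  show ?case
  proof (rule Ck_on_SucI[OF open_ball ray_int_has_derivative[OF f1]])
    show "Ck_on k (ball 0 \<delta>) (\<lambda>x. \<Sum>b\<in>Basis. (v \<bullet> b) *\<^sub>R ray_int E (shift E b j) (ddir b f) x)" for v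
      using Suc.prems by (intro Ck_on_sum Ck_on_scaleR Suc.IH open_ball Ck_on_const) auto
  qed
qed

text \<open>For \<open>j = 0\<close> this is the integral of the one-form \<open>\<Sum>\<^sub>c H\<^sub>c dx\<^sub>c\<close>, with \<open>c\<close> ranging over \<open>E\<close>, along the ray ending in \<open>x\<close>.\<close>

abbreviation ray_sum ::
  "'e::euclidean_space set \<Rightarrow> nat \<Rightarrow> ('e \<Rightarrow> 'e \<Rightarrow> 'w::euclidean_space) \<Rightarrow> 'e \<Rightarrow> 'w" where
  "ray_sum E j H x \<equiv> (\<Sum>c\<in>E. (x \<bullet> c) *\<^sub>R ray_int E j (H c) x)"

lemma ray_int_sum_diff_bound:
  fixes E :: "'e::euclidean_space set" and \<delta> D :: real and f g :: "'e \<Rightarrow> 'e \<Rightarrow> 'w::euclidean_space"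
  assumes E: "E \<subseteq> Basis" and x: "x \<in> ball 0 \<delta>"
    and f: "\<And>c. c \<in> E \<Longrightarrow> continuous_on (ball 0 \<delta>) (f c)"
    and g: "\<And>c. c \<in> E \<Longrightarrow> continuous_on (ball 0 \<delta>) (g c)"
    and D: "\<And>c y. c \<in> E \<Longrightarrow> y \<in> ball 0 \<delta> \<Longrightarrow> norm (f c y - g c y) \<le> D"
  shows "norm (ray_sum E j f x - ray_sum E j g x)
    \<le> card E * \<delta> * D"
proof -
  have "norm (ray_sum E j f x - ray_sum E j g x)
    = norm (ray_sum E j (\<lambda>c y. f c y - g c y) x)"
    by (simp add: ray_int_diff[OF f g x] sum_subtractf[symmetric] scaleR_diff_right)
  also have "\<dots> \<le> (\<Sum>c\<in>E. \<delta> * D)"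
  proof (rule order_trans[OF norm_sum], rule sum_mono)
    fix c assume c: "c \<in> E"
    have "norm (ray_int E j (\<lambda>y. f c y - g c y) x) \<le> D"
      by (rule ray_int_bound[OF _ x]) (use c f g D in \<open>auto intro!: continuous_intros\<close>)
    moreover have "\<bar>x \<bullet> c\<bar> \<le> \<delta>" using Basis_le_norm[of c x] c E x by auto
    ultimately show "norm ((x \<bullet> c) *\<^sub>R ray_int E j (\<lambda>y. f c y - g c y) x) \<le> \<delta> * D"
      by (auto intro!: mult_mono)
  qed
  finally show ?thesis by simp
qed

lemma ray_int_sum_bound:
  fixes E :: "'e::euclidean_space set" and \<delta> D :: real and f :: "'e \<Rightarrow> 'e \<Rightarrow> 'w::euclidean_space"
  assumes E: "E \<subseteq> Basis" and x: "x \<in> ball 0 \<delta>"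
    and f: "\<And>c. c \<in> E \<Longrightarrow> continuous_on (ball 0 \<delta>) (f c)"
    and D: "\<And>c y. c \<in> E \<Longrightarrow> y \<in> ball 0 \<delta> \<Longrightarrow> norm (f c y) \<le> D"
  shows "norm (ray_sum E j f x) \<le> card E * \<delta> * D"
proof -
  have "ray_int E j (\<lambda>y. 0::'w) x = 0" by (simp add: ray_int_def)
  then show ?thesis
    using ray_int_sum_diff_bound[OF E x, where f = f and g = "\<lambda>c y. 0" and D = D and j = j] D f by simp
qed

section \<open>Integral equations along rays\<close>

lemma geometric_uniform_limit:
  fixes f :: "nat \<Rightarrow> 'a \<Rightarrow> 'w::banach"
  assumes "\<And>n x. x \<in> S \<Longrightarrow> norm (f (Suc n) x - f n x) \<le> K / 2 ^ n"
  obtains g where "\<And>n x. x \<in> S \<Longrightarrow> norm (f n x - g x) \<le> 2 * K / 2 ^ n"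
    "uniform_limit S f g sequentially"
proof -
  have tel: "norm (f (n + d) x - f n x) \<le> 2 * K / 2 ^ n - 2 * K / 2 ^ (n + d)" if x: "x \<in> S" for n d x
  proof (induction d)
    case (Suc d)
    have "norm (f (n + Suc d) x - f n x)
        \<le> norm (f (Suc (n + d)) x - f (n + d) x) + norm (f (n + d) x - f n x)"
      using norm_triangle_ineq[of "f (Suc (n + d)) x - f (n + d) x" "f (n + d) x - f n x"] by simp
    also have "\<dots> \<le> K / 2 ^ (n + d) + (2 * K / 2 ^ n - 2 * K / 2 ^ (n + d))"
      using assms[OF x] Suc by (intro add_mono) auto
    finally show ?case by (simp add: field_simps)
  qed simp
  have K: "0 \<le> K" if "x \<in> S" for x
    using order_trans[OF norm_ge_zero assms[OF that, of 0]] by simp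
  have le: "norm (f m x - f n x) \<le> 2 * K / 2 ^ n" if "x \<in> S" "n \<le> m" for m n x
  proof -
    have "0 \<le> 2 * K / 2 ^ m" using K[OF that(1)] by simp
    then show ?thesis using tel[OF that(1), of n "m - n"] that(2) by simp
  qed
  have lim0: "(\<lambda>n. C / 2 ^ n) \<longlonglongrightarrow> 0" for C :: real
    using tendsto_mult_right_zero[OF LIMSEQ_power_zero[of "1/2::real"], of C]
    by (simp add: power_divide)
  have cau: "Cauchy (\<lambda>n. f n x)" if x: "x \<in> S" for x
  proof (rule CauchyI')
    fix e :: real assume "0 < e"
    obtain M where M: "2 * K / 2 ^ M < e"
      using order_tendstoD(2)[OF lim0[of "2 * K"] \<open>e > 0\<close>]
      unfolding eventually_sequentially by blast
    show "\<exists>M. \<forall>m\<ge>M. \<forall>n>m. dist (f m x) (f n x) < e"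
    proof (intro exI allI impI)
      fix m n assume "M \<le> m" "m < n"
      have "norm (f n x - f m x) \<le> 2 * K / 2 ^ m" using le[OF x, of m n] \<open>m < n\<close> by simp
      also have "\<dots> \<le> 2 * K / 2 ^ M"
        using K[OF x] \<open>M \<le> m\<close> by (intro divide_left_mono power_increasing) auto
      finally show "dist (f m x) (f n x) < e" using M by (simp add: dist_norm norm_minus_commute)
    qed
  qed
  define g where "g x = lim (\<lambda>n. f n x)" for x
  have g: "norm (f n x - g x) \<le> 2 * K / 2 ^ n" if x: "x \<in> S" for n x
  proof -
    have "(\<lambda>n. f n x) \<longlonglongrightarrow> g x"
      unfolding g_def convergent_LIMSEQ_iff[symmetric] by (rule Cauchy_convergent[OF cau[OF x]])
    then have "(\<lambda>m. norm (f m x - f n x)) \<longlonglongrightarrow> norm (g x - f n x)" by (intro tendsto_intros)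
    then have "norm (g x - f n x) \<le> 2 * K / 2 ^ n"
    proof (rule LIMSEQ_le_const2)
      show "\<exists>N. \<forall>m\<ge>N. norm (f m x - f n x) \<le> 2 * K / 2 ^ n" using le[OF x, of n] by blast
    qed
    then show ?thesis by (simp add: norm_minus_commute)
  qed
  have "uniform_limit S f g sequentially"
  proof (rule uniform_limitI)
    fix e :: real assume "0 < e"
    have "\<forall>\<^sub>F n in sequentially. 2 * K / 2 ^ n < e"
      using order_tendstoD(2)[OF lim0 \<open>e > 0\<close>] .
    then show "\<forall>\<^sub>F n in sequentially. \<forall>x\<in>S. dist (f n x) (g x) < e"
    proof eventually_elim
      case (elim n)
      show ?case unfolding dist_norm using le_less_trans[OF g elim] by simp
    qed
  qed
  then show ?thesis using that g by blast
qed

text \<open>On a ball so small that the right-hand side is at most a quarter of a bound of \<open>w\<close>, every bound of \<open>w\<close>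
  can be improved again and again, so \<open>w\<close> vanishes.\<close>

lemma linear_integral_unique:
  fixes E :: "'e::euclidean_space set" and w :: "'e \<Rightarrow> 'w::euclidean_space" and \<delta> M K :: real
  assumes E: "E \<subseteq> Basis" and M: "card E * \<delta> * M \<le> 1/4" "0 \<le> M"
    and A: "\<And>c y v. c \<in> E \<Longrightarrow> y \<in> ball 0 \<delta> \<Longrightarrow> norm (A c y v) \<le> M * norm v"
    and cA: "\<And>c. c \<in> E \<Longrightarrow> continuous_on (ball 0 \<delta>) (\<lambda>y. A c y (w y))"
    and bw: "\<And>y. y \<in> ball 0 \<delta> \<Longrightarrow> norm (w y) \<le> K"
    and eq: "\<And>x. x \<in> ball 0 \<delta> \<Longrightarrow> w x = ray_sum E j (\<lambda>c y. A c y (w y)) x"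
    and x: "x \<in> ball 0 \<delta>"
  shows "w x = 0"
proof -
  have b: "norm (w y) \<le> K * (1/2) ^ n" if "y \<in> ball 0 \<delta>" for n y
    using that
  proof (induction n arbitrary: y)
    case 0
    then show ?case using bw by simp
  next
    case (Suc n)
    have K: "0 \<le> K * (1/2) ^ n" using norm_ge_zero Suc.IH[OF Suc.prems] by (rule order_trans)
    have Ab: "norm (A c y (w y)) \<le> M * (K * (1/2) ^ n)" if "c \<in> E" "y \<in> ball 0 \<delta>" for c y
      using A[OF that] mult_left_mono[OF Suc.IH[OF that(2)] M(2)] by (rule order_trans)
    have "norm (w y) \<le> card E * \<delta> * (M * (K * (1/2) ^ n))"
      unfolding eq[OF Suc.prems] by (rule ray_int_sum_bound[OF E Suc.prems cA Ab])
    also have "\<dots> = (card E * \<delta> * M) * (K * (1/2) ^ n)" by (simp only: mult.assoc)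
    also have "\<dots> \<le> 1/4 * (K * (1/2) ^ n)" using M(1) K by (rule mult_right_mono)
    also have "\<dots> \<le> K * (1/2) ^ Suc n" using K by simp
    finally show ?case .
  qed
  have "(\<lambda>n. K * (1/2) ^ n) \<longlonglongrightarrow> 0"
    using tendsto_mult_right_zero[OF LIMSEQ_power_zero[of "1/2::real"], of K] by simp
  then have "norm (w x) \<le> 0"
  proof (rule LIMSEQ_le_const)
    show "\<exists>N. \<forall>n\<ge>N. norm (w x) \<le> K * (1/2) ^ n" using b[OF x] by simp
  qed
  then show ?thesis by simp
qed

lemma uniform_limit_continuous_on:
  fixes f :: "nat \<Rightarrow> 'a::topological_space \<Rightarrow> 'w::metric_space"
  assumes "uniform_limit S f g sequentially" "\<And>n. continuous_on S (f n)"
  shows "continuous_on S g"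
  by (rule uniform_limit_theorem[OF _ assms(1)]) (simp_all add: assms(2))

lemma C1_limit:
  fixes u :: "nat \<Rightarrow> 'e::euclidean_space \<Rightarrow> 'w::euclidean_space"
  assumes u: "\<And>n. Ck_on (Suc 0) (ball 0 \<delta>) (u n)" and "0 < \<delta>"
    and lim: "\<And>x. x \<in> ball 0 \<delta> \<Longrightarrow> (\<lambda>n. u n x) \<longlonglongrightarrow> v x"
    and K: "\<And>n b x. b \<in> Basis \<Longrightarrow> x \<in> ball 0 \<delta> \<Longrightarrow> norm (ddir b (u (Suc n)) x - ddir b (u n) x) \<le> K / 2 ^ n"
  shows "Ck_on (Suc 0) (ball 0 \<delta>) v"
proof -
  have "\<exists>g. (\<forall>n. \<forall>x\<in>ball 0 \<delta>. norm (ddir b (u n) x - g x) \<le> 2 * K / 2 ^ n) \<and>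
      uniform_limit (ball 0 \<delta>) (\<lambda>n. ddir b (u n)) g sequentially" if "b \<in> Basis" for b
    using geometric_uniform_limit[of "ball 0 \<delta>" "\<lambda>n. ddir b (u n)" K] K[OF that] by metis
  then obtain \<psi> where psi: "\<And>b n x. b \<in> Basis \<Longrightarrow> x \<in> ball 0 \<delta> \<Longrightarrow> norm (ddir b (u n) x - \<psi> b x) \<le> 2 * K / 2 ^ n"
    and ul: "\<And>b. b \<in> Basis \<Longrightarrow> uniform_limit (ball 0 \<delta>) (\<lambda>n. ddir b (u n)) (\<psi> b) sequentially"
    by metis
  have cpsi: "continuous_on (ball 0 \<delta>) (\<psi> b)" if "b \<in> Basis" for b
    by (rule uniform_limit_continuous_on[OF ul[OF that]]) (use u in auto)
  let ?D = "\<lambda>x h. \<Sum>b\<in>Basis. (h \<bullet> b) *\<^sub>R \<psi> b x"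
  have "\<exists>g. \<forall>x\<in>ball 0 \<delta>. (\<lambda>n. u n x) \<longlonglongrightarrow> g x \<and> (g has_derivative ?D x) (at x within ball 0 \<delta>)"
  proof (rule has_derivative_sequence[OF convex_ball])
    fix n and x :: 'e assume "x \<in> ball 0 \<delta>"
    then show "(u n has_derivative frechet_derivative (u n) (at x)) (at x within ball 0 \<delta>)"
      using Ck_on_has_derivative[OF u] has_derivative_at_withinI by blast
  next
    fix e :: real assume "0 < e"
    have "(\<lambda>n. real DIM('e) * 2 * K * (1/2) ^ n) \<longlonglongrightarrow> 0"
      using tendsto_mult_right_zero[OF LIMSEQ_power_zero[of "1/2::real"]] by simp
    then have "\<forall>\<^sub>F n in sequentially. real DIM('e) * 2 * K * (1/2) ^ n < e"
      using order_tendstoD(2) \<open>0 < e\<close> by blast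
    then show "\<forall>\<^sub>F n in sequentially. \<forall>x\<in>ball 0 \<delta>. \<forall>h. norm (frechet_derivative (u n) (at x) h - ?D x h) \<le> e * norm h"
    proof eventually_elim
      case (elim n)
      show ?case
      proof (intro ballI allI)
        fix x h :: 'e assume x: "x \<in> ball 0 \<delta>"
        have lin: "linear (frechet_derivative (u n) (at x))"
          by (rule has_derivative_linear[OF Ck_on_has_derivative[OF u x]])
        have "norm (frechet_derivative (u n) (at x) h - ?D x h)
            = norm (\<Sum>b\<in>Basis. (h \<bullet> b) *\<^sub>R (ddir b (u n) x - \<psi> b x))"
          by (simp only: linear_Basis_expansion[OF lin, of h] scaleR_diff_right sum_subtractf)
        also have "\<dots> \<le> real DIM('e) * (2 * K / 2 ^ n) * norm h"
          by (rule norm_Basis_combination_bound[OF psi[OF _ x]])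
        also have "\<dots> = (real DIM('e) * 2 * K * (1/2) ^ n) * norm h" by (simp add: power_divide)
        also have "\<dots> \<le> e * norm h" using elim by (intro mult_right_mono) auto
        finally show "norm (frechet_derivative (u n) (at x) h - ?D x h) \<le> e * norm h" .
      qed
    qed
  next
    show "(0::'e) \<in> ball 0 \<delta>" using \<open>0 < \<delta>\<close> by simp
    then show "(\<lambda>n. u n 0) \<longlonglongrightarrow> v 0" by (rule lim)
  qed
  then obtain g where g: "\<And>x. x \<in> ball 0 \<delta> \<Longrightarrow> (\<lambda>n. u n x) \<longlonglongrightarrow> g x"
    "\<And>x. x \<in> ball 0 \<delta> \<Longrightarrow> (g has_derivative ?D x) (at x within ball 0 \<delta>)" by blast
  have gv: "g x = v x" if "x \<in> ball 0 \<delta>" for x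
    using LIMSEQ_unique[OF g(1)[OF that] lim[OF that]] .
  have "Ck_on (Suc 0) (ball 0 \<delta>) g"
  proof (rule Ck_on_SucI[OF open_ball])
    fix x :: 'e assume x: "x \<in> ball 0 \<delta>"
    show "(g has_derivative ?D x) (at x)"
      using g(2)[OF x] unfolding at_within_open[OF x open_ball] .
  next
    show "Ck_on 0 (ball 0 \<delta>) (\<lambda>x. \<Sum>b\<in>Basis. (w \<bullet> b) *\<^sub>R \<psi> b x)" for w
      unfolding Ck_on.simps by (intro continuous_on_sum continuous_on_scaleR continuous_on_const cpsi)
  qed
  show ?thesis by (rule Ck_on_cong[where f = g, OF open_ball]) (fact gv, fact)
qed

lemma ddir_integral_equation:
  fixes E :: "'e::euclidean_space set" and b :: "'e \<Rightarrow> 'w::euclidean_space"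
  assumes v: "v \<in> Basis" and x: "x \<in> ball 0 \<delta>" and b: "Ck_on (Suc 0) (ball 0 \<delta>) b"
    and H: "\<And>c. c \<in> E \<Longrightarrow> Ck_on (Suc 0) (ball 0 \<delta>) (H c)"
  shows "ddir v (\<lambda>x. b x + ray_sum E j H x) x = ddir v b x +
      ((\<Sum>c\<in>E. (v \<bullet> c) *\<^sub>R ray_int E j (H c) x) +
       ray_sum E (shift E v j) (\<lambda>c. ddir v (H c)) x)"
proof -
  have d: "((\<lambda>x. (x \<bullet> c) *\<^sub>R ray_int E j (H c) x) has_derivative
      (\<lambda>w. (x \<bullet> c) *\<^sub>R ddir w (ray_int E j (H c)) x + (w \<bullet> c) *\<^sub>R ray_int E j (H c) x)) (at x)" if "c \<in> E" for c
  proof (rule has_derivative_scaleR)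
    show "((\<lambda>x. x \<bullet> c) has_derivative (\<lambda>w. w \<bullet> c)) (at x)"
      by (intro derivative_intros)
    show "(ray_int E j (H c) has_derivative frechet_derivative (ray_int E j (H c)) (at x)) (at x)"
      by (rule Ck_on_has_derivative[OF ray_int_Ck_on[OF H[OF that]] x])
  qed
  have "((\<lambda>x. b x + ray_sum E j H x) has_derivative
      (\<lambda>w. ddir w b x + (\<Sum>c\<in>E. (x \<bullet> c) *\<^sub>R ddir w (ray_int E j (H c)) x + (w \<bullet> c) *\<^sub>R ray_int E j (H c) x))) (at x)"
    by (intro has_derivative_add has_derivative_sum d Ck_on_has_derivative[OF b x])
  then have "ddir v (\<lambda>x. b x + ray_sum E j H x) x
      = ddir v b x + (\<Sum>c\<in>E. (x \<bullet> c) *\<^sub>R ddir v (ray_int E j (H c)) x + (v \<bullet> c) *\<^sub>R ray_int E j (H c) x)"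
    by (rule ddir_eq)
  also have "(\<Sum>c\<in>E. (x \<bullet> c) *\<^sub>R ddir v (ray_int E j (H c)) x + (v \<bullet> c) *\<^sub>R ray_int E j (H c) x)
      = (\<Sum>c\<in>E. (x \<bullet> c) *\<^sub>R ray_int E (shift E v j) (ddir v (H c)) x + (v \<bullet> c) *\<^sub>R ray_int E j (H c) x)"
    by (rule sum.cong[OF refl]) (simp only: ray_int_ddir[OF H x v])
  finally show ?thesis unfolding sum.distrib by (simp only: add.commute)
qed

text \<open>Picard iteration \<open>u\<^sub>n\<^sub>+\<^sub>1 = b + ray_sum (G(y, u\<^sub>n))\<close> in the space of \<open>C\<^sup>1\<close> maps.  \<open>G1\<close> and \<open>G2\<close> are the partial
  derivatives of \<open>G c y z\<close> in \<open>y\<close> and in \<open>z\<close>, given abstractly so that both the nonlinear equation of commuting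
  fields, where \<open>G\<close> depends on \<open>z\<close> only, and linear equations are instances.  The differences of the iterates
  decay like \<open>4\<^sup>-\<^sup>n\<close>.  Those of their derivatives satisfy \<open>d\<^sub>n\<^sub>+\<^sub>1 \<le> d\<^sub>n / 4 + C 4\<^sup>-\<^sup>n\<close> and decay at least like
  \<open>2\<^sup>-\<^sup>n\<close>, so the limit is again \<open>C\<^sup>1\<close>.\<close>

lemma C1_fixed_point:
  fixes E :: "'e::euclidean_space set" and b :: "'e \<Rightarrow> 'w::euclidean_space"
    and G :: "'e \<Rightarrow> 'e \<Rightarrow> 'w \<Rightarrow> 'w" and \<delta> R M M0 M1 B0 :: real
  assumes E: "E \<subseteq> Basis" and pos: "0 < \<delta>" "0 \<le> M" "0 \<le> M0" "0 \<le> M1" "0 \<le> B0" "0 \<le> R"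
    and b: "Ck_on (Suc 0) (ball 0 \<delta>) b" "\<And>y. y \<in> ball 0 \<delta> \<Longrightarrow> norm (b y) \<le> R / 2"
      "\<And>v y. v \<in> Basis \<Longrightarrow> y \<in> ball 0 \<delta> \<Longrightarrow> norm (ddir v b y) \<le> B0"
    and small: "card E * \<delta> * M0 \<le> R / 2" "card E * \<delta> * M \<le> 1/4"
    and G0: "\<And>c y z. c \<in> E \<Longrightarrow> y \<in> ball 0 \<delta> \<Longrightarrow> norm z \<le> R \<Longrightarrow> norm (G c y z) \<le> M0"
    and GL: "\<And>c y z z'. c \<in> E \<Longrightarrow> y \<in> ball 0 \<delta> \<Longrightarrow> norm z \<le> R \<Longrightarrow> norm z' \<le> R \<Longrightarrow>
      norm (G c y z - G c y z') \<le> M * norm (z - z')"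
    and chain: "\<And>c u. c \<in> E \<Longrightarrow> Ck_on (Suc 0) (ball 0 \<delta>) u \<Longrightarrow>
        (\<And>y. y \<in> ball 0 \<delta> \<Longrightarrow> norm (u y) \<le> R) \<Longrightarrow> Ck_on (Suc 0) (ball 0 \<delta>) (\<lambda>y. G c y (u y))"
      "\<And>c u v y. c \<in> E \<Longrightarrow> Ck_on (Suc 0) (ball 0 \<delta>) u \<Longrightarrow>
        (\<And>y. y \<in> ball 0 \<delta> \<Longrightarrow> norm (u y) \<le> R) \<Longrightarrow> v \<in> Basis \<Longrightarrow> y \<in> ball 0 \<delta> \<Longrightarrow>
        ddir v (\<lambda>y. G c y (u y)) y = G1 c v y (u y) + G2 c y (u y) (ddir v u y)"
    and G1: "\<And>c v y z. c \<in> E \<Longrightarrow> v \<in> Basis \<Longrightarrow> y \<in> ball 0 \<delta> \<Longrightarrow> norm z \<le> R \<Longrightarrow> norm (G1 c v y z) \<le> M1"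
      "\<And>c v y z z'. c \<in> E \<Longrightarrow> v \<in> Basis \<Longrightarrow> y \<in> ball 0 \<delta> \<Longrightarrow> norm z \<le> R \<Longrightarrow> norm z' \<le> R \<Longrightarrow>
        norm (G1 c v y z - G1 c v y z') \<le> M1 * norm (z - z')"
    and G2: "\<And>c y z w. c \<in> E \<Longrightarrow> y \<in> ball 0 \<delta> \<Longrightarrow> norm z \<le> R \<Longrightarrow> norm (G2 c y z w) \<le> M * norm w"
      "\<And>c y z z' w w'. c \<in> E \<Longrightarrow> y \<in> ball 0 \<delta> \<Longrightarrow> norm z \<le> R \<Longrightarrow> norm z' \<le> R \<Longrightarrow>
        norm (G2 c y z w - G2 c y z' w') \<le> M1 * norm (z - z') * norm w' + M * norm (w - w')"
  shows "\<exists>u. Ck_on (Suc 0) (ball 0 \<delta>) u \<and> (\<forall>y\<in>ball 0 \<delta>. norm (u y) \<le> R) \<and>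
    (\<forall>x\<in>ball 0 \<delta>. u x = b x + ray_sum E j (\<lambda>c y. G c y (u y)) x)"
proof -
  let ?B = "ball (0::'e) \<delta>"
  let ?N = "real (card E)"
  define T where "T u x = b x + ray_sum E j (\<lambda>c y. G c y (u y)) x" for u x
  define u where "u n = (T ^^ n) (\<lambda>_. 0)" for n
  have u_Suc: "u (Suc n) = T (u n)" and u_0: "u 0 = (\<lambda>_. 0)" for n by (simp_all add: u_def)
  have fE: "finite E" using E finite_Basis finite_subset by blast
  have inv: "Ck_on (Suc 0) ?B (u n) \<and> (\<forall>y\<in>?B. norm (u n y) \<le> R)" for n
  proof (induction n)
    case 0
    show ?case using pos(6) unfolding u_0 by (simp add: Ck_on_const del: Ck_on.simps)
  next
    case (Suc n)
    then have C: "Ck_on (Suc 0) ?B (u n)" and R: "\<And>y. y \<in> ?B \<Longrightarrow> norm (u n y) \<le> R" by auto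
    have "Ck_on (Suc 0) ?B (T (u n))"
      unfolding T_def[abs_def]
      by (intro Ck_on_add Ck_on_sum Ck_on_scaleR Ck_on_inner ray_int_Ck_on open_ball b(1) Ck_on_ident
          Ck_on_const chain(1) C R)
    moreover have "norm (T (u n) y) \<le> R" if y: "y \<in> ?B" for y
    proof -
      have "norm (ray_sum E j (\<lambda>c y. G c y (u n y)) y) \<le> ?N * \<delta> * M0"
        by (rule ray_int_sum_bound[OF E y Ck_on_continuous[OF chain(1)[OF _ C R]] G0[OF _ _ R]])
      then show ?thesis unfolding T_def using norm_triangle_le[of "b y"] b(2)[OF y] small(1) by fastforce
    qed
    ultimately show ?case unfolding u_Suc by blast
  qed
  have C: "Ck_on (Suc 0) ?B (u n)" for n using inv by blast
  have R: "norm (u n y) \<le> R" if "y \<in> ?B" for n y using inv that by blast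
  have cG: "continuous_on ?B (\<lambda>y. G c y (u n y))" if "c \<in> E" for c n
    by (rule Ck_on_continuous[OF chain(1)[OF that C R]])
  have Du: "ddir v (u (Suc n)) x = ddir v b x +
      ((\<Sum>c\<in>E. (v \<bullet> c) *\<^sub>R ray_int E j (\<lambda>y. G c y (u n y)) x) +
       ray_sum E (shift E v j) (\<lambda>c y. G1 c v y (u n y) + G2 c y (u n y) (ddir v (u n) y)) x)"
    if v: "v \<in> Basis" and x: "x \<in> ?B" for v x n
  proof -
    have "ray_int E (shift E v j) (ddir v (\<lambda>y. G c y (u n y))) x
        = ray_int E (shift E v j) (\<lambda>y. G1 c v y (u n y) + G2 c y (u n y) (ddir v (u n) y)) x" if "c \<in> E" for c
      by (rule ray_int_cong[where f = "ddir v (\<lambda>y. G c y (u n y))", OF chain(2)[OF that C R v] x])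
    then have S: "ray_sum E (shift E v j) (\<lambda>c. ddir v (\<lambda>y. G c y (u n y))) x
        = ray_sum E (shift E v j) (\<lambda>c y. G1 c v y (u n y) + G2 c y (u n y) (ddir v (u n) y)) x"
      by (intro sum.cong refl) (simp only:)
    have "ddir v (u (Suc n)) x = ddir v b x +
      ((\<Sum>c\<in>E. (v \<bullet> c) *\<^sub>R ray_int E j (\<lambda>y. G c y (u n y)) x) +
       ray_sum E (shift E v j) (\<lambda>c. ddir v (\<lambda>y. G c y (u n y))) x)"
      unfolding u_Suc T_def[abs_def] by (rule ddir_integral_equation[OF v x b(1) chain(1)[OF _ C R]])
    then show ?thesis unfolding S .
  qed
  have cG12: "continuous_on ?B (\<lambda>y. G1 c v y (u n y) + G2 c y (u n y) (ddir v (u n) y))"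
    if "c \<in> E" "v \<in> Basis" for c v n
  proof -
    have "continuous_on ?B (ddir v (\<lambda>y. G c y (u n y)))" using chain(1)[OF that(1) C R] by auto
    then show ?thesis by (rule continuous_on_eq) (rule chain(2)[OF that(1) C R that(2)])
  qed
  have du: "norm (u (Suc n) x - u n x) \<le> R * (1/4) ^ n" if "x \<in> ?B" for n x
    using that
  proof (induction n arbitrary: x)
    case 0
    then show ?case using R[of x "Suc 0"] by (simp add: u_0)
  next
    case (Suc n)
    have "u (Suc (Suc n)) x - u (Suc n) x = ray_sum E j (\<lambda>c y. G c y (u (Suc n) y)) x
        - ray_sum E j (\<lambda>c y. G c y (u n y)) x"
      unfolding u_Suc[of "Suc n"] u_Suc[of n] T_def by (simp only: add_diff_cancel_left)
    moreover have "norm (G c y (u (Suc n) y) - G c y (u n y)) \<le> M * (R * (1/4) ^ n)" if "c \<in> E" "y \<in> ?B" for c y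
      using GL[OF that R[OF that(2)] R[OF that(2)]] mult_left_mono[OF Suc.IH[OF that(2)] pos(2)] by (rule order_trans)
    ultimately have "norm (u (Suc (Suc n)) x - u (Suc n) x) \<le> ?N * \<delta> * (M * (R * (1/4) ^ n))"
      using ray_int_sum_diff_bound[OF E Suc.prems cG cG] by simp
    also have "\<dots> = (?N * \<delta> * M) * (R * (1/4) ^ n)" by (simp only: mult.assoc)
    also have "\<dots> \<le> 1/4 * (R * (1/4) ^ n)" using small(2) pos(6) by (intro mult_right_mono) auto
    finally show ?case by simp
  qed
  \<comment> \<open>A bound for the derivatives of all iterates: the equation of \<open>Du\<close> gives \<open>B / 2 + B / 4 \<le> B\<close>.\<close>
  define B where "B = 2 * (B0 + ?N * M0 + ?N * \<delta> * M1)"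
  have vc: "norm (\<Sum>c\<in>E. (v \<bullet> c) *\<^sub>R f c) \<le> ?N * D"
    if v: "v \<in> Basis" and f: "\<And>c. c \<in> E \<Longrightarrow> norm (f c) \<le> D" and D: "0 \<le> D"
    for v and f :: "'e \<Rightarrow> 'w" and D :: real
  proof -
    have "norm (\<Sum>c\<in>E. (v \<bullet> c) *\<^sub>R f c) \<le> (\<Sum>c\<in>E. D)"
    proof (rule order_trans[OF norm_sum], rule sum_mono)
      fix c assume c: "c \<in> E"
      then have "\<bar>v \<bullet> c\<bar> \<le> 1" using v E by (auto simp: inner_Basis)
      then have "\<bar>v \<bullet> c\<bar> * norm (f c) \<le> 1 * D" using f[OF c] by (intro mult_mono) auto
      then show "norm ((v \<bullet> c) *\<^sub>R f c) \<le> D" by simp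
    qed
    then show ?thesis by simp
  qed
  have Bpos: "0 \<le> B" unfolding B_def using pos by simp
  have DB: "norm (ddir v (u n) x) \<le> B" if "v \<in> Basis" "x \<in> ?B" for n v x
    using that(2)
  proof (induction n arbitrary: x)
    case 0
    show ?case using Bpos by (simp add: u_0)
  next
    case (Suc n)
    have H: "norm (G1 c v y (u n y) + G2 c y (u n y) (ddir v (u n) y)) \<le> M1 + M * B" if "c \<in> E" "y \<in> ?B" for c y
    proof (rule norm_triangle_le, rule add_mono)
      show "norm (G1 c v y (u n y)) \<le> M1" by (rule G1(1)[OF that(1) \<open>v \<in> Basis\<close> that(2) R[OF that(2)]])
      show "norm (G2 c y (u n y) (ddir v (u n) y)) \<le> M * B"
        using G2(1)[OF that R[OF that(2)]] mult_left_mono[OF Suc.IH[OF that(2)] pos(2)] by (rule order_trans)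
    qed
    have 1: "norm (ray_sum E (shift E v j) (\<lambda>c y. G1 c v y (u n y) + G2 c y (u n y) (ddir v (u n) y)) x)
        \<le> ?N * \<delta> * (M1 + M * B)"
      by (rule ray_int_sum_bound[OF E Suc.prems cG12[OF _ that(1)] H])
    have 2: "norm (\<Sum>c\<in>E. (v \<bullet> c) *\<^sub>R ray_int E j (\<lambda>y. G c y (u n y)) x) \<le> ?N * M0"
      by (rule vc[OF that(1) ray_int_bound[OF cG Suc.prems G0[OF _ _ R]] pos(3)])
    have "norm (ddir v (u (Suc n)) x) \<le> B0 + (?N * M0 + ?N * \<delta> * (M1 + M * B))"
      unfolding Du[OF that(1) Suc.prems] by (intro norm_triangle_le add_mono b(3)[OF that(1) Suc.prems] 1 2)
    also have "\<dots> = B / 2 + (?N * \<delta> * M) * B" unfolding B_def by (simp add: algebra_simps)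
    also have "\<dots> \<le> B / 2 + 1/4 * B" using small(2) Bpos by (intro add_left_mono mult_right_mono)
    also have "\<dots> \<le> B" using Bpos by simp
    finally show ?case .
  qed
  \<comment> \<open>Large enough for the first difference, \<open>2 B \<le> K\<close>, and for the recursion
    \<open>d\<^sub>n\<^sub>+\<^sub>1 \<le> d\<^sub>n / 4 + (K / 4) 2\<^sup>-\<^sup>n\<close>.\<close>
  define K where "K = 4 * ((?N * M + ?N * \<delta> * (M1 + M1 * B)) * R) + 2 * B"
  have CR: "0 \<le> (?N * M + ?N * \<delta> * (M1 + M1 * B)) * R" using pos Bpos by simp
  have dDu: "norm (ddir v (u (Suc n)) x - ddir v (u n) x) \<le> K / 2 ^ n" if v: "v \<in> Basis" and "x \<in> ?B" for n v x
    using that(2)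
  proof (induction n arbitrary: x)
    case 0
    have "norm (ddir v (u (Suc 0)) x - ddir v (u 0) x) \<le> B + B"
      by (rule order_trans[OF norm_triangle_ineq4 add_mono[OF DB[OF v 0] DB[OF v 0]]])
    also have "\<dots> \<le> K" unfolding K_def using CR by simp
    finally show ?case by simp
  next
    case (Suc n)
    let ?H = "\<lambda>n c y. G1 c v y (u n y) + G2 c y (u n y) (ddir v (u n) y)"
    have 1: "norm (G c y (u (Suc n) y) - G c y (u n y)) \<le> M * (R * (1/4) ^ n)" if "c \<in> E" "y \<in> ?B" for c y
      using GL[OF that R[OF that(2)] R[OF that(2)]] mult_left_mono[OF du[OF that(2)] pos(2)] by (rule order_trans)
    have H: "norm (?H (Suc n) c y - ?H n c y) \<le> M1 * (R * (1/4) ^ n) + (M1 * (R * (1/4) ^ n) * B + M * (K / 2 ^ n))"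
      if "c \<in> E" "y \<in> ?B" for c y
    proof -
      have "?H (Suc n) c y - ?H n c y = (G1 c v y (u (Suc n) y) - G1 c v y (u n y))
          + (G2 c y (u (Suc n) y) (ddir v (u (Suc n)) y) - G2 c y (u n y) (ddir v (u n) y))" by simp
      moreover have "norm (G1 c v y (u (Suc n) y) - G1 c v y (u n y)) \<le> M1 * (R * (1/4) ^ n)"
        using G1(2)[OF that(1) v that(2) R[OF that(2)] R[OF that(2)]] mult_left_mono[OF du[OF that(2)] pos(4)]
        by (rule order_trans)
      moreover have "norm (G2 c y (u (Suc n) y) (ddir v (u (Suc n)) y) - G2 c y (u n y) (ddir v (u n) y))
          \<le> M1 * (R * (1/4) ^ n) * B + M * (K / 2 ^ n)"
      proof (rule order_trans[OF G2(2)[OF that R[OF that(2)] R[OF that(2)]]], rule add_mono)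
        show "M1 * norm (u (Suc n) y - u n y) * norm (ddir v (u n) y) \<le> M1 * (R * (1/4) ^ n) * B"
          using du[OF that(2), of n] DB[OF v that(2), of n] pos by (intro mult_mono mult_nonneg_nonneg) auto
        show "M * norm (ddir v (u (Suc n)) y - ddir v (u n) y) \<le> M * (K / 2 ^ n)"
          by (rule mult_left_mono[OF Suc.IH[OF that(2)] pos(2)])
      qed
      ultimately show ?thesis by (simp only:) (intro norm_triangle_le add_mono)
    qed
    have S: "norm (ray_sum E (shift E v j) (?H (Suc n)) x - ray_sum E (shift E v j) (?H n) x)
        \<le> ?N * \<delta> * (M1 * (R * (1/4) ^ n) + (M1 * (R * (1/4) ^ n) * B + M * (K / 2 ^ n)))"
      by (rule ray_int_sum_diff_bound[OF E Suc.prems cG12[OF _ v] cG12[OF _ v] H])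
    have V: "norm ((\<Sum>c\<in>E. (v \<bullet> c) *\<^sub>R ray_int E j (\<lambda>y. G c y (u (Suc n) y)) x) - (\<Sum>c\<in>E. (v \<bullet> c) *\<^sub>R ray_int E j (\<lambda>y. G c y (u n y)) x))
        \<le> ?N * (M * (R * (1/4) ^ n))"
      unfolding sum_subtractf[symmetric] scaleR_diff_right[symmetric]
    proof (rule vc[OF v])
      fix c assume c: "c \<in> E"
      show "norm (ray_int E j (\<lambda>y. G c y (u (Suc n) y)) x - ray_int E j (\<lambda>y. G c y (u n y)) x) \<le> M * (R * (1/4) ^ n)"
        unfolding ray_int_diff[OF cG[OF c] cG[OF c] Suc.prems, symmetric]
        by (rule ray_int_bound[OF continuous_on_diff[OF cG[OF c] cG[OF c]] Suc.prems 1[OF c]])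
    qed (use pos in simp)
    have "norm (ddir v (u (Suc (Suc n))) x - ddir v (u (Suc n)) x)
       = norm (((\<Sum>c\<in>E. (v \<bullet> c) *\<^sub>R ray_int E j (\<lambda>y. G c y (u (Suc n) y)) x) - (\<Sum>c\<in>E. (v \<bullet> c) *\<^sub>R ray_int E j (\<lambda>y. G c y (u n y)) x))
        + (ray_sum E (shift E v j) (?H (Suc n)) x - ray_sum E (shift E v j) (?H n) x))"
      unfolding Du[OF v Suc.prems, of "Suc n"] Du[OF v Suc.prems, of n] add_diff_add by simp
    also have "\<dots> \<le> ?N * (M * (R * (1/4) ^ n)) + ?N * \<delta> * (M1 * (R * (1/4) ^ n) + (M1 * (R * (1/4) ^ n) * B + M * (K / 2 ^ n)))"
      by (rule norm_triangle_le[OF add_mono[OF V S]])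
    also have "\<dots> = ((?N * M + ?N * \<delta> * (M1 + M1 * B)) * R) * (1/4) ^ n + (?N * \<delta> * M) * (K / 2 ^ n)"
      by (simp add: algebra_simps)
    also have "\<dots> \<le> (K / 4) * (1/2) ^ n + 1/4 * (K / 2 ^ n)"
    proof (intro add_mono mult_mono mult_right_mono power_mono)
      show "(?N * M + ?N * \<delta> * (M1 + M1 * B)) * R \<le> K / 4" unfolding K_def using Bpos by simp
      show "0 \<le> K / 4" "0 \<le> K / 2 ^ n" unfolding K_def using Bpos CR by simp_all
    qed (use small(2) in simp_all)
    also have "\<dots> = K / 2 ^ Suc n" by (simp add: power_divide field_simps)
    finally show ?case .
  qed
  have du2: "norm (u (Suc n) x - u n x) \<le> R / 2 ^ n" if "x \<in> ?B" for n x
  proof -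
    have "R * (1/4) ^ n \<le> R * (1/2) ^ n" using pos(6) by (intro mult_left_mono power_mono) auto
    then show ?thesis using order_trans[OF du[OF that]] by (simp add: power_divide)
  qed
  obtain g where g: "\<And>n x. x \<in> ?B \<Longrightarrow> norm (u n x - g x) \<le> 2 * R / 2 ^ n"
    and ul: "uniform_limit ?B u g sequentially"
    using geometric_uniform_limit[of ?B u R] du2 by metis
  have limg: "(\<lambda>n. u n x) \<longlonglongrightarrow> g x" if "x \<in> ?B" for x
    using tendsto_uniform_limitI[OF ul that] .
  have Cg: "Ck_on (Suc 0) ?B g" by (rule C1_limit[OF C pos(1) limg dDu])
  have Rg: "norm (g x) \<le> R" if "x \<in> ?B" for x
  proof (rule LIMSEQ_le_const2[OF tendsto_norm[OF limg[OF that]]])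
    show "\<exists>N. \<forall>n\<ge>N. norm (u n x) \<le> R" using R[OF that] by simp
  qed
  have "g x = T g x" if x: "x \<in> ?B" for x
  proof -
    have "norm (G c y (u n y) - G c y (g y)) \<le> M * (2 * R / 2 ^ n)" if "c \<in> E" "y \<in> ?B" for c y n
      using GL[OF that R[OF that(2)] Rg[OF that(2)]] mult_left_mono[OF g[OF that(2)] pos(2)] by (rule order_trans)
    then have "norm (ray_sum E j (\<lambda>c y. G c y (u n y)) x - ray_sum E j (\<lambda>c y. G c y (g y)) x)
        \<le> ?N * \<delta> * (M * (2 * R / 2 ^ n))" for n
      by (intro ray_int_sum_diff_bound[OF E x] cG Ck_on_continuous[OF chain(1)[OF _ Cg Rg]])
    moreover have "u (Suc n) x - T g x = ray_sum E j (\<lambda>c y. G c y (u n y)) x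
        - ray_sum E j (\<lambda>c y. G c y (g y)) x" for n
      unfolding u_Suc T_def by (simp only: add_diff_cancel_left)
    ultimately have bd: "norm (u (Suc n) x - T g x) \<le> (?N * \<delta> * M * 2 * R) * (1/2) ^ n" for n
      by (simp add: power_divide mult.assoc)
    have "(\<lambda>n. u (Suc n) x - T g x) \<longlonglongrightarrow> 0"
    proof (rule Lim_null_comparison)
      show "\<forall>\<^sub>F n in sequentially. norm (u (Suc n) x - T g x) \<le> (?N * \<delta> * M * 2 * R) * (1/2) ^ n" using bd by simp
      show "(\<lambda>n. (?N * \<delta> * M * 2 * R) * (1/2) ^ n) \<longlonglongrightarrow> 0"
        using tendsto_mult_right_zero[OF LIMSEQ_power_zero[of "1/2::real"]] by simp
    qed
    then have "(\<lambda>n. u (Suc n) x) \<longlonglongrightarrow> T g x" by (rule LIM_zero_cancel)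
    then show ?thesis using LIMSEQ_unique[OF LIMSEQ_Suc[OF limg[OF x]]] by blast
  qed
  then show ?thesis using Cg Rg unfolding T_def by blast
qed

lemma bounded_on_cball:
  fixes f :: "'e::euclidean_space \<Rightarrow> 'w::real_normed_vector"
  assumes "continuous_on (ball 0 r) f" "R < r"
  shows "\<exists>B\<ge>0. \<forall>y\<in>cball 0 R. norm (f y) \<le> B"
proof -
  have "continuous_on (cball 0 R) f"
    by (rule continuous_on_subset[OF assms(1)]) (use assms(2) in auto)
  then have "bounded (f ` cball 0 R)"
    by (intro compact_imp_bounded compact_continuous_image compact_cball)
  then obtain B where "0 < B" "\<forall>z\<in>f ` cball 0 R. norm z \<le> B"
    unfolding bounded_pos by blast
  then show ?thesis by (intro exI[of _ B]) auto
qed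

lemma finite_uniform_bound:
  fixes f :: "'i \<Rightarrow> 'a \<Rightarrow> 'w::real_normed_vector"
  assumes "finite I" "\<And>i. i \<in> I \<Longrightarrow> \<exists>K\<ge>0. \<forall>y\<in>S. norm (f i y) \<le> K"
  shows "\<exists>K\<ge>0. \<forall>i\<in>I. \<forall>y\<in>S. norm (f i y) \<le> K"
proof -
  from assms(2) obtain K where K: "\<And>i. i \<in> I \<Longrightarrow> 0 \<le> K i" "\<And>i y. i \<in> I \<Longrightarrow> y \<in> S \<Longrightarrow> norm (f i y) \<le> K i"
    by metis
  have "norm (f i y) \<le> sum K I" if "i \<in> I" "y \<in> S" for i y
    using K(2)[OF that] member_le_sum[of i I K] K(1) that(1) assms(1) by fastforce
  moreover have "0 \<le> sum K I" by (rule sum_nonneg[OF K(1)])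
  ultimately show ?thesis by blast
qed

text \<open>Rays stay in concentric balls, and on a smaller closed ball a continuous solution is bounded.\<close>

lemma linear_integral_unique_continuous:
  fixes E :: "'e::euclidean_space set" and w :: "'e \<Rightarrow> 'w::euclidean_space" and \<delta> M :: real
  assumes E: "E \<subseteq> Basis" and M: "card E * \<delta> * M \<le> 1/4" "0 \<le> M"
    and A: "\<And>c y v. c \<in> E \<Longrightarrow> y \<in> ball 0 \<delta> \<Longrightarrow> norm (A c y v) \<le> M * norm v"
    and cA: "\<And>c. c \<in> E \<Longrightarrow> continuous_on (ball 0 \<delta>) (\<lambda>y. A c y (w y))"
    and cw: "continuous_on (ball 0 \<delta>) w"
    and eq: "\<And>x. x \<in> ball 0 \<delta> \<Longrightarrow> w x = ray_sum E j (\<lambda>c y. A c y (w y)) x"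
    and x: "x \<in> ball 0 \<delta>"
  shows "w x = 0"
proof -
  obtain \<delta>' where d: "norm x < \<delta>'" "\<delta>' < \<delta>" using x dense[of "norm x" \<delta>] by auto
  obtain K where K: "\<forall>y\<in>cball 0 \<delta>'. norm (w y) \<le> K" using bounded_on_cball[OF cw d(2)] by blast
  have sub: "y \<in> ball 0 \<delta>" if "y \<in> ball 0 \<delta>'" for y :: 'e using that d(2) by simp
  have M': "card E * \<delta>' * M \<le> 1/4"
    using M d(2) by (intro order_trans[OF _ M(1)] mult_right_mono mult_left_mono) auto
  show ?thesis
  proof (rule linear_integral_unique[OF E M' M(2) A[OF _ sub] _ _ eq[OF sub]])
    show "continuous_on (ball 0 \<delta>') (\<lambda>y. A c y (w y))" if "c \<in> E" for c
      by (rule continuous_on_subset[OF cA[OF that]]) (use sub in blast)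
    show "norm (w y) \<le> K" if "y \<in> ball 0 \<delta>'" for y using K that by simp
    show "x \<in> ball 0 \<delta>'" using d by simp
  qed
qed

lemma ddir_linear_family:
  fixes L :: "'e::euclidean_space \<Rightarrow> 'w::euclidean_space \<Rightarrow> 'v::real_normed_vector"
  assumes S: "open S" and lin: "\<And>x. x \<in> S \<Longrightarrow> linear (L x)"
    and L: "\<And>b. b \<in> Basis \<Longrightarrow> Ck_on (Suc 0) S (\<lambda>x. L x b)" and f: "Ck_on (Suc 0) S f" and x: "x \<in> S"
  shows "ddir v (\<lambda>x. L x (f x)) x = (\<Sum>i\<in>Basis. (f x \<bullet> i) *\<^sub>R ddir v (\<lambda>x. L x i) x) + L x (ddir v f x)"
proof -
  have rp: "L y w = (\<Sum>b\<in>Basis. (w \<bullet> b) *\<^sub>R L y b)" if "y \<in> S" for y w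
    by (rule linear_Basis_expansion[OF lin[OF that]])
  have "((\<lambda>x. \<Sum>b\<in>Basis. (f x \<bullet> b) *\<^sub>R L x b) has_derivative
      (\<lambda>v. \<Sum>b\<in>Basis. (f x \<bullet> b) *\<^sub>R ddir v (\<lambda>x. L x b) x + (ddir v f x \<bullet> b) *\<^sub>R L x b)) (at x)"
    by (intro has_derivative_sum has_derivative_scaleR has_derivative_inner_left
        Ck_on_has_derivative[OF L x] Ck_on_has_derivative[OF f x])
  then have "((\<lambda>x. L x (f x)) has_derivative
      (\<lambda>v. \<Sum>b\<in>Basis. (f x \<bullet> b) *\<^sub>R ddir v (\<lambda>x. L x b) x + (ddir v f x \<bullet> b) *\<^sub>R L x b)) (at x)"
    by (rule has_derivative_transform_within_open[OF _ S x]) (simp only: rp[symmetric])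
  then have "ddir v (\<lambda>x. L x (f x)) x
      = (\<Sum>b\<in>Basis. (f x \<bullet> b) *\<^sub>R ddir v (\<lambda>x. L x b) x + (ddir v f x \<bullet> b) *\<^sub>R L x b)"
    by (rule ddir_eq)
  then show ?thesis unfolding sum.distrib rp[OF x, of "ddir v f x"] .
qed

text \<open>The fixed point theorem produces a \<open>C\<^sup>1\<close> solution on each smaller ball; by uniqueness it is \<open>z\<close>.\<close>

lemma linear_integral_C1:
  fixes E :: "'e::euclidean_space set" and z :: "'e \<Rightarrow> 'w::euclidean_space" and \<delta> M :: real
  assumes E: "E \<subseteq> Basis" and M: "card E * \<delta> * M \<le> 1/4" "0 \<le> M"
    and lin: "\<And>c y. c \<in> E \<Longrightarrow> y \<in> ball 0 \<delta> \<Longrightarrow> linear (A c y)"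
    and A: "\<And>c y v. c \<in> E \<Longrightarrow> y \<in> ball 0 \<delta> \<Longrightarrow> norm (A c y v) \<le> M * norm v"
    and CA: "\<And>c i. c \<in> E \<Longrightarrow> i \<in> Basis \<Longrightarrow> Ck_on (Suc 0) (ball 0 \<delta>) (\<lambda>y. A c y i)"
    and b: "Ck_on (Suc 0) (ball 0 \<delta>) b" and z: "continuous_on (ball 0 \<delta>) z"
    and eq: "\<And>x. x \<in> ball 0 \<delta> \<Longrightarrow> z x = b x + ray_sum E j (\<lambda>c y. A c y (z y)) x"
  shows "Ck_on (Suc 0) (ball 0 \<delta>) z"
proof (rule Ck_on_local)
  fix x :: 'e assume x: "x \<in> ball 0 \<delta>"
  obtain \<delta>' where d: "norm x < \<delta>'" "\<delta>' < \<delta>" using x dense[of "norm x" \<delta>] by auto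
  have dpos: "0 < \<delta>'" using d(1) norm_ge_zero[of x] by linarith
  have sub: "y \<in> ball 0 \<delta>" if "y \<in> ball 0 \<delta>'" for y :: 'e using that d(2) by simp
  have subs: "ball 0 \<delta>' \<subseteq> ball (0::'e) \<delta>" using sub by blast
  have M': "card E * \<delta>' * M \<le> 1/4"
    using M d(2) by (intro order_trans[OF _ M(1)] mult_right_mono mult_left_mono) auto
  have fE: "finite E" using E finite_Basis finite_subset by blast
  obtain R0 where R0: "0 \<le> R0" "\<forall>y\<in>cball 0 \<delta>'. norm (b y) \<le> R0"
    using bounded_on_cball[OF Ck_on_continuous[OF b] d(2)] by blast
  have "\<exists>K\<ge>0. \<forall>v\<in>Basis. \<forall>y\<in>cball 0 \<delta>'. norm (ddir v b y) \<le> K"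
  proof (rule finite_uniform_bound[OF finite_Basis])
    fix v :: 'e
    show "\<exists>K\<ge>0. \<forall>y\<in>cball 0 \<delta>'. norm (ddir v b y) \<le> K"
      by (rule bounded_on_cball[OF _ d(2)]) (use b in simp)
  qed
  then obtain B0 where B0: "0 \<le> B0" "\<forall>v\<in>Basis. \<forall>y\<in>cball 0 \<delta>'. norm (ddir v b y) \<le> B0" by blast
  have LE: "\<exists>K\<ge>0. \<forall>p\<in>E \<times> Basis \<times> Basis. \<forall>y\<in>cball 0 \<delta>'. norm (ddir (fst (snd p)) (\<lambda>y. A (fst p) y (snd (snd p))) y) \<le> K"
  proof (rule finite_uniform_bound)
    show "finite (E \<times> (Basis::'e set) \<times> (Basis::'w set))" using fE by simp
    fix p assume "p \<in> E \<times> (Basis::'e set) \<times> (Basis::'w set)"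
    then have p: "fst p \<in> E" "snd (snd p) \<in> Basis" by auto
    show "\<exists>K\<ge>0. \<forall>y\<in>cball 0 \<delta>'. norm (ddir (fst (snd p)) (\<lambda>y. A (fst p) y (snd (snd p))) y) \<le> K"
      by (rule bounded_on_cball[OF _ d(2)]) (use CA[OF p] in simp)
  qed
  then obtain L where L: "0 \<le> L"
    "\<And>c v i y. c \<in> E \<Longrightarrow> v \<in> Basis \<Longrightarrow> i \<in> Basis \<Longrightarrow> y \<in> cball 0 \<delta>' \<Longrightarrow> norm (ddir v (\<lambda>y. A c y i) y) \<le> L"
  proof -
    from LE obtain L where L: "0 \<le> L" "\<forall>p\<in>E \<times> Basis \<times> Basis. \<forall>y\<in>cball 0 \<delta>'. norm (ddir (fst (snd p)) (\<lambda>y. A (fst p) y (snd (snd p))) y) \<le> L"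
      by blast
    have "norm (ddir v (\<lambda>y. A c y i) y) \<le> L" if "c \<in> E" "v \<in> Basis" "i \<in> Basis" "y \<in> cball 0 \<delta>'" for c v i y
      using bspec[OF bspec[OF L(2), of "(c, v, i)"] that(4)] that(1-3) by simp
    with L(1) show thesis by (rule that)
  qed
  \<comment> \<open>For a linear equation the radius \<open>R\<close> is only a bound of the solution, so it may follow that of \<open>b\<close>.\<close>
  define R where "R = 2 * R0"
  define G1 where "G1 c v y w = (\<Sum>i\<in>Basis. (w \<bullet> i) *\<^sub>R ddir v (\<lambda>y. A c y i) y)" for c v y and w :: 'w
  define M1 where "M1 = real DIM('w) * L * (R + 1)"
  have R: "0 \<le> R" unfolding R_def using R0(1) by simp
  have G1b: "norm (G1 c v y w) \<le> (real DIM('w) * L) * norm w" if "c \<in> E" "v \<in> Basis" "y \<in> ball 0 \<delta>'" for c v y w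
  proof -
    have "y \<in> cball 0 \<delta>'" using that(3) by simp
    then show ?thesis unfolding G1_def by (intro norm_Basis_combination_bound L(2)[OF that(1,2)])
  qed
  have "\<exists>u. Ck_on (Suc 0) (ball 0 \<delta>') u \<and> (\<forall>y\<in>ball 0 \<delta>'. norm (u y) \<le> R) \<and>
    (\<forall>x\<in>ball 0 \<delta>'. u x = b x + ray_sum E j (\<lambda>c y. A c y (u y)) x)"
  proof (rule C1_fixed_point[where E = E and \<delta> = \<delta>' and b = b and R = R and G = A and j = j and M = M and ?M0.0 = "M * R" and ?M1.0 = M1 and ?B0.0 = B0 and ?G1.0 = G1
        and ?G2.0 = "\<lambda>c y z w. A c y w"])
    show "E \<subseteq> Basis" "0 < \<delta>'" "0 \<le> M" "0 \<le> B0" "0 \<le> R" "0 \<le> M * R"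
      using E dpos M B0 R by auto
    show "0 \<le> M1" unfolding M1_def using L R by simp
    show "Ck_on (Suc 0) (ball 0 \<delta>') b" by (rule Ck_on_subset[OF b subs])
    show "norm (b y) \<le> R / 2" if "y \<in> ball 0 \<delta>'" for y using R0 that by (simp add: R_def)
    show "norm (ddir v b y) \<le> B0" if "v \<in> Basis" "y \<in> ball 0 \<delta>'" for v y using B0 that by simp
    have "card E * \<delta>' * (M * R) = (card E * \<delta>' * M) * R" by (simp only: mult.assoc)
    also have "\<dots> \<le> 1/4 * R" using M' R by (rule mult_right_mono)
    also have "\<dots> \<le> R / 2" using R by simp
    finally show "card E * \<delta>' * (M * R) \<le> R / 2" .
    show "card E * \<delta>' * M \<le> 1/4" by (rule M')
    show "norm (A c y w) \<le> M * R" if "c \<in> E" "y \<in> ball 0 \<delta>'" "norm w \<le> R" for c y w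
      using A[OF that(1) sub[OF that(2)]] mult_left_mono[OF that(3) M(2)] by (rule order_trans)
    show "norm (A c y w - A c y w') \<le> M * norm (w - w')" if "c \<in> E" "y \<in> ball 0 \<delta>'" for c y w w'
      unfolding linear_diff[OF lin[OF that(1) sub[OF that(2)]], symmetric] by (rule A[OF that(1) sub[OF that(2)]])
    show "Ck_on (Suc 0) (ball 0 \<delta>') (\<lambda>y. A c y (u y))" if "c \<in> E" "Ck_on (Suc 0) (ball 0 \<delta>') u" for c u
      by (rule Ck_on_linear_family[OF open_ball lin[OF that(1) sub] Ck_on_subset[OF CA[OF that(1)] subs] that(2)])
    show "ddir v (\<lambda>y. A c y (u y)) y = G1 c v y (u y) + A c y (ddir v u y)"
      if "c \<in> E" "Ck_on (Suc 0) (ball 0 \<delta>') u" "v \<in> Basis" "y \<in> ball 0 \<delta>'" for c u v y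
      unfolding G1_def
      by (rule ddir_linear_family[OF open_ball lin[OF that(1) sub] Ck_on_subset[OF CA[OF that(1)] subs] that(2,4)])
    show "norm (G1 c v y w) \<le> M1" if "c \<in> E" "v \<in> Basis" "y \<in> ball 0 \<delta>'" "norm w \<le> R" for c v y w
    proof (rule order_trans[OF G1b[OF that(1-3)]])
      show "real DIM('w) * L * norm w \<le> M1" unfolding M1_def using that(4) L by (intro mult_left_mono) auto
    qed
    show "norm (G1 c v y w - G1 c v y w') \<le> M1 * norm (w - w')" if "c \<in> E" "v \<in> Basis" "y \<in> ball 0 \<delta>'" for c v y w w'
    proof -
      have "G1 c v y w - G1 c v y w' = G1 c v y (w - w')"
        unfolding G1_def inner_diff_left scaleR_diff_left sum_subtractf ..
      moreover have "real DIM('w) * L \<le> M1" unfolding M1_def using L R mult_left_mono[of 1 "R + 1" "real DIM('w) * L"] by simp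
      ultimately show ?thesis
        by (simp only:) (rule order_trans[OF G1b[OF that] mult_right_mono[OF _ norm_ge_zero]])
    qed
    show "norm (A c y w) \<le> M * norm w" if "c \<in> E" "y \<in> ball 0 \<delta>'" for c y w
      by (rule A[OF that(1) sub[OF that(2)]])
    show "norm (A c y w - A c y w') \<le> M1 * norm (z - z') * norm w' + M * norm (w - w')"
      if "c \<in> E" "y \<in> ball 0 \<delta>'" for c y w w' and z z' :: 'w
    proof -
      have "norm (A c y w - A c y w') \<le> M * norm (w - w')"
        unfolding linear_diff[OF lin[OF that(1) sub[OF that(2)]], symmetric] by (rule A[OF that(1) sub[OF that(2)]])
      moreover have "0 \<le> M1 * norm (z - z') * norm w'" using \<open>0 \<le> M1\<close> by simp
      ultimately show ?thesis by linarith
    qed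
  qed
  then obtain u where u: "Ck_on (Suc 0) (ball 0 \<delta>') u"
    "\<And>x. x \<in> ball 0 \<delta>' \<Longrightarrow> u x = b x + ray_sum E j (\<lambda>c y. A c y (u y)) x" by blast
  have cl: "continuous_on (ball 0 \<delta>') (\<lambda>y. A c y (w y))" if "c \<in> E" "continuous_on (ball 0 \<delta>') w" for c and w :: "'e \<Rightarrow> 'w"
  proof -
    have "Ck_on 0 (ball 0 \<delta>') (\<lambda>y. A c y (w y))"
    proof (rule Ck_on_linear_family[OF open_ball lin[OF that(1) sub]])
      show "Ck_on 0 (ball 0 \<delta>') (\<lambda>y. A c y i)" if "i \<in> Basis" for i
        by (rule Ck_on_subset[OF Ck_on_Suc_imp[OF CA[OF \<open>c \<in> E\<close> that]] subs])
    qed (use that(2) in simp_all)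
    then show ?thesis by simp
  qed
  have zc: "continuous_on (ball 0 \<delta>') z" by (rule continuous_on_subset[OF z subs])
  have uc: "continuous_on (ball 0 \<delta>') u" by (rule Ck_on_continuous[OF u(1)])
  have "z y - u y = 0" if "y \<in> ball 0 \<delta>'" for y
  proof (rule linear_integral_unique_continuous[OF E M' M(2) A[OF _ sub] cl])
    show "continuous_on (ball 0 \<delta>') (\<lambda>y. z y - u y)" by (intro continuous_on_diff zc uc)
    then show "continuous_on (ball 0 \<delta>') (\<lambda>y. z y - u y)" .
    show "z x - u x = ray_sum E j (\<lambda>c y. A c y (z y - u y)) x" if x: "x \<in> ball 0 \<delta>'" for x
    proof -
      have "ray_int E j (\<lambda>y. A c y (z y - u y)) x = ray_int E j (\<lambda>y. A c y (z y)) x - ray_int E j (\<lambda>y. A c y (u y)) x" if c: "c \<in> E" for c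
        unfolding ray_int_diff[OF cl[OF c zc] cl[OF c uc] x, symmetric]
        by (rule ray_int_cong[OF linear_diff[OF lin[OF c sub]] x])
      then have "ray_sum E j (\<lambda>c y. A c y (z y - u y)) x
         = (\<Sum>c\<in>E. (x \<bullet> c) *\<^sub>R ray_int E j (\<lambda>y. A c y (z y)) x - (x \<bullet> c) *\<^sub>R ray_int E j (\<lambda>y. A c y (u y)) x)"
        by (intro sum.cong refl) (simp only: scaleR_diff_right)
      then show ?thesis unfolding sum_subtractf using eq[OF sub[OF x]] u(2)[OF x] by (simp only: add_diff_cancel_left)
    qed
  qed (use that in auto)
  then have "Ck_on (Suc 0) (ball 0 \<delta>') z"
    by (intro Ck_on_cong[OF open_ball _ u(1)]) (simp only: right_minus_eq)
  then show "\<exists>T. open T \<and> x \<in> T \<and> Ck_on (Suc 0) T z"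
    using d(1) by (intro exI[of _ "ball 0 \<delta>'"]) simp
qed

text \<open>The derivatives of a solution solve linear equations with the same \<open>A\<close>, a shifted weight, and an
  inhomogeneity that involves only \<open>z\<close> and derivatives of \<open>A\<close> and \<open>b\<close>.\<close>

lemma linear_integral_Ck:
  fixes E :: "'e::euclidean_space set" and z :: "'e \<Rightarrow> 'w::euclidean_space" and \<delta> M :: real
  assumes E: "E \<subseteq> Basis" and M: "card E * \<delta> * M \<le> 1/4" "0 \<le> M"
    and lin: "\<And>c y. c \<in> E \<Longrightarrow> y \<in> ball 0 \<delta> \<Longrightarrow> linear (A c y)"
    and A: "\<And>c y v. c \<in> E \<Longrightarrow> y \<in> ball 0 \<delta> \<Longrightarrow> norm (A c y v) \<le> M * norm v"
    and CA: "\<And>c i. c \<in> E \<Longrightarrow> i \<in> Basis \<Longrightarrow> Ck_on k (ball 0 \<delta>) (\<lambda>y. A c y i)"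
    and b: "Ck_on k (ball 0 \<delta>) b" and z: "continuous_on (ball 0 \<delta>) z"
    and eq: "\<And>x. x \<in> ball 0 \<delta> \<Longrightarrow> z x = b x + ray_sum E j (\<lambda>c y. A c y (z y)) x"
  shows "Ck_on k (ball 0 \<delta>) z"
  using CA b z eq
proof (induction k arbitrary: b z j)
  case 0
  then show ?case by simp
next
  case (Suc k)
  note CA = Suc.prems(1) and b = Suc.prems(2) and z = Suc.prems(3) and eq = Suc.prems(4)
  have CA': "\<And>c i. c \<in> E \<Longrightarrow> i \<in> Basis \<Longrightarrow> Ck_on k (ball 0 \<delta>) (\<lambda>y. A c y i)"
    using CA Ck_on_Suc_imp by blast
  have CA1: "\<And>c i. c \<in> E \<Longrightarrow> i \<in> Basis \<Longrightarrow> Ck_on (Suc 0) (ball 0 \<delta>) (\<lambda>y. A c y i)"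
    by (rule Ck_on_mono[OF CA]) auto
  have b1: "Ck_on (Suc 0) (ball 0 \<delta>) b" by (rule Ck_on_mono[OF b]) simp
  have zk: "Ck_on k (ball 0 \<delta>) z" by (rule Suc.IH[OF CA' Ck_on_Suc_imp[OF b] z eq])
  have z1: "Ck_on (Suc 0) (ball 0 \<delta>) z" by (rule linear_integral_C1[OF E M lin A CA1 b1 z eq])
  have Az1: "Ck_on (Suc 0) (ball 0 \<delta>) (\<lambda>y. A c y (z y))" if "c \<in> E" for c
    by (rule Ck_on_linear_family[OF open_ball lin[OF that] CA1[OF that] z1])
  have Azk: "Ck_on k (ball 0 \<delta>) (\<lambda>y. A c y (z y))" if "c \<in> E" for c
    by (rule Ck_on_linear_family[OF open_ball lin[OF that] CA'[OF that] zk])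
  let ?G = "\<lambda>v c y. \<Sum>i\<in>Basis. (z y \<bullet> i) *\<^sub>R ddir v (\<lambda>y. A c y i) y"
  have Gk: "Ck_on k (ball 0 \<delta>) (?G v c)" if "c \<in> E" for c v
    using CA[OF that] by (intro Ck_on_sum Ck_on_scaleR Ck_on_inner open_ball zk Ck_on_const) auto
  have "Ck_on k (ball 0 \<delta>) (ddir v z)" if v: "v \<in> Basis" for v
  proof (rule Suc.IH[OF CA'])
    let ?b = "\<lambda>x. ddir v b x + ((\<Sum>c\<in>E. (v \<bullet> c) *\<^sub>R ray_int E j (\<lambda>y. A c y (z y)) x)
      + ray_sum E (shift E v j) (?G v) x)"
    show "Ck_on k (ball 0 \<delta>) ?b"
    proof -
      have "Ck_on k (ball 0 \<delta>) (ddir v b)" using b by simp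
      then show ?thesis
        by (intro Ck_on_add Ck_on_sum Ck_on_scaleR Ck_on_inner ray_int_Ck_on open_ball Ck_on_const Ck_on_ident Azk Gk)
    qed
    show cv: "continuous_on (ball 0 \<delta>) (ddir v z)" using z1 by simp
    fix x :: 'e assume x: "x \<in> ball 0 \<delta>"
    have Gc: "continuous_on (ball 0 \<delta>) (?G v c)" if "c \<in> E" for c
      by (rule Ck_on_continuous[OF Gk[OF that]])
    have Ac: "continuous_on (ball 0 \<delta>) (\<lambda>y. A c y (ddir v z y))" if "c \<in> E" for c
    proof -
      have "Ck_on 0 (ball 0 \<delta>) (\<lambda>y. A c y (ddir v z y))"
        by (rule Ck_on_linear_family[OF open_ball lin[OF that] Ck_on_mono[OF CA'[OF that]]]) (use cv in auto)
      then show ?thesis by simp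
    qed
    have "ddir v z x = ddir v (\<lambda>x. b x + ray_sum E j (\<lambda>c y. A c y (z y)) x) x"
      using frechet_derivative_cong_open[OF open_ball x eq] by simp
    also have "\<dots> = ddir v b x + ((\<Sum>c\<in>E. (v \<bullet> c) *\<^sub>R ray_int E j (\<lambda>y. A c y (z y)) x)
      + ray_sum E (shift E v j) (\<lambda>c. ddir v (\<lambda>y. A c y (z y))) x)"
      by (rule ddir_integral_equation[OF v x b1 Az1])
    also have "ray_sum E (shift E v j) (\<lambda>c. ddir v (\<lambda>y. A c y (z y))) x
      = (\<Sum>c\<in>E. (x \<bullet> c) *\<^sub>R ray_int E (shift E v j) (?G v c) x + (x \<bullet> c) *\<^sub>R ray_int E (shift E v j) (\<lambda>y. A c y (ddir v z y)) x)"
    proof (rule sum.cong[OF refl])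
      fix c assume c: "c \<in> E"
      have "ray_int E (shift E v j) (ddir v (\<lambda>y. A c y (z y))) x
          = ray_int E (shift E v j) (\<lambda>y. ?G v c y + A c y (ddir v z y)) x"
        by (rule ray_int_cong[OF ddir_linear_family[OF open_ball lin[OF c] CA1[OF c] z1] x])
      then show "(x \<bullet> c) *\<^sub>R ray_int E (shift E v j) (ddir v (\<lambda>y. A c y (z y))) x
          = (x \<bullet> c) *\<^sub>R ray_int E (shift E v j) (?G v c) x + (x \<bullet> c) *\<^sub>R ray_int E (shift E v j) (\<lambda>y. A c y (ddir v z y)) x"
        unfolding ray_int_add[OF Gc[OF c] Ac[OF c] x] scaleR_add_right[symmetric] by (simp only:)
    qed
    finally show "ddir v z x = ?b x + ray_sum E (shift E v j) (\<lambda>c y. A c y (ddir v z y)) x"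
      unfolding sum.distrib by (simp only: add.assoc)
  qed
  then show ?case
    by (intro Ck_on_Suc_BasisI[OF open_ball Ck_on_has_derivative[OF z1]])
qed

section \<open>Integrating commuting vector fields\<close>

lemma C1_bounds:
  fixes f :: "'e::euclidean_space \<Rightarrow> 'w::euclidean_space"
  assumes f: "Ck_on (Suc 0) (ball 0 r) f" and R: "R < r"
  shows "\<exists>L\<ge>0. (\<forall>y\<in>cball 0 R. \<forall>w. norm (ddir w f y) \<le> L * norm w) \<and>
    (\<forall>y\<in>cball 0 R. \<forall>z\<in>cball 0 R. norm (f y - f z) \<le> L * norm (y - z))"
proof -
  have "\<exists>K\<ge>0. \<forall>v\<in>Basis. \<forall>y\<in>cball 0 R. norm (ddir v f y) \<le> K"
  proof (rule finite_uniform_bound[OF finite_Basis])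
    fix v :: 'e
    show "\<exists>K\<ge>0. \<forall>y\<in>cball 0 R. norm (ddir v f y) \<le> K"
      by (rule bounded_on_cball[OF _ R]) (use f in simp)
  qed
  then obtain K where K: "0 \<le> K" "\<And>v y. v \<in> Basis \<Longrightarrow> y \<in> cball 0 R \<Longrightarrow> norm (ddir v f y) \<le> K" by blast
  define L where "L = real DIM('e) * K"
  have L: "norm (ddir w f y) \<le> L * norm w" if y: "y \<in> cball 0 R" for y w
  proof -
    have "y \<in> ball 0 r" using y R by auto
    then have lin: "linear (frechet_derivative f (at y))"
      by (rule has_derivative_linear[OF Ck_on_has_derivative[OF f]])
    show ?thesis
      unfolding linear_Basis_expansion[OF lin, of w] L_def by (rule norm_Basis_combination_bound[OF K(2)[OF _ y]])
  qed
  have "norm (f y - f z) \<le> L * norm (y - z)" if "y \<in> cball 0 R" "z \<in> cball 0 R" for y z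
  proof (rule differentiable_bound[OF convex_cball _ _ that])
    fix x :: 'e assume x: "x \<in> cball 0 R"
    then have "x \<in> ball 0 r" using R by auto
    then show "(f has_derivative frechet_derivative f (at x)) (at x within cball 0 R)"
      by (rule has_derivative_at_withinI[OF Ck_on_has_derivative[OF f]])
    show "onorm (frechet_derivative f (at x)) \<le> L" by (rule onorm_le) (rule L[OF x])
  qed
  moreover have "0 \<le> L" using K by (simp add: L_def)
  ultimately show ?thesis using L by blast
qed

text \<open>Substitution \<open>t \<mapsto> s t\<close>, with \<open>m\<^sub>t \<circ> m\<^sub>s = m\<^sub>t\<^sub>s\<close>.\<close>

lemma ray_int_primitive:
  fixes h :: "'e::euclidean_space \<Rightarrow> 'w::euclidean_space"
  assumes h: "continuous_on (ball 0 \<delta>) h" and x: "x \<in> ball 0 \<delta>" and s: "0 \<le> s" "s \<le> 1"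
  shows "s *\<^sub>R ray_int E 0 h (contr E s x) = integral {0..s} (\<lambda>t. h (contr E t x))"
proof -
  have "continuous_on {0..1} (\<lambda>t. t ^ 0 *\<^sub>R h (contr E t x))"
    by (rule ray_int_integrand_continuous[OF h x])
  then have c: "continuous_on {0..1} (\<lambda>t. h (contr E t x))" by simp
  have "((\<lambda>t. s *\<^sub>R h (contr E (s * t) x)) has_integral integral {s * 0..s * 1} (\<lambda>t. h (contr E t x))) {0..1}"
  proof (rule has_integral_substitution[where c = 0 and d = 1])
    show "(\<lambda>t. s * t) ` {0..1} \<subseteq> {0..1}" using s by (auto simp: mult_le_one)
    show "((\<lambda>t. s * t) has_field_derivative s) (at t within {0..1})" for t
      by (auto intro!: derivative_eq_intros)
  qed (use s c in auto)
  then have "integral {0..1} (\<lambda>t. s *\<^sub>R h (contr E (s * t) x)) = integral {s * 0..s * 1} (\<lambda>t. h (contr E t x))"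
    by (rule integral_unique)
  then show ?thesis
    unfolding ray_int_def contr_contr integral_cmul[symmetric] power_0 scaleR_one
    by (simp only: mult.commute mult_1 mult_zero_left)
qed

text \<open>Put \<open>\<eta> = a\<^sub>c \<circ> \<Phi>\<close>.  Along the ray, \<open>s \<mapsto> \<Phi>(m\<^sub>s x)\<close> has the velocity \<open>\<Sum>\<^sub>d x\<^sub>d a\<^sub>d(\<Phi>)\<close>, hence \<open>\<eta>(m\<^sub>s x)\<close> has the
  velocity \<open>\<Sum>\<^sub>d x\<^sub>d Da\<^sub>c(a\<^sub>d) = \<Sum>\<^sub>d x\<^sub>d Da\<^sub>d(\<eta>)\<close> because the fields commute.  Integrating the derivative of
  \<open>s \<eta>(m\<^sub>s x)\<close> shows that \<open>\<eta>\<close> solves the linear equation obtained by differentiating the equation of \<open>\<Phi>\<close> in the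
  direction \<open>c\<close>.  By uniqueness \<open>\<eta> = \<partial>\<^sub>c\<Phi>\<close>.\<close>

lemma commuting_fields_integrate:
  fixes E :: "'e::euclidean_space set" and a :: "'e \<Rightarrow> 'e \<Rightarrow> 'e" and \<delta> M R r :: real
  assumes E: "E \<subseteq> Basis" and M: "card E * \<delta> * M \<le> 1/4" "0 \<le> M"
    and a: "\<And>c. c \<in> E \<Longrightarrow> Ck_on (Suc (Suc 0)) (ball 0 r) (a c)"
    and bound: "\<And>c y w. c \<in> E \<Longrightarrow> y \<in> cball 0 R \<Longrightarrow> norm (ddir w (a c) y) \<le> M * norm w" and R: "R < r"
    and comm: "\<And>c d y. c \<in> E \<Longrightarrow> d \<in> E \<Longrightarrow> y \<in> ball 0 r \<Longrightarrow> ddir (a d y) (a c) y = ddir (a c y) (a d) y"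
    and F: "Ck_on (Suc 0) (ball 0 \<delta>) \<Phi>" and FR: "\<And>y. y \<in> ball 0 \<delta> \<Longrightarrow> norm (\<Phi> y) \<le> R"
    and eq: "\<And>x. x \<in> ball 0 \<delta> \<Longrightarrow> \<Phi> x = contr E 0 x + ray_sum E 0 (\<lambda>c y. a c (\<Phi> y)) x"
    and x: "x \<in> ball 0 \<delta>" and c: "c \<in> E"
  shows "ddir c \<Phi> x = a c (\<Phi> x)"
proof -
  have Fr: "\<Phi> y \<in> ball 0 r" if "y \<in> ball 0 \<delta>" for y using FR[OF that] R by simp
  have FR': "\<Phi> y \<in> cball 0 R" if "y \<in> ball 0 \<delta>" for y using FR[OF that] by simp
  have a1: "Ck_on (Suc 0) (ball 0 r) (a d)" if "d \<in> E" for d using Ck_on_Suc_imp[OF a[OF that]] .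
  have da1: "Ck_on (Suc 0) (ball 0 r) (ddir w (a d))" if "d \<in> E" for d w using a[OF that] by simp
  have aF: "Ck_on (Suc 0) (ball 0 \<delta>) (\<lambda>y. a d (\<Phi> y))" if "d \<in> E" for d
    by (rule Ck_on_compose[OF open_ball a1[OF that] F]) (use Fr in blast)
  have caF: "continuous_on (ball 0 \<delta>) (\<lambda>y. a d (\<Phi> y))" if "d \<in> E" for d
    by (rule Ck_on_continuous[OF aF[OF that]])
  have lin: "linear (\<lambda>w. ddir w (a d) (\<Phi> y))" if "d \<in> E" "y \<in> ball 0 \<delta>" for d y
    by (rule has_derivative_linear[OF Ck_on_has_derivative[OF a1[OF that(1)] Fr[OF that(2)]]])
  have cA: "continuous_on (ball 0 \<delta>) (\<lambda>y. ddir (w y) (a d) (\<Phi> y))"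
    if "d \<in> E" "continuous_on (ball 0 \<delta>) w" for d and w :: "'e \<Rightarrow> 'e"
  proof -
    have "Ck_on 0 (ball 0 \<delta>) (\<lambda>y. ddir (w y) (a d) (\<Phi> y))"
    proof (rule Ck_on_linear_family[OF open_ball lin[OF that(1)]])
      show "Ck_on 0 (ball 0 \<delta>) (\<lambda>y. ddir b (a d) (\<Phi> y))" for b
        by (rule Ck_on_compose[OF open_ball Ck_on_Suc_imp[OF da1[OF that(1)]] Ck_on_Suc_imp[OF F]]) (use Fr in blast)
    qed (use that(2) in simp_all)
    then show ?thesis by simp
  qed
  define \<eta> where "\<eta> y = a c (\<Phi> y)" for y
  have ceta: "continuous_on (ball 0 \<delta>) \<eta>" unfolding \<eta>_def[abs_def] by (rule caF[OF c])
  have cont_k: "continuous_on {0..1} (\<lambda>s. k (contr E s x))" if "continuous_on (ball 0 \<delta>) k" "x \<in> ball 0 \<delta>"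
    for k :: "'e \<Rightarrow> 'e" and x
    using ray_int_integrand_continuous[OF that, of 0] by simp
  have eta: "\<eta> x = ray_int E 0 \<eta> x + ray_sum E (Suc 0) (\<lambda>d y. ddir (\<eta> y) (a d) (\<Phi> y)) x"
    if x: "x \<in> ball 0 \<delta>" for x
  proof -
    have mx: "contr E s x \<in> ball 0 \<delta>" if "s \<in> {0..1}" for s
      using contr_in_ball[of s x \<delta> E] that x by simp
    have Fm: "\<Phi> (contr E s x) = contr E 0 x + (\<Sum>d\<in>E. (x \<bullet> d) *\<^sub>R integral {0..s} (\<lambda>t. a d (\<Phi> (contr E t x))))"
      if s: "s \<in> {0..1}" for s
    proof -
      have "(contr E s x \<bullet> d) *\<^sub>R ray_int E 0 (\<lambda>y. a d (\<Phi> y)) (contr E s x)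
          = (x \<bullet> d) *\<^sub>R integral {0..s} (\<lambda>t. a d (\<Phi> (contr E t x)))" if d: "d \<in> E" for d
      proof -
        have "contr E s x \<bullet> d = (x \<bullet> d) * s" using d E contr_inner[of d E s x] by auto
        moreover have "s *\<^sub>R ray_int E 0 (\<lambda>y. a d (\<Phi> y)) (contr E s x) = integral {0..s} (\<lambda>t. a d (\<Phi> (contr E t x)))"
          by (rule ray_int_primitive[OF caF[OF d] x]) (use s in auto)
        ultimately show ?thesis by (metis scaleR_scaleR)
      qed
      then have "(\<Sum>d\<in>E. (contr E s x \<bullet> d) *\<^sub>R ray_int E 0 (\<lambda>y. a d (\<Phi> y)) (contr E s x))
          = (\<Sum>d\<in>E. (x \<bullet> d) *\<^sub>R integral {0..s} (\<lambda>t. a d (\<Phi> (contr E t x))))" by (intro sum.cong refl)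
      then show ?thesis using eq[OF mx[OF s]] by (simp add: contr_contr)
    qed
    let ?v = "\<lambda>s. \<Sum>d\<in>E. (x \<bullet> d) *\<^sub>R a d (\<Phi> (contr E s x))"
    have dF: "((\<lambda>s. \<Phi> (contr E s x)) has_vector_derivative ?v s) (at s within {0..1})" if s: "s \<in> {0..1}" for s
    proof (rule has_vector_derivative_transform[OF s Fm])
      show "((\<lambda>s. contr E 0 x + (\<Sum>d\<in>E. (x \<bullet> d) *\<^sub>R integral {0..s} (\<lambda>t. a d (\<Phi> (contr E t x))))) has_vector_derivative ?v s)
          (at s within {0..1})"
      proof -
        have "((\<lambda>s. integral {0..s} (\<lambda>t. a d (\<Phi> (contr E t x)))) has_vector_derivative a d (\<Phi> (contr E s x)))
            (at s within {0..1})" if "d \<in> E" for d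
          by (rule integral_has_vector_derivative[OF cont_k[OF caF[OF that] x] s])
        then have "((\<lambda>s. contr E 0 x + (\<Sum>d\<in>E. (x \<bullet> d) *\<^sub>R integral {0..s} (\<lambda>t. a d (\<Phi> (contr E t x))))) has_vector_derivative
            0 + ?v s) (at s within {0..1})"
          by (intro has_vector_derivative_add has_vector_derivative_const has_vector_derivative_sum
              bounded_linear.has_vector_derivative[OF bounded_linear_scaleR_right])
        then show ?thesis by simp
      qed
    qed
    have deta: "((\<lambda>s. \<eta> (contr E s x)) has_vector_derivative
        (\<Sum>d\<in>E. (x \<bullet> d) *\<^sub>R ddir (\<eta> (contr E s x)) (a d) (\<Phi> (contr E s x)))) (at s within {0..1})" if s: "s \<in> {0..1}" for s
    proof -
      let ?p = "\<Phi> (contr E s x)"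
      have l: "linear (frechet_derivative (a c) (at ?p))" using lin[OF c mx[OF s]] .
      have "(a c has_derivative frechet_derivative (a c) (at ?p)) (at ?p within ((\<lambda>s. \<Phi> (contr E s x)) ` {0..1}))"
        by (rule has_derivative_at_withinI[OF Ck_on_has_derivative[OF a1[OF c] Fr[OF mx[OF s]]]])
      from vector_derivative_diff_chain_within[OF dF[OF s] this]
      have "((\<lambda>s. \<eta> (contr E s x)) has_vector_derivative ddir (?v s) (a c) ?p) (at s within {0..1})"
        by (simp add: o_def \<eta>_def)
      also have "ddir (?v s) (a c) ?p = (\<Sum>d\<in>E. (x \<bullet> d) *\<^sub>R ddir (a d ?p) (a c) ?p)"
        by (simp only: linear_sum[OF l] linear_scale[OF l])
      also have "\<dots> = (\<Sum>d\<in>E. (x \<bullet> d) *\<^sub>R ddir (\<eta> (contr E s x)) (a d) ?p)"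
        unfolding \<eta>_def by (rule sum.cong[OF refl]) (simp only: comm[OF c _ Fr[OF mx[OF s]]])
      finally show ?thesis .
    qed
    let ?w = "\<lambda>s. s *\<^sub>R (\<Sum>d\<in>E. (x \<bullet> d) *\<^sub>R ddir (\<eta> (contr E s x)) (a d) (\<Phi> (contr E s x))) + 1 *\<^sub>R \<eta> (contr E s x)"
    have "(?w has_integral (1 *\<^sub>R \<eta> (contr E 1 x) - 0 *\<^sub>R \<eta> (contr E 0 x))) {0..1}"
    proof (rule fundamental_theorem_of_calculus)
      fix s :: real assume s: "s \<in> {0..1}"
      have "((\<lambda>s. s) has_field_derivative 1) (at s within {0..1})" by (rule DERIV_ident)
      from has_vector_derivative_scaleR[OF this deta[OF s]]
      show "((\<lambda>s. s *\<^sub>R \<eta> (contr E s x)) has_vector_derivative ?w s) (at s within {0..1})" .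
    qed simp
    then have "(?w has_integral \<eta> x) {0..1}" by simp
    then have "\<eta> x = integral {0..1} ?w" by (rule integral_unique[symmetric])
    also have "\<dots> = integral {0..1} (\<lambda>s. (\<Sum>d\<in>E. (x \<bullet> d) *\<^sub>R (s ^ Suc 0 *\<^sub>R ddir (\<eta> (contr E s x)) (a d) (\<Phi> (contr E s x))))
        + s ^ 0 *\<^sub>R \<eta> (contr E s x))"
      by (rule integral_cong) (simp add: scaleR_sum_right mult.commute)
    also have "\<dots> = ray_sum E (Suc 0) (\<lambda>d y. ddir (\<eta> y) (a d) (\<Phi> y)) x + ray_int E 0 \<eta> x"
    proof -
      have fE: "finite E" using E finite_Basis finite_subset by blast
      have i: "(\<lambda>s. s ^ Suc 0 *\<^sub>R ddir (\<eta> (contr E s x)) (a d) (\<Phi> (contr E s x))) integrable_on {0..1}" if "d \<in> E" for d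
        by (rule ray_int_integrable[OF cA[OF that ceta] x])
      have i0: "(\<lambda>s. s ^ 0 *\<^sub>R \<eta> (contr E s x)) integrable_on {0..1}" by (rule ray_int_integrable[OF ceta x])
      have "((\<lambda>s. (\<Sum>d\<in>E. (x \<bullet> d) *\<^sub>R (s ^ Suc 0 *\<^sub>R ddir (\<eta> (contr E s x)) (a d) (\<Phi> (contr E s x))))
        + s ^ 0 *\<^sub>R \<eta> (contr E s x)) has_integral
        ray_sum E (Suc 0) (\<lambda>d y. ddir (\<eta> y) (a d) (\<Phi> y)) x + ray_int E 0 \<eta> x) {0..1}"
        unfolding ray_int_def
        by (intro has_integral_add has_integral_sum fE has_integral_cmul integrable_integral i i0)
      then show ?thesis by (rule integral_unique)
    qed
    finally show ?thesis by (simp only: add.commute)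
  qed
  have cD: "continuous_on (ball 0 \<delta>) (ddir c \<Phi>)" using F by simp
  have Deq: "ddir c \<Phi> x = ray_int E 0 \<eta> x + ray_sum E (Suc 0) (\<lambda>d y. ddir (ddir c \<Phi> y) (a d) (\<Phi> y)) x"
    if x: "x \<in> ball 0 \<delta>" for x
  proof -
    have cB: "c \<in> Basis" using c E by blast
    have fE: "finite E" using E finite_Basis finite_subset by blast
    have "ddir c \<Phi> x = ddir c (\<lambda>x. contr E 0 x + ray_sum E 0 (\<lambda>d y. a d (\<Phi> y)) x) x"
      using frechet_derivative_cong_open[OF open_ball x eq] by simp
    also have "\<dots> = ddir c (contr E 0) x + ((\<Sum>d\<in>E. (c \<bullet> d) *\<^sub>R ray_int E 0 (\<lambda>y. a d (\<Phi> y)) x)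
      + ray_sum E (shift E c 0) (\<lambda>d. ddir c (\<lambda>y. a d (\<Phi> y))) x)"
      by (rule ddir_integral_equation[OF cB x Ck_on_linear[OF linear_contr open_ball Ck_on_ident] aF])
    also have "ddir c (contr E 0) x = 0"
      unfolding ddir_eq[OF linear_imp_has_derivative[OF linear_contr]] contr_Basis[OF cB] using c by simp
    also have "(\<Sum>d\<in>E. (c \<bullet> d) *\<^sub>R ray_int E 0 (\<lambda>y. a d (\<Phi> y)) x) = (\<Sum>d\<in>E. if d = c then ray_int E 0 \<eta> x else 0)"
      unfolding \<eta>_def[abs_def] by (rule sum.cong) (use E cB in \<open>auto simp: inner_Basis\<close>)
    also have "\<dots> = ray_int E 0 \<eta> x" using c fE by simp
    also have "ray_sum E (shift E c 0) (\<lambda>d. ddir c (\<lambda>y. a d (\<Phi> y))) x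
      = ray_sum E (Suc 0) (\<lambda>d y. ddir (ddir c \<Phi> y) (a d) (\<Phi> y)) x"
    proof (rule sum.cong[OF refl])
      fix d assume d: "d \<in> E"
      have "ddir c (\<lambda>y. a d (\<Phi> y)) y = ddir (ddir c \<Phi> y) (a d) (\<Phi> y)" if y: "y \<in> ball 0 \<delta>" for y
        using ddir_eq[OF diff_chain_at[OF Ck_on_has_derivative[OF F y] Ck_on_has_derivative[OF a1[OF d] Fr[OF y]]], of c]
        by (simp only: o_def)
      from ray_int_cong[where f = "ddir c (\<lambda>y. a d (\<Phi> y))", OF this x]
      show "(x \<bullet> d) *\<^sub>R ray_int E (shift E c 0) (ddir c (\<lambda>y. a d (\<Phi> y))) x
          = (x \<bullet> d) *\<^sub>R ray_int E (Suc 0) (\<lambda>y. ddir (ddir c \<Phi> y) (a d) (\<Phi> y)) x" using c by simp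
    qed
    finally show ?thesis by simp
  qed
  have "ddir c \<Phi> x - \<eta> x = 0"
  proof (rule linear_integral_unique_continuous[where A = "\<lambda>d y w. ddir w (a d) (\<Phi> y)" and w = "\<lambda>y. ddir c \<Phi> y - \<eta> y",
        OF E M bound[OF _ FR'] cA])
    show cw: "continuous_on (ball 0 \<delta>) (\<lambda>y. ddir c \<Phi> y - \<eta> y)" by (intro continuous_on_diff cD ceta)
    then show "continuous_on (ball 0 \<delta>) (\<lambda>y. ddir c \<Phi> y - \<eta> y)" .
    fix x :: 'e assume x: "x \<in> ball 0 \<delta>"
    have "ray_sum E (Suc 0) (\<lambda>d y. ddir (ddir c \<Phi> y - \<eta> y) (a d) (\<Phi> y)) x
      = (\<Sum>d\<in>E. (x \<bullet> d) *\<^sub>R ray_int E (Suc 0) (\<lambda>y. ddir (ddir c \<Phi> y) (a d) (\<Phi> y)) x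
         - (x \<bullet> d) *\<^sub>R ray_int E (Suc 0) (\<lambda>y. ddir (\<eta> y) (a d) (\<Phi> y)) x)"
    proof (rule sum.cong[OF refl])
      fix d assume d: "d \<in> E"
      have "ray_int E (Suc 0) (\<lambda>y. ddir (ddir c \<Phi> y - \<eta> y) (a d) (\<Phi> y)) x
          = ray_int E (Suc 0) (\<lambda>y. ddir (ddir c \<Phi> y) (a d) (\<Phi> y) - ddir (\<eta> y) (a d) (\<Phi> y)) x"
        by (rule ray_int_cong[OF linear_diff[OF lin[OF d]] x])
      then show "(x \<bullet> d) *\<^sub>R ray_int E (Suc 0) (\<lambda>y. ddir (ddir c \<Phi> y - \<eta> y) (a d) (\<Phi> y)) x
        = (x \<bullet> d) *\<^sub>R ray_int E (Suc 0) (\<lambda>y. ddir (ddir c \<Phi> y) (a d) (\<Phi> y)) x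
         - (x \<bullet> d) *\<^sub>R ray_int E (Suc 0) (\<lambda>y. ddir (\<eta> y) (a d) (\<Phi> y)) x"
        unfolding ray_int_diff[OF cA[OF d cD] cA[OF d ceta] x] scaleR_diff_right[symmetric] by (simp only:)
    qed
    then show "ddir c \<Phi> x - \<eta> x = ray_sum E (Suc 0) (\<lambda>d y. ddir (ddir c \<Phi> y - \<eta> y) (a d) (\<Phi> y)) x"
      unfolding sum_subtractf using Deq[OF x] eta[OF x] by (simp only: add_diff_cancel_left)
  qed (use x in auto)
  then show ?thesis by (simp add: \<eta>_def)
qed

text \<open>The common flow of commuting fields, started on the subspace complementary to \<open>span E\<close>: the solution of
  \<open>\<Phi> = Q + ray_sum (a\<^sub>c \<circ> \<Phi>)\<close>.  One equation replaces the composition of the flows of the single fields.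
  Smoothness follows by bootstrapping: if \<open>\<Phi>\<close> is \<open>C\<^sup>k\<close>, then its derivatives solve linear equations with \<open>C\<^sup>k\<close>
  coefficients.\<close>

lemma commuting_fields_flow:
  fixes E :: "'e::euclidean_space set" and a :: "'e \<Rightarrow> 'e \<Rightarrow> 'e" and r :: real
  assumes E: "E \<subseteq> Basis" and r: "0 < r"
    and a: "\<And>c. c \<in> E \<Longrightarrow> smooth_on (ball 0 r) (a c)"
    and comm: "\<And>c d y. c \<in> E \<Longrightarrow> d \<in> E \<Longrightarrow> y \<in> ball 0 r \<Longrightarrow> ddir (a d y) (a c) y = ddir (a c y) (a d) y"
  obtains \<delta> \<Phi> where "0 < \<delta>" "smooth_on (ball 0 \<delta>) \<Phi>" "\<Phi> ` ball 0 \<delta> \<subseteq> ball 0 r" "\<Phi> 0 = 0"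
    "\<And>c x. c \<in> E \<Longrightarrow> x \<in> ball 0 \<delta> \<Longrightarrow> ddir c \<Phi> x = a c (\<Phi> x)"
    "\<And>b. b \<in> Basis - E \<Longrightarrow> ddir b \<Phi> 0 = b"
proof -
  define R where "R = r / 2"
  have R: "0 < R" "R < r" using r by (simp_all add: R_def)
  have fE: "finite E" using E finite_Basis finite_subset by blast
  have a1: "Ck_on (Suc 0) (ball 0 r) (a c)" if "c \<in> E" for c by (rule smooth_onD[OF a[OF that]])
  have a2: "Ck_on (Suc (Suc 0)) (ball 0 r) (a c)" if "c \<in> E" for c by (rule smooth_onD[OF a[OF that]])
  have da1: "Ck_on (Suc 0) (ball 0 r) (ddir v (a c))" if "c \<in> E" for c v
    using a2[OF that] by simp
  have "\<exists>K\<ge>0. \<forall>c\<in>E. \<forall>y\<in>cball 0 R. norm (a c y) \<le> K"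
    by (rule finite_uniform_bound[OF fE bounded_on_cball[OF Ck_on_continuous[OF a1] R(2)]])
  then obtain M0 where M0: "0 \<le> M0" "\<And>c y. c \<in> E \<Longrightarrow> y \<in> cball 0 R \<Longrightarrow> norm (a c y) \<le> M0" by blast
  have "\<exists>L. \<forall>c\<in>E. 0 \<le> L c \<and> (\<forall>y\<in>cball 0 R. \<forall>w. norm (ddir w (a c) y) \<le> L c * norm w) \<and>
    (\<forall>y\<in>cball 0 R. \<forall>z\<in>cball 0 R. norm (a c y - a c z) \<le> L c * norm (y - z))"
    by (rule bchoice) (use C1_bounds[OF a1 R(2)] in blast)
  then obtain L where L: "\<And>c. c \<in> E \<Longrightarrow> 0 \<le> L c"
    "\<And>c y w. c \<in> E \<Longrightarrow> y \<in> cball 0 R \<Longrightarrow> norm (ddir w (a c) y) \<le> L c * norm w"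
    "\<And>c y z. c \<in> E \<Longrightarrow> y \<in> cball 0 R \<Longrightarrow> z \<in> cball 0 R \<Longrightarrow> norm (a c y - a c z) \<le> L c * norm (y - z)"
    by blast
  define M where "M = sum L E"
  have M: "0 \<le> M" unfolding M_def by (rule sum_nonneg[OF L(1)])
  have LM: "L c \<le> M" if "c \<in> E" for c
    unfolding M_def by (rule member_le_sum[OF that _ fE]) (use L(1) in blast)
  have Da: "norm (ddir w (a c) y) \<le> M * norm w" if "c \<in> E" "y \<in> cball 0 R" for c y w
    by (rule order_trans[OF L(2)[OF that] mult_right_mono[OF LM[OF that(1)] norm_ge_zero]])
  have La: "norm (a c y - a c z) \<le> M * norm (y - z)" if "c \<in> E" "y \<in> cball 0 R" "z \<in> cball 0 R" for c y z
    by (rule order_trans[OF L(3)[OF that] mult_right_mono[OF LM[OF that(1)] norm_ge_zero]])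
  have "\<exists>L2. \<forall>p\<in>E \<times> Basis. 0 \<le> L2 p \<and>
    (\<forall>y\<in>cball 0 R. \<forall>z\<in>cball 0 R. norm (ddir (snd p) (a (fst p)) y - ddir (snd p) (a (fst p)) z) \<le> L2 p * norm (y - z))"
  proof (rule bchoice, rule ballI)
    fix p assume "p \<in> E \<times> (Basis :: 'e set)"
    then have "fst p \<in> E" by auto
    from C1_bounds[OF da1[OF this, of "snd p"] R(2)]
    show "\<exists>L2. 0 \<le> L2 \<and> (\<forall>y\<in>cball 0 R. \<forall>z\<in>cball 0 R. norm (ddir (snd p) (a (fst p)) y - ddir (snd p) (a (fst p)) z) \<le> L2 * norm (y - z))"
      by blast
  qed
  then obtain L2 where L2: "\<And>c i. c \<in> E \<Longrightarrow> i \<in> Basis \<Longrightarrow> 0 \<le> L2 (c, i)"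
    "\<And>c i y z. c \<in> E \<Longrightarrow> i \<in> Basis \<Longrightarrow> y \<in> cball 0 R \<Longrightarrow> z \<in> cball 0 R \<Longrightarrow>
      norm (ddir i (a c) y - ddir i (a c) z) \<le> L2 (c, i) * norm (y - z)"
    by force
  \<comment> \<open>A Lipschitz constant for the derivatives of all the fields on the ball of radius \<open>R\<close>.\<close>
  define M1 where "M1 = (\<Sum>p\<in>E \<times> Basis. L2 p) * real DIM('e)"
  have sL2: "0 \<le> (\<Sum>p\<in>E \<times> Basis. L2 p)" by (rule sum_nonneg) (use L2(1) in auto)
  have M1: "0 \<le> M1" unfolding M1_def using sL2 by simp
  have lin: "linear (\<lambda>w. ddir w (a c) y)" if "c \<in> E" "y \<in> cball 0 R" for c y
    by (rule has_derivative_linear[OF Ck_on_has_derivative[OF a1[OF that(1)]]]) (use that(2) R in auto)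
  have DDa: "norm (ddir w (a c) z - ddir w (a c) z') \<le> M1 * norm (z - z') * norm w"
    if "c \<in> E" "z \<in> cball 0 R" "z' \<in> cball 0 R" for c z z' w
  proof -
    have rp: "ddir w (a c) y = (\<Sum>i\<in>Basis. (w \<bullet> i) *\<^sub>R ddir i (a c) y)" if "y \<in> cball 0 R" for y
      by (rule linear_Basis_expansion[OF lin[OF \<open>c \<in> E\<close> that]])
    have "ddir w (a c) z - ddir w (a c) z' = (\<Sum>i\<in>Basis. (w \<bullet> i) *\<^sub>R (ddir i (a c) z - ddir i (a c) z'))"
      unfolding rp[OF that(2)] rp[OF that(3)] scaleR_diff_right sum_subtractf ..
    also have "norm \<dots> \<le> real DIM('e) * ((\<Sum>p\<in>E \<times> Basis. L2 p) * norm (z - z')) * norm w"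
    proof (rule norm_Basis_combination_bound)
      fix i :: 'e assume i: "i \<in> Basis"
      have "L2 (c, i) \<le> (\<Sum>p\<in>E \<times> Basis. L2 p)"
        by (rule member_le_sum) (use that(1) i L2(1) fE in auto)
      then show "norm (ddir i (a c) z - ddir i (a c) z') \<le> (\<Sum>p\<in>E \<times> Basis. L2 p) * norm (z - z')"
        by (rule order_trans[OF L2(2)[OF that(1) i that(2,3)] mult_right_mono[OF _ norm_ge_zero]])
    qed
    also have "\<dots> = M1 * norm (z - z') * norm w" by (simp add: M1_def mult_ac)
    finally show ?thesis .
  qed
  define N where "N = real (card E)"
  \<comment> \<open>The three entries give \<open>|Q x| \<le> R / 2\<close>, bound the integral term by \<open>R / 2\<close>, and make the Lipschitz
    constant of the integral term at most \<open>1/4\<close>; adding \<open>1\<close> avoids vanishing denominators.\<close>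
  define \<delta> where "\<delta> = min (R / 2) (min (R / (2 * (N * M0 + 1))) (1 / (4 * (N * M + 1))))"
  have NM0: "0 \<le> N * M0" "0 \<le> N * M" using M0(1) M by (simp_all add: N_def)
  have dpos: "0 < \<delta>" unfolding \<delta>_def using R NM0 by simp
  have d1: "\<delta> \<le> R / 2" unfolding \<delta>_def by (rule min.cobounded1)
  have d2: "N * \<delta> * M0 \<le> R / 2"
  proof -
    have "\<delta> \<le> R / (2 * (N * M0 + 1))" unfolding \<delta>_def by simp
    then have "N * M0 * \<delta> \<le> N * M0 * (R / (2 * (N * M0 + 1)))" by (rule mult_left_mono[OF _ NM0(1)])
    also have "\<dots> = (N * M0 / (N * M0 + 1)) * (R / 2)" by simp
    also have "\<dots> \<le> 1 * (R / 2)" using NM0(1) R by (intro mult_right_mono) auto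
    finally show ?thesis by (simp add: mult_ac)
  qed
  have d3: "N * \<delta> * M \<le> 1/4"
  proof -
    have "\<delta> \<le> 1 / (4 * (N * M + 1))" unfolding \<delta>_def by simp
    then have "N * M * \<delta> \<le> N * M * (1 / (4 * (N * M + 1)))" by (rule mult_left_mono[OF _ NM0(2)])
    also have "\<dots> = (N * M / (N * M + 1)) * (1/4)" by simp
    also have "\<dots> \<le> 1 * (1/4)" using NM0(2) by (intro mult_right_mono) auto
    finally show ?thesis by (simp add: mult_ac)
  qed
  have comp: "Ck_on k (ball 0 \<delta>) (\<lambda>y. f (u y))"
    if "Ck_on k (ball 0 r) f" "Ck_on k (ball 0 \<delta>) u" "\<And>y. y \<in> ball 0 \<delta> \<Longrightarrow> norm (u y) \<le> R"
    for k and f u :: "'e \<Rightarrow> 'e"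
    by (rule Ck_on_compose[OF open_ball that(1,2)]) (use that(3) R in force)
  have dcontr: "ddir v (contr E 0) y = contr E 0 v" for v y
    by (rule ddir_eq[OF linear_imp_has_derivative[OF linear_contr]])
  have "\<exists>u. Ck_on (Suc 0) (ball 0 \<delta>) u \<and> (\<forall>y\<in>ball 0 \<delta>. norm (u y) \<le> R) \<and>
    (\<forall>x\<in>ball 0 \<delta>. u x = contr E 0 x + ray_sum E 0 (\<lambda>c y. a c (u y)) x)"
  proof (rule C1_fixed_point[where E = E and \<delta> = \<delta> and b = "contr E 0" and R = R and G = "\<lambda>c y z. a c z" and j = 0
        and M = M and ?M0.0 = M0 and ?M1.0 = M1 and ?B0.0 = 1 and ?G1.0 = "\<lambda>c v y z. 0"
        and ?G2.0 = "\<lambda>c y z w. ddir w (a c) z"])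
    show "E \<subseteq> Basis" "0 < \<delta>" "0 \<le> M" "0 \<le> M0" "0 \<le> M1" "0 \<le> (1::real)" "0 \<le> R"
      using E dpos M M0 M1 R by auto
    show "Ck_on (Suc 0) (ball 0 \<delta>) (contr E 0)" by (rule Ck_on_linear[OF linear_contr open_ball Ck_on_ident])
    show "norm (contr E 0 y) \<le> R / 2" if "y \<in> ball 0 \<delta>" for y
      using norm_contr_le[of 0 E y] that d1 by simp
    show "norm (ddir v (contr E 0) y) \<le> 1" if "v \<in> Basis" for v y
      unfolding dcontr using norm_contr_le[of 0 E v] that by simp
    show "real (card E) * \<delta> * M0 \<le> R / 2" "real (card E) * \<delta> * M \<le> 1/4"
      using d2 d3 by (simp_all add: N_def)
    show "norm (a c z) \<le> M0" if "c \<in> E" "norm z \<le> R" for c z using M0(2)[OF that(1), of z] that(2) by simp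
    show "norm (a c z - a c z') \<le> M * norm (z - z')" if "c \<in> E" "norm z \<le> R" "norm z' \<le> R" for c z z'
      by (rule La[OF that(1)]) (use that in simp_all)
    show "Ck_on (Suc 0) (ball 0 \<delta>) (\<lambda>y. a c (u y))"
      if "c \<in> E" "Ck_on (Suc 0) (ball 0 \<delta>) u" "\<And>y. y \<in> ball 0 \<delta> \<Longrightarrow> norm (u y) \<le> R" for c and u :: "'e \<Rightarrow> 'e"
      by (rule comp[OF a1[OF that(1)] that(2,3)])
    show "ddir v (\<lambda>y. a c (u y)) y = 0 + ddir (ddir v u y) (a c) (u y)"
      if "c \<in> E" "Ck_on (Suc 0) (ball 0 \<delta>) u" "\<And>y. y \<in> ball 0 \<delta> \<Longrightarrow> norm (u y) \<le> R" "y \<in> ball 0 \<delta>" for c u v y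
    proof -
      have "u y \<in> ball 0 r" using that(3)[OF that(4)] R by simp
      from ddir_eq[OF diff_chain_at[OF Ck_on_has_derivative[OF that(2,4)] Ck_on_has_derivative[OF a1[OF that(1)] this]], of v]
      show ?thesis by (simp only: o_def add_0)
    qed
    show "norm (0::'e) \<le> M1" using M1 by simp
    show "norm ((0::'e) - 0) \<le> M1 * norm (z - z')" for z z' :: 'e using M1 by simp
    show "norm (ddir w (a c) z) \<le> M * norm w" if "c \<in> E" "norm z \<le> R" for c z w
      by (rule Da[OF that(1)]) (use that in simp)
    show "norm (ddir w (a c) z - ddir w' (a c) z') \<le> M1 * norm (z - z') * norm w' + M * norm (w - w')"
      if "c \<in> E" "norm z \<le> R" "norm z' \<le> R" for c z z' w w'
    proof -
      have z: "z \<in> cball 0 R" "z' \<in> cball 0 R" using that by simp_all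
      have "ddir w (a c) z - ddir w' (a c) z' = (ddir w' (a c) z - ddir w' (a c) z') + ddir (w - w') (a c) z"
        unfolding linear_diff[OF lin[OF that(1) z(1)]] by simp
      then show ?thesis
        by (simp only:) (rule norm_triangle_le[OF add_mono[OF DDa[OF that(1) z] Da[OF that(1) z(1)]]])
    qed
  qed
  then obtain \<Phi> where F1: "Ck_on (Suc 0) (ball 0 \<delta>) \<Phi>" and FR: "\<And>y. y \<in> ball 0 \<delta> \<Longrightarrow> norm (\<Phi> y) \<le> R"
    and eq: "\<And>x. x \<in> ball 0 \<delta> \<Longrightarrow> \<Phi> x = contr E 0 x + ray_sum E 0 (\<lambda>c y. a c (\<Phi> y)) x"
    by blast
  have FR': "\<Phi> y \<in> cball 0 R" if "y \<in> ball 0 \<delta>" for y using FR[OF that] by simp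
  have aF: "Ck_on (Suc 0) (ball 0 \<delta>) (\<lambda>y. a c (\<Phi> y))" if "c \<in> E" for c
    by (rule comp[OF a1[OF that] F1 FR])
  have Deq: "ddir v \<Phi> x = (contr E 0 v + (\<Sum>d\<in>E. (v \<bullet> d) *\<^sub>R ray_int E 0 (\<lambda>y. a d (\<Phi> y)) x)) +
      ray_sum E (shift E v 0) (\<lambda>d y. ddir (ddir v \<Phi> y) (a d) (\<Phi> y)) x"
    if v: "v \<in> Basis" and x: "x \<in> ball 0 \<delta>" for v x
  proof -
    have "ddir v \<Phi> x = ddir v (\<lambda>x. contr E 0 x + ray_sum E 0 (\<lambda>d y. a d (\<Phi> y)) x) x"
      using frechet_derivative_cong_open[OF open_ball x eq] by simp
    also have "\<dots> = ddir v (contr E 0) x + ((\<Sum>d\<in>E. (v \<bullet> d) *\<^sub>R ray_int E 0 (\<lambda>y. a d (\<Phi> y)) x)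
      + ray_sum E (shift E v 0) (\<lambda>d. ddir v (\<lambda>y. a d (\<Phi> y))) x)"
      by (rule ddir_integral_equation[OF v x Ck_on_linear[OF linear_contr open_ball Ck_on_ident] aF])
    also have "ray_sum E (shift E v 0) (\<lambda>d. ddir v (\<lambda>y. a d (\<Phi> y))) x
      = ray_sum E (shift E v 0) (\<lambda>d y. ddir (ddir v \<Phi> y) (a d) (\<Phi> y)) x"
    proof (rule sum.cong[OF refl])
      fix d assume d: "d \<in> E"
      have "ddir v (\<lambda>y. a d (\<Phi> y)) y = ddir (ddir v \<Phi> y) (a d) (\<Phi> y)" if y: "y \<in> ball 0 \<delta>" for y
      proof -
        have "\<Phi> y \<in> ball 0 r" using FR[OF y] R by simp
        from ddir_eq[OF diff_chain_at[OF Ck_on_has_derivative[OF F1 y] Ck_on_has_derivative[OF a1[OF d] this]], of v]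
        show ?thesis by (simp only: o_def)
      qed
      from ray_int_cong[where f = "ddir v (\<lambda>y. a d (\<Phi> y))", OF this x]
      show "(x \<bullet> d) *\<^sub>R ray_int E (shift E v 0) (ddir v (\<lambda>y. a d (\<Phi> y))) x
          = (x \<bullet> d) *\<^sub>R ray_int E (shift E v 0) (\<lambda>y. ddir (ddir v \<Phi> y) (a d) (\<Phi> y)) x" by (simp only:)
    qed
    finally show ?thesis by (simp only: dcontr add.assoc)
  qed
  have "Ck_on k (ball 0 \<delta>) \<Phi>" for k
  proof (induction k)
    case 0
    show ?case by (rule Ck_on_Suc_imp[OF F1])
  next
    case (Suc k)
    have "Ck_on k (ball 0 \<delta>) (ddir v \<Phi>)" if v: "v \<in> Basis" for v
    proof (rule linear_integral_Ck[where A = "\<lambda>d y w. ddir w (a d) (\<Phi> y)" and z = "ddir v \<Phi>", OF E _ M])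
      show "real (card E) * \<delta> * M \<le> 1/4" using d3 by (simp add: N_def)
      show "linear (\<lambda>w. ddir w (a c) (\<Phi> y))" if "c \<in> E" "y \<in> ball 0 \<delta>" for c y
        by (rule lin[OF that(1) FR'[OF that(2)]])
      show "norm (ddir w (a c) (\<Phi> y)) \<le> M * norm w" if "c \<in> E" "y \<in> ball 0 \<delta>" for c y w
        by (rule Da[OF that(1) FR'[OF that(2)]])
      show "Ck_on k (ball 0 \<delta>) (\<lambda>y. ddir i (a c) (\<Phi> y))" if "c \<in> E" for c i
        by (rule comp[OF smooth_onD[OF smooth_on_ddir[OF a[OF that]]] Suc.IH FR])
      show "Ck_on k (ball 0 \<delta>) (\<lambda>x. contr E 0 v + (\<Sum>d\<in>E. (v \<bullet> d) *\<^sub>R ray_int E 0 (\<lambda>y. a d (\<Phi> y)) x))"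
        by (intro Ck_on_add Ck_on_sum Ck_on_scaleR Ck_on_const open_ball ray_int_Ck_on comp[OF smooth_onD[OF a] Suc.IH FR])
      show "continuous_on (ball 0 \<delta>) (ddir v \<Phi>)" using F1 by simp
    qed (rule Deq[OF v])
    then show ?case
      by (intro Ck_on_Suc_BasisI[OF open_ball Ck_on_has_derivative[OF F1]])
  qed
  then have Fs: "smooth_on (ball 0 \<delta>) \<Phi>" by (rule smooth_onI)
  have z: "0 \<in> ball 0 \<delta>" using dpos by simp
  show ?thesis
  proof (rule that[OF dpos Fs])
    show "\<Phi> ` ball 0 \<delta> \<subseteq> ball 0 r" using FR R by force
    show "\<Phi> 0 = 0" using eq[OF z] by simp
    show "ddir c \<Phi> x = a c (\<Phi> x)" if "c \<in> E" "x \<in> ball 0 \<delta>" for c x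
      by (rule commuting_fields_integrate[OF E d3[unfolded N_def] M a2 Da R(2) comm F1 FR eq that(2,1)])
    show "ddir b \<Phi> 0 = b" if b: "b \<in> Basis - E" for b
    proof -
      have "(\<Sum>d\<in>E. (b \<bullet> d) *\<^sub>R ray_int E 0 (\<lambda>y. a d (\<Phi> y)) 0) = 0"
      proof (rule sum.neutral, rule ballI)
        fix d assume "d \<in> E"
        then have "b \<bullet> d = 0" using b E by (auto simp: inner_Basis)
        then show "(b \<bullet> d) *\<^sub>R ray_int E 0 (\<lambda>y. a d (\<Phi> y)) 0 = 0" by simp
      qed
      then show ?thesis using Deq[OF _ z, of b] b contr_Basis[of b E 0] by simp
    qed
  qed
qed

section \<open>Symmetry of second derivatives\<close>

text \<open>The left-hand side of the equation is symmetric in \<open>v\<close> and \<open>w\<close>; letting \<open>s\<close> tend to zero turns this into the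
  symmetry of the second derivative.\<close>

lemma mixed_difference_mvt:
  fixes f :: "'e::euclidean_space \<Rightarrow> real"
  assumes f: "Ck_on (Suc (Suc 0)) (ball x r) f" and s: "0 < s" "s * (norm v + norm w) < r"
  obtains \<xi> where "dist \<xi> x \<le> s * (norm v + norm w)"
    "f (x + s *\<^sub>R v + s *\<^sub>R w) - f (x + s *\<^sub>R v) - f (x + s *\<^sub>R w) + f x = s * s * ddir w (ddir v f) \<xi>"
proof -
  have f1: "Ck_on (Suc 0) (ball x r) f" by (rule Ck_on_Suc_imp[OF f])
  have df1: "Ck_on (Suc 0) (ball x r) (ddir v f)" using f by simp
  have le: "norm (p *\<^sub>R v + q *\<^sub>R w) \<le> s * (norm v + norm w)" if "0 \<le> p" "p \<le> s" "0 \<le> q" "q \<le> s" for p q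
  proof -
    have "norm (p *\<^sub>R v + q *\<^sub>R w) \<le> p * norm v + q * norm w"
      using norm_triangle_ineq[of "p *\<^sub>R v" "q *\<^sub>R w"] that by simp
    also have "\<dots> \<le> s * norm v + s * norm w" using that by (intro add_mono mult_right_mono) auto
    finally show ?thesis by (simp only: distrib_left)
  qed
  have inb: "x + (p *\<^sub>R v + q *\<^sub>R w) \<in> ball x r" if "0 \<le> p" "p \<le> s" "0 \<le> q" "q \<le> s" for p q
  proof -
    have "dist x (x + z) = norm z" for z by (simp add: dist_norm)
    then show ?thesis using le[OF that] s(2) by simp
  qed
  have D: "((\<lambda>t. g (y + t *\<^sub>R u)) has_real_derivative ddir u g (y + t *\<^sub>R u)) (at t)"
    if g: "Ck_on (Suc 0) (ball x r) g" and y: "y + t *\<^sub>R u \<in> ball x r" for g :: "'e \<Rightarrow> real" and y u t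
  proof -
    have l: "((\<lambda>t. y + t *\<^sub>R u) has_derivative (\<lambda>h. h *\<^sub>R u)) (at t)" by (auto intro!: derivative_eq_intros)
    have lin: "linear (frechet_derivative g (at (y + t *\<^sub>R u)))"
      by (rule has_derivative_linear[OF Ck_on_has_derivative[OF g y]])
    from diff_chain_at[OF l Ck_on_has_derivative[OF g y]]
    have "((\<lambda>t. g (y + t *\<^sub>R u)) has_derivative (\<lambda>h. ddir (h *\<^sub>R u) g (y + t *\<^sub>R u))) (at t)"
      by (simp only: o_def)
    then show ?thesis
      unfolding has_field_derivative_def linear_scale[OF lin] by (simp only: real_scaleR_def mult.commute[of _ "ddir u g (y + t *\<^sub>R u)"])
  qed
  let ?g = "\<lambda>t. f (x + s *\<^sub>R w + t *\<^sub>R v) - f (x + t *\<^sub>R v)"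
  have "\<exists>\<sigma>. 0 < \<sigma> \<and> \<sigma> < s \<and> ?g s - ?g 0 = (s - 0) * (ddir v f (x + s *\<^sub>R w + \<sigma> *\<^sub>R v) - ddir v f (x + \<sigma> *\<^sub>R v))"
  proof (rule MVT2[OF s(1)])
    fix t assume t: "0 \<le> t" "t \<le> s"
    show "(?g has_real_derivative ddir v f (x + s *\<^sub>R w + t *\<^sub>R v) - ddir v f (x + t *\<^sub>R v)) (at t)"
    proof (intro DERIV_diff D[OF f1])
      show "x + s *\<^sub>R w + t *\<^sub>R v \<in> ball x r" using inb[OF t, of s] s(1) by (simp add: add_ac)
      show "x + t *\<^sub>R v \<in> ball x r" using inb[OF t, of 0] s(1) by simp
    qed
  qed
  then obtain \<sigma> where sg: "0 < \<sigma>" "\<sigma> < s"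
    "?g s - ?g 0 = s * (ddir v f (x + s *\<^sub>R w + \<sigma> *\<^sub>R v) - ddir v f (x + \<sigma> *\<^sub>R v))" by auto
  let ?h = "\<lambda>t. ddir v f (x + \<sigma> *\<^sub>R v + t *\<^sub>R w)"
  have "\<exists>\<tau>. 0 < \<tau> \<and> \<tau> < s \<and> ?h s - ?h 0 = (s - 0) * ddir w (ddir v f) (x + \<sigma> *\<^sub>R v + \<tau> *\<^sub>R w)"
  proof (rule MVT2[OF s(1)])
    fix t assume t: "0 \<le> t" "t \<le> s"
    show "(?h has_real_derivative ddir w (ddir v f) (x + \<sigma> *\<^sub>R v + t *\<^sub>R w)) (at t)"
    proof (rule D[OF df1])
      show "x + \<sigma> *\<^sub>R v + t *\<^sub>R w \<in> ball x r" using inb[of \<sigma> t] sg t by (simp add: add_ac)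
    qed
  qed
  then obtain \<tau> where tau: "0 < \<tau>" "\<tau> < s" "?h s - ?h 0 = s * ddir w (ddir v f) (x + \<sigma> *\<^sub>R v + \<tau> *\<^sub>R w)" by auto
  have "?g s - ?g 0 = s * (s * ddir w (ddir v f) (x + \<sigma> *\<^sub>R v + \<tau> *\<^sub>R w))"
    using sg(3) tau(3) by (simp add: add_ac)
  moreover have "dist (x + \<sigma> *\<^sub>R v + \<tau> *\<^sub>R w) x \<le> s * (norm v + norm w)"
    using le[of \<sigma> \<tau>] sg tau by (simp add: dist_norm add.assoc)
  ultimately show thesis
    by (intro that[of "x + \<sigma> *\<^sub>R v + \<tau> *\<^sub>R w"]) (simp_all add: algebra_simps)
qed

lemma ddir_commute_real:
  fixes f :: "'e::euclidean_space \<Rightarrow> real"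
  assumes S: "open S" "x \<in> S" and f: "Ck_on (Suc (Suc 0)) S f"
  shows "ddir v (ddir w f) x = ddir w (ddir v f) x"
proof -
  obtain r where r: "0 < r" "ball x r \<subseteq> S" using S open_contains_ball by blast
  have fr: "Ck_on (Suc (Suc 0)) (ball x r) f" by (rule Ck_on_subset[OF f r(2)])
  have xr: "x \<in> ball x r" using r by simp
  have lim: "(\<xi> \<longlonglongrightarrow> x) \<Longrightarrow> (\<lambda>n. ddir p (ddir q f) (\<xi> n)) \<longlonglongrightarrow> ddir p (ddir q f) x" for \<xi> p q
  proof -
    have "continuous_on (ball x r) (ddir p (ddir q f))" using fr by simp
    then have "isCont (ddir p (ddir q f)) x" using xr continuous_on_eq_continuous_at[OF open_ball] by blast
    then show "(\<xi> \<longlonglongrightarrow> x) \<Longrightarrow> (\<lambda>n. ddir p (ddir q f) (\<xi> n)) \<longlonglongrightarrow> ddir p (ddir q f) x"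
      by (rule isCont_tendsto_compose)
  qed
  let ?C = "norm v + norm w + 1"
  have C: "0 < ?C" by (simp add: add_nonneg_pos)
  define s where "s n = r / (?C * real (Suc n))" for n
  have spos: "0 < s n" for n unfolding s_def using r C by simp
  have sC: "s n * (norm v + norm w) < r" for n
  proof -
    have "s n * (norm v + norm w) < s n * ?C" using spos by simp
    also have "s n * ?C = r / real (Suc n)" unfolding s_def using C by simp
    also have "\<dots> \<le> r / 1" using r by (intro divide_left_mono) auto
    finally show ?thesis by simp
  qed
  have s0: "(\<lambda>n. s n * (norm v + norm w)) \<longlonglongrightarrow> 0"
  proof -
    have "s n * (norm v + norm w) = (r / ?C * (norm v + norm w)) * inverse (real (Suc n))" for n
      unfolding s_def by (simp add: divide_inverse)
    then show ?thesis by (simp only: tendsto_mult_right_zero[OF LIMSEQ_inverse_real_of_nat])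
  qed
  have "\<exists>\<xi>. dist \<xi> x \<le> s n * (norm v + norm w) \<and>
    f (x + s n *\<^sub>R v + s n *\<^sub>R w) - f (x + s n *\<^sub>R v) - f (x + s n *\<^sub>R w) + f x = s n * s n * ddir w (ddir v f) \<xi>" for n
    using mixed_difference_mvt[OF fr spos sC] by blast
  then obtain \<xi> where xi: "\<And>n. dist (\<xi> n) x \<le> s n * (norm v + norm w)"
    "\<And>n. f (x + s n *\<^sub>R v + s n *\<^sub>R w) - f (x + s n *\<^sub>R v) - f (x + s n *\<^sub>R w) + f x = s n * s n * ddir w (ddir v f) (\<xi> n)"
    by metis
  have "\<exists>\<xi>. dist \<xi> x \<le> s n * (norm w + norm v) \<and>
    f (x + s n *\<^sub>R w + s n *\<^sub>R v) - f (x + s n *\<^sub>R w) - f (x + s n *\<^sub>R v) + f x = s n * s n * ddir v (ddir w f) \<xi>" for n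
    using mixed_difference_mvt[OF fr spos[of n], of w v] sC[of n] by (metis add.commute)
  then obtain \<zeta> where ze: "\<And>n. dist (\<zeta> n) x \<le> s n * (norm w + norm v)"
    "\<And>n. f (x + s n *\<^sub>R w + s n *\<^sub>R v) - f (x + s n *\<^sub>R w) - f (x + s n *\<^sub>R v) + f x = s n * s n * ddir v (ddir w f) (\<zeta> n)"
    by metis
  have eq: "ddir w (ddir v f) (\<xi> n) = ddir v (ddir w f) (\<zeta> n)" for n
  proof -
    have "s n * s n * ddir w (ddir v f) (\<xi> n) = s n * s n * ddir v (ddir w f) (\<zeta> n)"
      unfolding xi(2)[symmetric] ze(2)[symmetric] by (simp add: add_ac)
    moreover have "s n * s n \<noteq> 0" using spos[of n] by simp
    ultimately show ?thesis by simp
  qed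
  have l1: "\<xi> \<longlonglongrightarrow> x"
    using tendsto_0_le[OF s0, of "\<lambda>n. dist (\<xi> n) x" 1] xi(1) spos by (subst tendsto_dist_iff) (simp add: order_trans[OF _ abs_ge_self])
  have l2: "\<zeta> \<longlonglongrightarrow> x"
    using tendsto_0_le[OF s0, of "\<lambda>n. dist (\<zeta> n) x" 1] ze(1) spos by (subst tendsto_dist_iff) (simp add: order_trans[OF _ abs_ge_self] add.commute)
  have "(\<lambda>n. ddir v (ddir w f) (\<zeta> n)) \<longlonglongrightarrow> ddir w (ddir v f) x"
    using lim[OF l1, where p = w and q = v] unfolding eq .
  then show ?thesis using LIMSEQ_unique[OF lim[OF l2]] by blast
qed

lemma ddir_commute:
  fixes f :: "'e::euclidean_space \<Rightarrow> 'v::euclidean_space"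
  assumes S: "open S" "x \<in> S" and f: "Ck_on (Suc (Suc 0)) S f"
  shows "ddir v (ddir w f) x = ddir w (ddir v f) x"
proof (rule euclidean_eqI)
  fix b :: 'v assume "b \<in> Basis"
  have fb: "Ck_on (Suc (Suc 0)) S (\<lambda>x. f x \<bullet> b)" by (intro Ck_on_inner S f Ck_on_const)
  have d: "ddir p (\<lambda>x. g x \<bullet> b) y = ddir p g y \<bullet> b" if "Ck_on (Suc 0) S g" "y \<in> S" for g :: "'e \<Rightarrow> 'v" and p y
    by (rule ddir_eq[OF has_derivative_inner_left[OF Ck_on_has_derivative[OF that]]])
  have dd: "ddir p (ddir q (\<lambda>x. f x \<bullet> b)) x = ddir p (ddir q f) x \<bullet> b" for p q
  proof -
    have "ddir p (ddir q (\<lambda>x. f x \<bullet> b)) x = ddir p (\<lambda>x. ddir q f x \<bullet> b) x"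
      using frechet_derivative_cong_open[OF S, of "ddir q (\<lambda>x. f x \<bullet> b)" "\<lambda>x. ddir q f x \<bullet> b"]
        d[OF Ck_on_Suc_imp[OF f]] by simp
    also have "\<dots> = ddir p (ddir q f) x \<bullet> b" by (rule d[OF _ S(2)]) (use f in simp)
    finally show ?thesis .
  qed
  show "ddir v (ddir w f) x \<bullet> b = ddir w (ddir v f) x \<bullet> b"
    using ddir_commute_real[OF S fb, where v = v and w = w] unfolding dd .
qed

lemma second_derivative_symmetric:
  fixes f :: "'e::euclidean_space \<Rightarrow> 'w::euclidean_space"
  assumes W: "open W" "x \<in> W" and f: "smooth_on W f"
  shows "(\<Sum>i\<in>Basis. (v \<bullet> i) *\<^sub>R ddir w (ddir i f) x) = (\<Sum>i\<in>Basis. (w \<bullet> i) *\<^sub>R ddir v (ddir i f) x)"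
proof -
  have lin2: "ddir w (ddir u f) x = (\<Sum>i\<in>Basis. (w \<bullet> i) *\<^sub>R ddir i (ddir u f) x)" for u w
    by (rule linear_Basis_expansion[OF has_derivative_linear[OF smooth_on_has_derivative[OF smooth_on_ddir[OF f] W(2)]]])
  have "(\<Sum>i\<in>Basis. (v \<bullet> i) *\<^sub>R ddir w (ddir i f) x)
      = (\<Sum>i\<in>Basis. \<Sum>j\<in>Basis. (v \<bullet> i) *\<^sub>R (w \<bullet> j) *\<^sub>R ddir j (ddir i f) x)"
    by (intro sum.cong refl) (simp only: lin2[where w = w] scaleR_sum_right)
  also have "\<dots> = (\<Sum>j\<in>Basis. \<Sum>i\<in>Basis. (v \<bullet> i) *\<^sub>R (w \<bullet> j) *\<^sub>R ddir j (ddir i f) x)" by (rule sum.swap)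
  also have "\<dots> = (\<Sum>j\<in>Basis. \<Sum>i\<in>Basis. (w \<bullet> j) *\<^sub>R (v \<bullet> i) *\<^sub>R ddir i (ddir j f) x)"
  proof (intro sum.cong refl)
    fix i j :: 'e
    show "(v \<bullet> i) *\<^sub>R (w \<bullet> j) *\<^sub>R ddir j (ddir i f) x = (w \<bullet> j) *\<^sub>R (v \<bullet> i) *\<^sub>R ddir i (ddir j f) x"
      unfolding ddir_commute[OF W smooth_onD[OF f], where v = j and w = i] by (rule scaleR_left_commute)
  qed
  also have "\<dots> = (\<Sum>j\<in>Basis. (w \<bullet> j) *\<^sub>R ddir v (ddir j f) x)"
    by (intro sum.cong refl) (simp only: lin2[where w = v] scaleR_sum_right)
  finally show ?thesis .
qed

section \<open>Smooth inverse functions\<close>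

lemma linear_coordinate_sum: "linear (\<lambda>u. \<Sum>i\<in>Basis. (u \<bullet> i) *\<^sub>R c i)"
  by (intro linearI) (simp_all add: inner_add_left scaleR_add_left sum.distrib scaleR_sum_right)

text \<open>The derivative of \<open>M\<^sup>-\<^sup>1\<close> is \<open>- M\<^sup>-\<^sup>1 (DM) M\<^sup>-\<^sup>1\<close>, which is as smooth as \<open>M\<^sup>-\<^sup>1\<close> itself; so its class can be raised
  step by step.\<close>

lemma linear_family_inverse:
  fixes M :: "'e::euclidean_space \<Rightarrow> 'w::euclidean_space \<Rightarrow> 'w"
  assumes S: "open S" and lin: "\<And>x. x \<in> S \<Longrightarrow> linear (M x)"
    and smooth: "\<And>v. smooth_on S (\<lambda>x. M x v)" and inj: "\<And>x. x \<in> S \<Longrightarrow> inj (M x)"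
  shows "smooth_on S (\<lambda>x. inv (M x) w)"
proof -
  have bij: "bij (M x)" if "x \<in> S" for x
    using linear_injective_imp_surjective[OF lin[OF that] inj[OF that]] inj[OF that] by (simp add: bij_def)
  have MN: "M x (inv (M x) w) = w" if "x \<in> S" for x w
    by (rule surj_f_inv_f[OF bij_is_surj[OF bij[OF that]]])
  have NM: "inv (M x) (M x w) = w" if "x \<in> S" for x w
    by (rule inv_f_f[OF inj[OF that]])
  have linN: "linear (inv (M x))" if x: "x \<in> S" for x
  proof -
    obtain g where g: "linear g" "g \<circ> M x = id" using linear_injective_left_inverse[OF lin[OF x] inj[OF x]] by blast
    have "g w = inv (M x) w" for w
      using fun_cong[OF g(2), of "inv (M x) w"] by (simp add: MN[OF x])
    then have "inv (M x) = g" by (intro ext) (rule sym)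
    then show ?thesis using g(1) by (simp only:)
  qed
  \<comment> \<open>A bound of the operator norm of \<open>M y - M x\<close>.\<close>
  define e where "e x y = (\<Sum>i\<in>Basis. norm (M y i - M x i))" for x y
  have e: "norm (M y u - M x u) \<le> e x y * norm u" if "x \<in> S" "y \<in> S" for x y u
    unfolding e_def linear_Basis_expansion[OF lin[OF that(1)], of u] linear_Basis_expansion[OF lin[OF that(2)], of u]
      sum_subtractf[symmetric] scaleR_diff_right[symmetric]
    by (rule norm_Basis_combination_le)
  have e0: "(e x \<longlongrightarrow> 0) (at x)" if x: "x \<in> S" for x
  proof -
    have "((\<lambda>y. \<Sum>i\<in>Basis. norm (M y i - M x i)) \<longlongrightarrow> (\<Sum>i\<in>(Basis::'w set). norm (M x i - M x i))) (at x)"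
    proof (intro tendsto_sum tendsto_norm tendsto_diff tendsto_const)
      fix i :: 'w
      have "continuous_on S (\<lambda>x. M x i)" by (rule Ck_on_continuous[OF smooth_onD[OF smooth]])
      then show "((\<lambda>y. M y i) \<longlongrightarrow> M x i) (at x)"
        using x continuous_on_eq_continuous_at[OF S] unfolding isCont_def by blast
    qed
    then show ?thesis by (simp add: e_def[abs_def])
  qed
  \<comment> \<open>The inverses are locally bounded, since \<open>M x\<close> is bounded below and this persists nearby.\<close>
  have nearN: "\<exists>C>0. \<forall>\<^sub>F y in at x. \<forall>u. norm (inv (M y) u) \<le> C * norm u" if x: "x \<in> S" for x
  proof -
    obtain B where B: "0 < B" "\<And>u. B * norm u \<le> norm (M x u)"
      using linear_inj_bounded_below_pos[OF lin[OF x] inj[OF x]] by blast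
    have "\<forall>\<^sub>F y in at x. e x y < B / 2" by (rule order_tendstoD(2)[OF e0[OF x]]) (use B in simp)
    moreover have "\<forall>\<^sub>F y in at x. y \<in> S" using S x by (rule eventually_at_in_open')
    ultimately have "\<forall>\<^sub>F y in at x. \<forall>u. norm (inv (M y) u) \<le> (2 / B) * norm u"
    proof eventually_elim
      case (elim y)
      show ?case
      proof
        fix u
        let ?p = "inv (M y) u"
        have "B * norm ?p \<le> norm (M x ?p)" by (rule B(2))
        also have "\<dots> \<le> norm (M y ?p) + norm (M y ?p - M x ?p)"
          using norm_triangle_ineq4[of "M y ?p" "M y ?p - M x ?p"] by simp
        also have "\<dots> \<le> norm u + B / 2 * norm ?p"
          using e[OF x elim(2), of ?p] mult_right_mono[OF less_imp_le[OF elim(1)] norm_ge_zero[of ?p]] MN[OF elim(2), of u] by simp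
        finally show "norm ?p \<le> (2 / B) * norm u" using B(1) by (simp add: field_simps)
      qed
    qed
    then show ?thesis using B(1) by (intro exI[of _ "2 / B"]) simp
  qed
  have contN: "((\<lambda>y. inv (M y) u) \<longlongrightarrow> inv (M x) u) (at x)" if x: "x \<in> S" for x u
  proof -
    obtain C where C: "0 < C" "\<forall>\<^sub>F y in at x. \<forall>u. norm (inv (M y) u) \<le> C * norm u" using nearN[OF x] by blast
    have "\<forall>\<^sub>F y in at x. y \<in> S" using S x by (rule eventually_at_in_open')
    with C(2) have ev: "\<forall>\<^sub>F y in at x. norm (inv (M y) u - inv (M x) u) \<le> e x y * (C * norm (inv (M x) u))"
    proof eventually_elim
      case (elim y)
      have "inv (M y) u - inv (M x) u = inv (M y) (u - M y (inv (M x) u))"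
        by (simp only: linear_diff[OF linN[OF elim(2)]] NM[OF elim(2)])
      also have "norm \<dots> \<le> C * norm (u - M y (inv (M x) u))" using elim(1) by blast
      also have "\<dots> \<le> C * (e x y * norm (inv (M x) u))"
        using e[OF x elim(2), of "inv (M x) u"] C(1) MN[OF x, of u]
        by (intro mult_left_mono) (simp_all add: norm_minus_commute)
      finally show ?case by (simp only: mult.left_commute)
    qed
    have "((\<lambda>y. e x y * (C * norm (inv (M x) u))) \<longlongrightarrow> 0) (at x)" by (rule tendsto_mult_left_zero[OF e0[OF x]])
    from Lim_null_comparison[OF ev this] show ?thesis by (rule LIM_zero_cancel)
  qed
  have derN: "((\<lambda>y. inv (M y) w) has_derivative (\<lambda>v. - inv (M x) (ddir v (\<lambda>y. M y (inv (M x) w)) x))) (at x)" if x: "x \<in> S" for x w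
  proof -
    let ?p = "inv (M x) w"
    let ?D = "\<lambda>v. ddir v (\<lambda>y. M y ?p) x"
    have D: "((\<lambda>y. M y ?p) has_derivative ?D) (at x)" by (rule smooth_on_has_derivative[OF smooth x])
    obtain C where C: "0 < C" "\<forall>\<^sub>F y in at x. \<forall>u. norm (inv (M y) u) \<le> C * norm u" using nearN[OF x] by blast
    have evS: "\<forall>\<^sub>F y in at x. y \<in> S" using S x by (rule eventually_at_in_open')
    have bl: "bounded_linear (\<lambda>v. - inv (M x) (?D v))"
      by (rule bounded_linear_minus[OF bounded_linear_compose[OF
            linear_conv_bounded_linear[THEN iffD1, OF linN[OF x]] has_derivative_bounded_linear[OF D]]])
    have lim1: "((\<lambda>y. norm (M y ?p - M x ?p - ?D (y - x)) / norm (y - x)) \<longlongrightarrow> 0) (at x)"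
      using D unfolding has_derivative_iff_norm by blast
    \<comment> \<open>\<open>M\<^sub>y\<^sup>-\<^sup>1 \<circ> D - M\<^sub>x\<^sup>-\<^sup>1 \<circ> D\<close> tends to zero uniformly on bounded sets because it does on a basis.\<close>
    let ?q = "\<lambda>y. \<Sum>i\<in>Basis. norm (inv (M y) (?D i) - inv (M x) (?D i))"
    have q0: "(?q \<longlongrightarrow> 0) (at x)"
    proof -
      have "(?q \<longlongrightarrow> (\<Sum>i\<in>(Basis::'e set). norm (inv (M x) (?D i) - inv (M x) (?D i)))) (at x)"
        by (intro tendsto_sum tendsto_norm tendsto_diff tendsto_const contN x)
      then show ?thesis by simp
    qed
    have linD: "linear ?D" by (rule has_derivative_linear[OF D])
    have "\<forall>\<^sub>F y in at x. norm (norm (inv (M y) w - ?p - - inv (M x) (?D (y - x))) / norm (y - x))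
        \<le> C * (norm (M y ?p - M x ?p - ?D (y - x)) / norm (y - x)) + ?q y"
      using C(2) evS
    proof eventually_elim
      case (elim y)
      let ?h = "y - x"
      have 1: "inv (M y) w - ?p = - inv (M y) (M y ?p - M x ?p)"
        by (simp add: linear_diff[OF linN[OF elim(2)]] NM[OF elim(2)] MN[OF x])
      have "inv (M y) w - ?p - - inv (M x) (?D ?h)
        = - inv (M y) (M y ?p - M x ?p - ?D ?h) - (inv (M y) (?D ?h) - inv (M x) (?D ?h))"
        unfolding 1 linear_diff[OF linN[OF elim(2)], of "M y ?p - M x ?p"] by simp
      then have "norm (inv (M y) w - ?p - - inv (M x) (?D ?h))
        \<le> norm (inv (M y) (M y ?p - M x ?p - ?D ?h)) + norm (inv (M y) (?D ?h) - inv (M x) (?D ?h))"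
        using norm_triangle_ineq4[of "- inv (M y) (M y ?p - M x ?p - ?D ?h)"] by (simp only: norm_minus_cancel)
      also have "\<dots> \<le> C * norm (M y ?p - M x ?p - ?D ?h) + ?q y * norm ?h"
      proof (rule add_mono)
        show "norm (inv (M y) (M y ?p - M x ?p - ?D ?h)) \<le> C * norm (M y ?p - M x ?p - ?D ?h)" using elim(1) by blast
        have rp: "inv (M z) (?D ?h) = (\<Sum>i\<in>Basis. (?h \<bullet> i) *\<^sub>R inv (M z) (?D i))" if "z \<in> S" for z
          using linear_Basis_expansion[OF linear_compose[OF linD linN[OF that]], of ?h] by (simp only: o_def)
        show "norm (inv (M y) (?D ?h) - inv (M x) (?D ?h)) \<le> ?q y * norm ?h"
          unfolding rp[OF elim(2)] rp[OF x] sum_subtractf[symmetric] scaleR_diff_right[symmetric]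
          by (rule norm_Basis_combination_le)
      qed
      finally have b: "norm (inv (M y) w - ?p - - inv (M x) (?D ?h)) \<le> C * norm (M y ?p - M x ?p - ?D ?h) + ?q y * norm ?h" .
      have qn: "0 \<le> ?q y" by (rule sum_nonneg) simp
      show ?case
      proof (cases "?h = 0")
        case True
        then show ?thesis using qn by simp
      next
        case False
        then have h: "0 < norm ?h" by simp
        have "norm (inv (M y) w - ?p - - inv (M x) (?D ?h)) / norm ?h \<le> (C * norm (M y ?p - M x ?p - ?D ?h) + ?q y * norm ?h) / norm ?h"
          by (rule divide_right_mono[OF b norm_ge_zero])
        also have "\<dots> = C * (norm (M y ?p - M x ?p - ?D ?h) / norm ?h) + ?q y"
          using h by (simp only: add_divide_distrib nonzero_mult_div_cancel_right[OF less_imp_neq[OF h, symmetric]] times_divide_eq_right)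
        finally show ?thesis by simp
      qed
    qed
    moreover have "((\<lambda>y. C * (norm (M y ?p - M x ?p - ?D (y - x)) / norm (y - x)) + ?q y) \<longlongrightarrow> 0) (at x)"
      using tendsto_add[OF tendsto_mult_right_zero[OF lim1, of C] q0] by simp
    ultimately have "((\<lambda>y. norm (inv (M y) w - ?p - - inv (M x) (?D (y - x))) / norm (y - x)) \<longlongrightarrow> 0) (at x)"
      by (rule Lim_null_comparison)
    then show ?thesis unfolding has_derivative_iff_norm using bl by blast
  qed
  have "Ck_on k S (\<lambda>x. inv (M x) w)" for k w
  proof (induction k arbitrary: w)
    case 0
    have "isCont (\<lambda>x. inv (M x) w) x" if "x \<in> S" for x using contN[OF that, of w] unfolding isCont_def .
    then show ?case by (simp add: continuous_at_imp_continuous_on)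
  next
    case (Suc k)
    show ?case
    proof (rule Ck_on_SucI[OF S derN])
      fix v
      have dM: "ddir v (\<lambda>y. M y u) x = (\<Sum>i\<in>Basis. (u \<bullet> i) *\<^sub>R ddir v (\<lambda>y. M y i) x)" if x: "x \<in> S" for x u
        using ddir_linear_family[OF S lin smooth_onD[OF smooth], where f = "\<lambda>_. u" and x = x and v = v] x linear_0[OF lin[OF x]] by simp
      have lD: "linear (\<lambda>u. ddir v (\<lambda>y. M y u) x)" if "x \<in> S" for x
        unfolding ext[OF dM[OF that]] by (rule linear_coordinate_sum)
      have "Ck_on k S (\<lambda>x. ddir v (\<lambda>y. M y (inv (M x) w)) x)"
        by (rule Ck_on_linear_family[OF S lD smooth_onD[OF smooth_on_ddir[OF smooth]] Suc.IH])
      from Ck_on_linear_family[OF S linN Suc.IH this]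
      have "Ck_on k S (\<lambda>x. inv (M x) (ddir v (\<lambda>y. M y (inv (M x) w)) x))" .
      then show "Ck_on k S (\<lambda>x. - inv (M x) (ddir v (\<lambda>y. M y (inv (M x) w)) x))" by (rule Ck_on_minus[OF S])
    qed
  qed
  then show ?thesis by (rule smooth_onI)
qed

text \<open>A lower bound \<open>B |u| \<le> |M x0 u|\<close> survives perturbations of norm less than \<open>B\<close>.\<close>

lemma injective_near:
  fixes M :: "'e::euclidean_space \<Rightarrow> 'w::euclidean_space \<Rightarrow> 'w"
  assumes S: "open S" "x0 \<in> S" and lin: "\<And>x. x \<in> S \<Longrightarrow> linear (M x)"
    and cont: "\<And>v. continuous_on S (\<lambda>x. M x v)" and inj: "inj (M x0)"
  obtains T where "open T" "x0 \<in> T" "T \<subseteq> S" "\<And>x. x \<in> T \<Longrightarrow> inj (M x)"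
proof -
  obtain B where B: "0 < B" "\<And>u. B * norm u \<le> norm (M x0 u)"
    using linear_inj_bounded_below_pos[OF lin[OF S(2)] inj] by blast
  define e where "e x = (\<Sum>i\<in>Basis. norm (M x i - M x0 i))" for x
  have ce: "continuous_on S e" unfolding e_def[abs_def] by (intro continuous_intros cont)
  define T where "T = S \<inter> e -` {..<B}"
  show thesis
  proof
    show "open T" unfolding T_def by (rule continuous_open_preimage[OF ce S(1) open_lessThan])
    show "x0 \<in> T" "T \<subseteq> S" using S B by (simp_all add: T_def e_def)
    fix x assume "x \<in> T"
    then have x: "x \<in> S" "e x < B" by (auto simp: T_def)
    have "u = 0" if u: "M x u = 0" for u
    proof (rule ccontr)
      assume "u \<noteq> 0"
      have "norm (M x u - M x0 u) \<le> e x * norm u"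
        unfolding linear_Basis_expansion[OF lin[OF x(1)], of u] linear_Basis_expansion[OF lin[OF S(2)], of u] e_def
          sum_subtractf[symmetric] scaleR_diff_right[symmetric]
        by (rule norm_Basis_combination_le)
      also have "\<dots> < B * norm u" using x(2) \<open>u \<noteq> 0\<close> by simp
      also have "\<dots> \<le> norm (M x0 u)" by (rule B(2))
      finally show False using u by simp
    qed
    then show "inj (M x)" using linear_injective_0[OF lin[OF x(1)]] by blast
  qed
qed

text \<open>The derivative of the inverse \<open>g\<close> is \<open>(Df)\<^sup>-\<^sup>1 \<circ> g\<close>, hence of the class of \<open>g\<close>, which bootstraps.\<close>

lemma smooth_inverse_function:
  fixes f :: "'e::euclidean_space \<Rightarrow> 'e"
  assumes U: "open U" "x0 \<in> U" and f: "smooth_on U f" and inj: "inj (frechet_derivative f (at x0))"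
  obtains U' V g where "open U'" "U' \<subseteq> U" "x0 \<in> U'" "open V" "homeomorphism U' V f g" "smooth_on V g"
    "\<And>x. x \<in> U' \<Longrightarrow> inj (frechet_derivative f (at x))"
proof -
  have D: "(f has_derivative frechet_derivative f (at x)) (at x)" if "x \<in> U" for x
    by (rule smooth_on_has_derivative[OF f that])
  define f' where "f' x = Blinfun (frechet_derivative f (at x))" for x
  have f': "blinfun_apply (f' x) = frechet_derivative f (at x)" if "x \<in> U" for x
    unfolding f'_def by (rule bounded_linear_Blinfun_apply[OF has_derivative_bounded_linear[OF D[OF that]]])
  have cont: "continuous_on U f'"
  proof (rule continuous_on_blinfun_componentwise)
    fix i :: 'e assume "i \<in> Basis"
    have "continuous_on U (ddir i f)" by (rule Ck_on_continuous[OF smooth_onD[OF smooth_on_ddir[OF f]]])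
    then show "continuous_on U (\<lambda>x. blinfun_apply (f' x) i)"
      by (rule continuous_on_eq) (simp only: f')
  qed
  have lin0: "linear (frechet_derivative f (at x0))" by (rule has_derivative_linear[OF D[OF U(2)]])
  obtain h where h: "linear h" "h \<circ> frechet_derivative f (at x0) = id"
    using linear_injective_left_inverse[OF lin0 inj] by blast
  have hb: "bounded_linear h" using h(1) by (simp add: linear_conv_bounded_linear)
  have inv0: "Blinfun h o\<^sub>L f' x0 = id_blinfun"
    by (rule blinfun_eqI) (use fun_cong[OF h(2)] in \<open>simp add: bounded_linear_Blinfun_apply[OF hb] f'[OF U(2)]\<close>)
  have der: "(f has_derivative blinfun_apply (f' x)) (at x)" if "x \<in> U" for x
    using D[OF that] by (simp only: f'[OF that])
  obtain U' V g g' where g: "open U'" "U' \<subseteq> U" "x0 \<in> U'" "open V" "f x0 \<in> V" "homeomorphism U' V f g"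
    "\<And>y. y \<in> V \<Longrightarrow> (g has_derivative (g' y)) (at y)"
    "\<And>y. y \<in> V \<Longrightarrow> g' y = inv (blinfun_apply (f' (g y)))"
    "\<And>y. y \<in> V \<Longrightarrow> bij (blinfun_apply (f' (g y)))"
    using inverse_function_theorem[OF U(1) der cont U(2) inv0] by metis
  have gU': "g y \<in> U'" if "y \<in> V" for y using homeomorphism_image2[OF g(6)] that by blast
  have gU: "g y \<in> U" if "y \<in> V" for y using gU'[OF that] g(2) by blast
  have fU': "f x \<in> V" "g (f x) = x" if "x \<in> U'" for x
    using homeomorphism_image1[OF g(6)] homeomorphism_apply1[OF g(6) that] that by blast+
  have injU: "inj (frechet_derivative f (at x))" if "x \<in> U'" for x
  proof -
    have "x \<in> U" using that g(2) by blast
    then show ?thesis using bij_is_inj[OF g(9)[OF fU'(1)[OF that]]] unfolding fU'(2)[OF that] by (simp only: f')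
  qed
  have sub: "x \<in> U" if "x \<in> U'" for x using that g(2) by blast
  have invs: "smooth_on U' (\<lambda>x. inv (frechet_derivative f (at x)) v)" for v
  proof (rule linear_family_inverse[OF g(1) has_derivative_linear[OF D[OF sub]] _ injU])
    show "smooth_on U' (ddir v f)" for v by (rule smooth_on_subset[OF smooth_on_ddir[OF f] g(2)])
  qed
  have Dg: "(g has_derivative (\<lambda>v. inv (frechet_derivative f (at (g y))) v)) (at y)" if "y \<in> V" for y
    using g(7)[OF that] unfolding g(8)[OF that] f'[OF gU[OF that]] .
  have "Ck_on k V g" for k
  proof (induction k)
    case 0
    show ?case using homeomorphism_cont2[OF g(6)] by simp
  next
    case (Suc k)
    show ?case
    proof (rule Ck_on_SucI[OF g(4) Dg])
      show "Ck_on k V (\<lambda>y. inv (frechet_derivative f (at (g y))) v)" for v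
        by (rule Ck_on_compose[OF g(4) smooth_onD[OF invs] Suc.IH]) (use gU' in blast)
    qed
  qed
  then have "smooth_on V g" by (rule smooth_onI)
  with g(1-4,6) injU show thesis by (intro that)
qed

section \<open>Charts and tangent vectors\<close>

locale smooth_manifold =
  fixes A :: "('a::topological_space, 'e::euclidean_space) chart set"
  assumes atlas: "smooth_structure A"
begin

lemma chart: "c \<in> A \<Longrightarrow> is_chart c" using atlas by (simp add: smooth_structure_def)

lemma open_cdom: "c \<in> A \<Longrightarrow> open (cdom c)" using chart by (simp add: is_chart_def)

lemma chart_homeo: "c \<in> A \<Longrightarrow> homeomorphism (cdom c) (cimg c) (cmap c) (cinv c)"
  using chart by (simp add: is_chart_def)

lemma open_cimg: "c \<in> A \<Longrightarrow> open (cimg c)" using chart by (simp add: is_chart_def)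

lemma cinv_cmap: "c \<in> A \<Longrightarrow> p \<in> cdom c \<Longrightarrow> cinv c (cmap c p) = p"
  using homeomorphism_apply1[OF chart_homeo] .

lemma cmap_cinv: "c \<in> A \<Longrightarrow> x \<in> cimg c \<Longrightarrow> cmap c (cinv c x) = x"
  using homeomorphism_apply2[OF chart_homeo] .

lemma cinv_in: "c \<in> A \<Longrightarrow> x \<in> cimg c \<Longrightarrow> cinv c x \<in> cdom c"
  using homeomorphism_image2[OF chart_homeo] by blast

lemma cmap_image_eq:
  "c \<in> A \<Longrightarrow> cmap c ` (cdom c \<inter> S) = cimg c \<inter> cinv c -` S"
  using cinv_cmap by (auto simp: image_iff)

lemma open_cmap_image:
  assumes "c \<in> A" "open S"
  shows "open (cmap c ` (cdom c \<inter> S))"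
  unfolding cmap_image_eq[OF assms(1)]
  by (rule continuous_open_preimage[OF homeomorphism_cont2[OF chart_homeo[OF assms(1)]] open_cimg[OF assms(1)] assms(2)])

lemma chart_at: "chart_at A p \<in> A" "p \<in> cdom (chart_at A p)"
proof -
  have "\<exists>c. c \<in> A \<and> p \<in> cdom c" using atlas unfolding smooth_structure_def by blast
  then have "chart_at A p \<in> A \<and> p \<in> cdom (chart_at A p)" unfolding chart_at_def by (rule someI_ex)
  then show "chart_at A p \<in> A" "p \<in> cdom (chart_at A p)" by auto
qed

lemma transition_smooth:
  assumes "c \<in> A" "d \<in> A"
  shows "smooth_on (cmap c ` (cdom c \<inter> cdom d)) (cmap d \<circ> cinv c)"
  using atlas assms unfolding smooth_structure_def compatible_charts_def by blast

lemma transition_has_derivative: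
  assumes "c \<in> A" "d \<in> A" "p \<in> cdom c" "p \<in> cdom d"
  shows "((cmap d \<circ> cinv c) has_derivative frechet_derivative (cmap d \<circ> cinv c) (at (cmap c p))) (at (cmap c p))"
  by (rule smooth_on_has_derivative[OF transition_smooth[OF assms(1,2)]]) (use assms in blast)

text \<open>Tangent vectors, differentials and directional derivatives are all defined by a derivative in a
  reference chart; this chain rule moves each of them to an arbitrary chart.\<close>

lemma transition_chain:
  assumes c: "c \<in> A" "p \<in> cdom c" and d: "d \<in> A" "p \<in> cdom d"
    and f: "((f \<circ> cinv d) has_derivative D) (at (cmap d p))"
  shows "((f \<circ> cinv c) has_derivative (\<lambda>v. D (frechet_derivative (cmap d \<circ> cinv c) (at (cmap c p)) v))) (at (cmap c p))"
proof -
  have e: "(cmap d \<circ> cinv c) (cmap c p) = cmap d p" by (simp add: cinv_cmap[OF c])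
  have "((f \<circ> cinv d) \<circ> (cmap d \<circ> cinv c) has_derivative D \<circ> frechet_derivative (cmap d \<circ> cinv c) (at (cmap c p))) (at (cmap c p))"
    by (rule diff_chain_at[OF transition_has_derivative[OF c(1) d(1) c(2) d(2)]]) (simp only: e f)
  then have "((f \<circ> cinv d) \<circ> (cmap d \<circ> cinv c) has_derivative (\<lambda>v. D (frechet_derivative (cmap d \<circ> cinv c) (at (cmap c p)) v))) (at (cmap c p))"
    by (simp only: o_def)
  then show ?thesis
  proof (rule has_derivative_transform_within_open[OF _ open_cmap_image[OF c(1) open_cdom[OF d(1)]]])
    show "cmap c p \<in> cmap c ` (cdom c \<inter> cdom d)" using c d by blast
    fix x assume "x \<in> cmap c ` (cdom c \<inter> cdom d)"
    then show "((f \<circ> cinv d) \<circ> (cmap d \<circ> cinv c)) x = (f \<circ> cinv c) x"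
      by (auto simp: cinv_cmap[OF c(1)] cinv_cmap[OF d(1)])
  qed
qed

lemma dchart_linear: "c \<in> A \<Longrightarrow> p \<in> cdom c \<Longrightarrow> linear (dchart A c p)"
  unfolding dchart_def by (rule has_derivative_linear[OF transition_has_derivative[OF chart_at(1) _ chart_at(2)]])

lemma coord_vec_linear: "c \<in> A \<Longrightarrow> p \<in> cdom c \<Longrightarrow> linear (\<lambda>u. coord_vec A c u p)"
  unfolding coord_vec_def by (rule has_derivative_linear[OF transition_has_derivative[OF _ chart_at(1) _ chart_at(2)]])

lemma transition_inverse:
  assumes c: "c \<in> A" "p \<in> cdom c" and d: "d \<in> A" "p \<in> cdom d"
  shows "frechet_derivative (cmap d \<circ> cinv c) (at (cmap c p)) (frechet_derivative (cmap c \<circ> cinv d) (at (cmap d p)) v) = v"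
proof -
  have "((cmap d \<circ> cinv d) has_derivative (\<lambda>v. v)) (at (cmap d p))"
    by (rule has_derivative_transform_within_open[OF has_derivative_ident open_cimg[OF d(1)]])
      (use d in \<open>auto simp: cinv_cmap\<close>)
  from has_derivative_unique[OF this transition_chain[OF d c transition_has_derivative[OF c(1) d(1) c(2) d(2)]]]
  show ?thesis by metis
qed

lemma dchart_coord_vec: "c \<in> A \<Longrightarrow> p \<in> cdom c \<Longrightarrow> dchart A c p (coord_vec A c u p) = u"
  unfolding dchart_def coord_vec_def by (rule transition_inverse[OF chart_at])

lemma coord_vec_dchart: "c \<in> A \<Longrightarrow> p \<in> cdom c \<Longrightarrow> coord_vec A c (dchart A c p v) p = v"
  unfolding dchart_def coord_vec_def by (rule transition_inverse[OF _ _ chart_at])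

lemma dchart_eq_iff: "c \<in> A \<Longrightarrow> p \<in> cdom c \<Longrightarrow> dchart A c p v = dchart A c p w \<longleftrightarrow> v = w"
  by (metis coord_vec_dchart)

lemma dchart_change:
  assumes c: "c \<in> A" "p \<in> cdom c" and d: "d \<in> A" "p \<in> cdom d"
  shows "dchart A d p v = frechet_derivative (cmap d \<circ> cinv c) (at (cmap c p)) (dchart A c p v)"
  unfolding dchart_def
  using has_derivative_unique[OF transition_has_derivative[OF chart_at(1) d(1) chart_at(2) d(2)]
      transition_chain[OF chart_at c transition_has_derivative[OF c(1) d(1) c(2) d(2)]]] by metis

lemma vf_coords_change:
  assumes c: "c \<in> A" and d: "d \<in> A" and x: "x \<in> cmap c ` (cdom c \<inter> cdom d)"
  shows "vf_coords A c X x = frechet_derivative (cmap c \<circ> cinv d) (at ((cmap d \<circ> cinv c) x)) (vf_coords A d X ((cmap d \<circ> cinv c) x))"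
proof -
  obtain p where p: "p \<in> cdom c" "p \<in> cdom d" "x = cmap c p" using x by blast
  have "cinv c x = p" "(cmap d \<circ> cinv c) x = cmap d p" "cinv d (cmap d p) = p"
    using p by (simp_all add: cinv_cmap c d)
  then show ?thesis unfolding vf_coords_def by (simp only:) (rule dchart_change[OF d p(2) c p(1)])
qed

text \<open>The coordinates of \<open>X\<close> in another chart are obtained by applying the derivative of the coordinate
  change, which is smooth, so one chart around each point decides.\<close>

lemma vector_fields_onI:
  assumes "\<And>p. p \<in> U \<Longrightarrow> \<exists>c T. c \<in> A \<and> p \<in> cdom c \<and> open T \<and> p \<in> T \<and> smooth_on (cmap c ` (cdom c \<inter> T)) (vf_coords A c X)"
  shows "X \<in> vector_fields_on A U"
  unfolding vector_fields_on_def
proof (intro CollectI ballI smooth_on_local)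
  fix d x assume d: "d \<in> A" and "x \<in> cmap d ` (cdom d \<inter> U)"
  then obtain p where p: "p \<in> cdom d" "p \<in> U" "x = cmap d p" by blast
  obtain c T where c: "c \<in> A" "p \<in> cdom c" "open T" "p \<in> T" "smooth_on (cmap c ` (cdom c \<inter> T)) (vf_coords A c X)"
    using assms[OF p(2)] by blast
  define W where "W = cmap d ` (cdom d \<inter> (cdom c \<inter> T))"
  have W: "open W" unfolding W_def by (rule open_cmap_image[OF d open_Int[OF open_cdom[OF c(1)] c(3)]])
  have xW: "x \<in> W" unfolding W_def using p c by blast
  have Wc: "W \<subseteq> cmap d ` (cdom d \<inter> cdom c)" unfolding W_def by blast
  have tW: "(cmap c \<circ> cinv d) ` W \<subseteq> cmap c ` (cdom c \<inter> T)" "(cmap c \<circ> cinv d) ` W \<subseteq> cmap c ` (cdom c \<inter> cdom d)"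
    unfolding W_def by (auto simp: cinv_cmap[OF d])
  have ts: "smooth_on W (cmap c \<circ> cinv d)" by (rule smooth_on_subset[OF transition_smooth[OF d c(1)] Wc])
  have Tcd: "open (cmap c ` (cdom c \<inter> cdom d))" by (rule open_cmap_image[OF c(1) open_cdom[OF d]])
  have "smooth_on W (\<lambda>y. frechet_derivative (cmap d \<circ> cinv c) (at ((cmap c \<circ> cinv d) y)) (vf_coords A c X ((cmap c \<circ> cinv d) y)))"
  proof (rule smooth_on_linear_family[where L = "\<lambda>y v. frechet_derivative (cmap d \<circ> cinv c) (at ((cmap c \<circ> cinv d) y)) v", OF W])
    show "linear (\<lambda>v. frechet_derivative (cmap d \<circ> cinv c) (at ((cmap c \<circ> cinv d) y)) v)" if "y \<in> W" for y
      by (rule has_derivative_linear[OF smooth_on_has_derivative[OF transition_smooth[OF c(1) d]]]) (use tW that in blast)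
    show "smooth_on W (\<lambda>y. frechet_derivative (cmap d \<circ> cinv c) (at ((cmap c \<circ> cinv d) y)) b)" for b
      by (rule smooth_on_compose[OF W smooth_on_ddir[OF transition_smooth[OF c(1) d]] ts tW(2)])
    show "smooth_on W (\<lambda>y. vf_coords A c X ((cmap c \<circ> cinv d) y))"
      by (rule smooth_on_compose[OF W c(5) ts tW(1)])
  qed
  then have "smooth_on W (vf_coords A d X)"
  proof (rule smooth_on_cong[OF W, rotated])
    fix y assume "y \<in> W"
    then have "y \<in> cmap d ` (cdom d \<inter> cdom c)" using Wc by blast
    from vf_coords_change[OF d c(1) this, of X]
    show "frechet_derivative (cmap d \<circ> cinv c) (at ((cmap c \<circ> cinv d) y)) (vf_coords A c X ((cmap c \<circ> cinv d) y))
        = vf_coords A d X y" by (rule sym)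
  qed
  then show "\<exists>T. open T \<and> x \<in> T \<and> smooth_on T (vf_coords A d X)" using W xW by blast
qed

lemma vector_fields_on_smooth:
  "X \<in> vector_fields_on A U \<Longrightarrow> c \<in> A \<Longrightarrow> smooth_on (cmap c ` (cdom c \<inter> U)) (vf_coords A c X)"
  by (simp add: vector_fields_on_def)

lemma vector_fields_smooth: "X \<in> vector_fields A \<Longrightarrow> c \<in> A \<Longrightarrow> smooth_on (cimg c) (vf_coords A c X)"
  using vector_fields_on_smooth[of X UNIV] by simp

lemma vf_coords_at: "c \<in> A \<Longrightarrow> p \<in> cdom c \<Longrightarrow> vf_coords A c X (cmap c p) = dchart A c p (X p)"
  by (simp add: vf_coords_def cinv_cmap)

text \<open>The coordinate formula for the bracket holds in every chart.  Both sides are computed from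
  \<open>X\<^sub>c = D\<tau> X\<^sub>d\<close> with the coordinate change \<open>\<tau>\<close>; the terms containing \<open>D\<^sup>2\<tau>\<close> cancel because second
  derivatives commute.\<close>

lemma dchart_lie_bracket:
  assumes c: "c \<in> A" "p \<in> cdom c" and U: "open U" "p \<in> U"
    and X: "X \<in> vector_fields_on A U" and Y: "Y \<in> vector_fields_on A U"
  shows "dchart A c p (lie_bracket A X Y p) =
    frechet_derivative (vf_coords A c Y) (at (cmap c p)) (vf_coords A c X (cmap c p)) -
    frechet_derivative (vf_coords A c X) (at (cmap c p)) (vf_coords A c Y (cmap c p))"
proof -
  define d where "d = chart_at A p"
  have d: "d \<in> A" "p \<in> cdom d" unfolding d_def by (rule chart_at)+
  define x where "x = cmap d p"
  define t where "t = cmap c \<circ> cinv d"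
  define W where "W = cmap d ` (cdom d \<inter> (cdom c \<inter> U))"
  have W: "open W" unfolding W_def by (rule open_cmap_image[OF d(1) open_Int[OF open_cdom[OF c(1)] U(1)]])
  have xW: "x \<in> W" unfolding W_def x_def using c d U by blast
  have tx: "t x = cmap c p" by (simp add: t_def x_def cinv_cmap[OF d])
  have ts: "smooth_on W t"
    unfolding t_def by (rule smooth_on_subset[OF transition_smooth[OF d(1) c(1)]]) (auto simp: W_def)
  have Vd: "smooth_on W (vf_coords A d Z)" if "Z \<in> vector_fields_on A U" for Z
    by (rule smooth_on_subset[OF vector_fields_on_smooth[OF that d(1)]]) (auto simp: W_def)
  have Vc: "(vf_coords A c Z has_derivative frechet_derivative (vf_coords A c Z) (at (cmap c p))) (at (cmap c p))"
    if "Z \<in> vector_fields_on A U" for Z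
    by (rule smooth_on_has_derivative[OF vector_fields_on_smooth[OF that c(1)]]) (use c U in blast)
  have rel: "vf_coords A c Z (t y) = ddir (vf_coords A d Z y) t y" if y: "y \<in> W" for Z y
  proof -
    obtain q where q: "q \<in> cdom d" "q \<in> cdom c" "y = cmap d q" using y unfolding W_def by blast
    have ty: "t y = cmap c q" using q by (simp add: t_def cinv_cmap[OF d(1)])
    show ?thesis
      unfolding ty unfolding q(3) vf_coords_at[OF c(1) q(2)] vf_coords_at[OF d(1) q(1)] t_def
      by (rule dchart_change[OF d(1) q(1) c(1) q(2)])
  qed
  have t1: "(t has_derivative frechet_derivative t (at x)) (at x)" by (rule smooth_on_has_derivative[OF ts xW])
  have lt: "linear (frechet_derivative t (at y))" if "y \<in> W" for y
    by (rule has_derivative_linear[OF smooth_on_has_derivative[OF ts that]])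
  have key: "ddir (ddir w t x) (vf_coords A c Z) (cmap c p)
      = (\<Sum>i\<in>Basis. (vf_coords A d Z x \<bullet> i) *\<^sub>R ddir w (ddir i t) x) + ddir (ddir w (vf_coords A d Z) x) t x"
    if Z: "Z \<in> vector_fields_on A U" for Z w
  proof -
    have "(vf_coords A c Z \<circ> t has_derivative frechet_derivative (vf_coords A c Z) (at (cmap c p)) \<circ> frechet_derivative t (at x)) (at x)"
      by (rule diff_chain_at[OF t1]) (simp only: tx Vc[OF Z])
    then have "ddir (ddir w t x) (vf_coords A c Z) (cmap c p) = ddir w (vf_coords A c Z \<circ> t) x"
      by (simp only: ddir_eq o_apply)
    also have "\<dots> = ddir w (\<lambda>y. ddir (vf_coords A d Z y) t y) x"
      using frechet_derivative_cong_open[OF W xW, of "vf_coords A c Z \<circ> t" "\<lambda>y. ddir (vf_coords A d Z y) t y"] rel by simp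
    also have "\<dots> = (\<Sum>i\<in>Basis. (vf_coords A d Z x \<bullet> i) *\<^sub>R ddir w (ddir i t) x) + ddir (ddir w (vf_coords A d Z) x) t x"
      by (rule ddir_linear_family[OF W lt smooth_onD[OF smooth_on_ddir[OF ts]] smooth_onD[OF Vd[OF Z]] xW])
    finally show ?thesis .
  qed
  let ?X = "vf_coords A d X x" and ?Y = "vf_coords A d Y x"
  have sym: "(\<Sum>i\<in>Basis. (?Y \<bullet> i) *\<^sub>R ddir ?X (ddir i t) x) = (\<Sum>i\<in>Basis. (?X \<bullet> i) *\<^sub>R ddir ?Y (ddir i t) x)"
    by (rule second_derivative_symmetric[OF W xW ts])
  have "dchart A c p (lie_bracket A X Y p) = ddir (lie_bracket A X Y p) t x"
    unfolding dchart_def t_def x_def d_def ..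
  also have "\<dots> = ddir (ddir ?X (vf_coords A d Y) x - ddir ?Y (vf_coords A d X) x) t x"
    by (simp add: lie_bracket_def Let_def d_def x_def)
  also have "\<dots> = ddir (ddir ?X (vf_coords A d Y) x) t x - ddir (ddir ?Y (vf_coords A d X) x) t x"
    by (rule linear_diff[OF lt[OF xW]])
  also have "\<dots> = ddir (ddir ?X t x) (vf_coords A c Y) (cmap c p) - ddir (ddir ?Y t x) (vf_coords A c X) (cmap c p)"
    unfolding key[OF X] key[OF Y] sym by simp
  also have "ddir ?X t x = vf_coords A c X (cmap c p)" using rel[OF xW, of X] by (simp only: tx)
  also have "ddir ?Y t x = vf_coords A c Y (cmap c p)" using rel[OF xW, of Y] by (simp only: tx)
  finally show ?thesis .
qed

end

section \<open>Smooth bumps\<close>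

text \<open>The usual flat function \<open>e\<^sup>-\<^sup>1\<^sup>/\<^sup>t\<close>; the powers of \<open>t\<close> make the family closed under differentiation.\<close>

definition flat :: "nat \<Rightarrow> real \<Rightarrow> real" where
  "flat m t = (if t \<le> 0 then 0 else exp (- (1 / t)) / t ^ m)"

lemma flat_tendsto_0: "((\<lambda>t. flat m t) \<longlongrightarrow> 0) (at_right 0)"
proof -
  have 1: "((\<lambda>u. u ^ m / exp u) \<longlongrightarrow> (0::real)) at_top" by (rule tendsto_power_div_exp_0)
  have 2: "filterlim (\<lambda>t::real. inverse t) at_top (at_right 0)" by (rule filterlim_inverse_at_top_right)
  have "((\<lambda>t. inverse t ^ m / exp (inverse t)) \<longlongrightarrow> (0::real)) (at_right 0)"
    using filterlim_compose[OF 1 2] .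
  then show ?thesis
  proof (rule Lim_transform_eventually)
    have "\<forall>\<^sub>F t in at_right 0. (0::real) < t" by (simp add: eventually_at_filter)
    then show "\<forall>\<^sub>F t in at_right 0. inverse t ^ m / exp (inverse t) = flat m t"
    proof eventually_elim
      case (elim t)
      then show ?case by (simp add: flat_def exp_minus divide_simps power_inverse)
    qed
  qed
qed

lemma flat_DERIV: "(flat m has_real_derivative flat (m + 2) t - real m * flat (m + 1) t) (at t)"
proof -
  consider "t < 0" | "t = 0" | "0 < t" by linarith
  then show ?thesis
  proof cases
    case 1
    have "((\<lambda>_. 0) has_real_derivative 0) (at t)" by simp
    then have "(flat m has_real_derivative 0) (at t)"
      by (rule has_field_derivative_transform_within_open[where S = "{..<0}"]) (use 1 in \<open>auto simp: flat_def\<close>)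
    then show ?thesis using 1 by (simp add: flat_def)
  next
    case 2
    have "((\<lambda>h. (flat m (0 + h) - flat m 0) / h) \<longlongrightarrow> 0) (at 0)"
    proof (rule filterlim_split_at)
      have "\<forall>\<^sub>F h in at_left (0::real). h < 0" by (simp add: eventually_at_filter)
      then have "\<forall>\<^sub>F h in at_left (0::real). 0 = (flat m (0 + h) - flat m 0) / h"
        by eventually_elim (simp add: flat_def)
      from Lim_transform_eventually[OF tendsto_const this]
      show "((\<lambda>h. (flat m (0 + h) - flat m 0) / h) \<longlongrightarrow> 0) (at_left 0)" .
      have "\<forall>\<^sub>F h in at_right (0::real). 0 < h" by (simp add: eventually_at_filter)
      then have "\<forall>\<^sub>F h in at_right (0::real). flat (Suc m) h = (flat m (0 + h) - flat m 0) / h"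
        by eventually_elim (simp add: flat_def)
      from Lim_transform_eventually[OF flat_tendsto_0 this]
      show "((\<lambda>h. (flat m (0 + h) - flat m 0) / h) \<longlongrightarrow> 0) (at_right 0)" .
    qed
    then have "(flat m has_real_derivative 0) (at 0)" by (simp only: DERIV_def)
    then show ?thesis using 2 by (simp add: flat_def)
  next
    case 3
    have "((\<lambda>t. exp (- (1 / t)) / t ^ m) has_real_derivative
        (exp (- (1 / t)) * (1 / t ^ 2)) / t ^ m - real m * exp (- (1 / t)) / t ^ (m + 1)) (at t)"
    proof -
      have "((\<lambda>t. exp (- (1 / t)) * inverse (t ^ m)) has_real_derivative
          exp (- (1 / t)) * (1 / t ^ 2) * inverse (t ^ m) + exp (- (1 / t)) * (- (inverse (t ^ m) * (real m * t ^ (m - 1)) * inverse (t ^ m)))) (at t)"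
        using 3 by (auto intro!: derivative_eq_intros simp: power2_eq_square divide_inverse)
      moreover have "inverse (t ^ m) * (real m * t ^ (m - 1)) * inverse (t ^ m) = real m / t ^ (m + 1)"
        using 3 by (cases m) (simp_all add: field_simps)
      ultimately have "((\<lambda>t. exp (- (1 / t)) / t ^ m) has_real_derivative
          exp (- (1 / t)) * (1 / t ^ 2) * inverse (t ^ m) + exp (- (1 / t)) * (- (real m / t ^ (m + 1)))) (at t)"
        by (simp only: divide_inverse[of "exp _"])
      moreover have "exp (- (1 / t)) * (1 / t ^ 2) * inverse (t ^ m) + exp (- (1 / t)) * (- (real m / t ^ (m + 1)))
          = (exp (- (1 / t)) * (1 / t ^ 2)) / t ^ m - real m * exp (- (1 / t)) / t ^ (m + 1)"
        by (simp add: divide_inverse)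
      ultimately show ?thesis by (simp only:)
    qed
    then have "(flat m has_real_derivative
        (exp (- (1 / t)) * (1 / t ^ 2)) / t ^ m - real m * exp (- (1 / t)) / t ^ (m + 1)) (at t)"
      by (rule has_field_derivative_transform_within_open[where S = "{0<..}"]) (use 3 in \<open>auto simp: flat_def\<close>)
    moreover have "(exp (- (1 / t)) * (1 / t ^ 2)) / t ^ m = flat (m + 2) t"
      using 3 by (simp add: flat_def power_add power2_eq_square)
    moreover have "real m * exp (- (1 / t)) / t ^ (m + 1) = real m * flat (m + 1) t"
      using 3 by (simp add: flat_def)
    ultimately show ?thesis by (simp only:)
  qed
qed

lemma smooth_flat: "smooth_on UNIV (flat m)"
proof (rule smooth_onI)
  show "Ck_on k UNIV (flat m)" for k
  proof (induction k arbitrary: m)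
    case 0
    show ?case using DERIV_isCont[OF flat_DERIV] by (simp add: continuous_at_imp_continuous_on)
  next
    case (Suc k)
    show ?case
    proof (rule Ck_on_SucI[OF open_UNIV])
      show "(flat m has_derivative (\<lambda>v. (flat (m + 2) t - real m * flat (m + 1) t) * v)) (at t)" for t
        using flat_DERIV[of m t] by (simp only: has_field_derivative_def)
      show "Ck_on k UNIV (\<lambda>t. (flat (m + 2) t - real m * flat (m + 1) t) * v)" for v
        by (intro Ck_on_mult Ck_on_diff open_UNIV Ck_on_const Suc.IH)
    qed
  qed
qed

definition bump :: "'e::euclidean_space \<Rightarrow> real \<Rightarrow> 'e \<Rightarrow> real" where
  "bump x0 r x = flat 0 (r\<^sup>2 - (x - x0) \<bullet> (x - x0))"

lemma smooth_bump: "open S \<Longrightarrow> smooth_on S (bump x0 r)"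
proof -
  assume S: "open S"
  have "smooth_on S (\<lambda>x. flat 0 (r\<^sup>2 - (x - x0) \<bullet> (x - x0)))"
    by (rule smooth_on_compose[OF S smooth_flat])
      (auto intro!: smooth_on_diff smooth_on_inner smooth_on_ident smooth_on_const S)
  then show ?thesis by (simp add: bump_def[abs_def])
qed

lemma bump_pos: "x \<in> ball x0 r \<Longrightarrow> 0 < bump x0 r x"
proof -
  assume x: "x \<in> ball x0 r"
  then have "norm (x - x0) < r" by (simp add: dist_norm norm_minus_commute)
  then have "(norm (x - x0))\<^sup>2 < r\<^sup>2" by (intro power_strict_mono) auto
  then have "0 < r\<^sup>2 - (x - x0) \<bullet> (x - x0)" by (simp add: power2_norm_eq_inner)
  then show "0 < bump x0 r x" unfolding bump_def flat_def by simp
qed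

lemma bump_zero: "0 \<le> r \<Longrightarrow> x \<notin> cball x0 r \<Longrightarrow> bump x0 r x = 0"
proof -
  assume r: "0 \<le> r" and x: "x \<notin> cball x0 r"
  then have "r < norm (x - x0)" by (simp add: dist_norm norm_minus_commute)
  then have "r\<^sup>2 < (norm (x - x0))\<^sup>2" using r by (intro power_strict_mono) auto
  then have "\<not> 0 < r\<^sup>2 - (x - x0) \<bullet> (x - x0)" by (simp add: power2_norm_eq_inner)
  then show "bump x0 r x = 0" unfolding bump_def flat_def by simp
qed

section \<open>Adapted frames\<close>

lemma Basis_combination_inner:
  fixes r :: "'e::euclidean_space \<Rightarrow> real"
  assumes "E \<subseteq> Basis" "c \<in> Basis"
  shows "(\<Sum>b\<in>E. r b *\<^sub>R b) \<bullet> c = (if c \<in> E then r c else 0)"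
proof -
  have "finite E" using assms(1) finite_Basis finite_subset by blast
  moreover have "(\<Sum>b\<in>E. r b *\<^sub>R b) \<bullet> c = (\<Sum>b\<in>E. if b = c then r c else 0)"
    unfolding inner_sum_left by (rule sum.cong[OF refl]) (use assms in \<open>auto simp: inner_Basis\<close>)
  ultimately show ?thesis by simp
qed

text \<open>Indexed families instead of sets of vectors, because the values of a frame at a point are indexed.\<close>

lemma spanning_family_independent:
  fixes f :: "'i \<Rightarrow> 'e::euclidean_space"
  assumes I: "finite I" and d: "dim (span (f ` I)) = card I" and z: "(\<Sum>i\<in>I. r i *\<^sub>R f i) = 0" and i: "i \<in> I"
  shows "r i = 0"
proof -
  have "card I \<le> card (f ` I)" using dim_le_card[of "span (f ` I)" "f ` I"] I d by simp
  then have c: "card (f ` I) = card I" using card_image_le[OF I, of f] by simp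
  then have inj: "inj_on f I" by (rule eq_card_imp_inj_on[OF I])
  have ind: "independent (f ` I)"
    by (rule card_le_dim_spanning[of _ "span (f ` I)"]) (use I d c in \<open>auto intro: span_base\<close>)
  have "(\<Sum>v\<in>f ` I. r (the_inv_into I f v) *\<^sub>R v) = (\<Sum>i\<in>I. r i *\<^sub>R f i)"
    by (subst sum.reindex[OF inj]) (simp add: the_inv_into_f_f[OF inj])
  then have "r (the_inv_into I f (f i)) = 0"
    using independentD[OF ind finite_imageI[OF I] subset_refl, of "\<lambda>v. r (the_inv_into I f v)" "f i"] z i by simp
  then show ?thesis by (simp add: the_inv_into_f_f[OF inj i])
qed

lemma in_span_image_finite:
  fixes f :: "'i \<Rightarrow> 'e::real_vector"
  assumes "finite I" "v \<in> span (f ` I)"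
  shows "\<exists>r. v = (\<Sum>i\<in>I. r i *\<^sub>R f i)"
  using assms
proof (induction I arbitrary: v)
  case empty
  then show ?case by simp
next
  case (insert i I)
  then obtain k where "v - k *\<^sub>R f i \<in> span (f ` I)" unfolding image_insert span_breakdown_eq by blast
  from insert.IH[OF this] obtain r where r: "v - k *\<^sub>R f i = (\<Sum>j\<in>I. r j *\<^sub>R f j)" by blast
  have "(\<Sum>j\<in>I. (r(i := k)) j *\<^sub>R f j) = (\<Sum>j\<in>I. r j *\<^sub>R f j)"
    by (rule sum.cong[OF refl]) (use insert.hyps in auto)
  then have "v = (\<Sum>j\<in>insert i I. (r(i := k)) j *\<^sub>R f j)"
    using insert.hyps r by (simp add: algebra_simps)
  then show ?case by blast
qed

text \<open>Extend a basis of \<open>D\<close> to a basis of the whole space by standard basis vectors \<open>C\<close>.  The remaining standard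
  vectors are \<open>E\<close>, and a vector of \<open>D\<close> without coordinates in \<open>E\<close> lies in \<open>D \<inter> span C = {0}\<close>.\<close>

lemma complementary_coordinates:
  fixes D :: "'e::euclidean_space set"
  assumes D: "subspace D"
  obtains E where "E \<subseteq> Basis" "card E = dim D" "\<And>v. v \<in> D \<Longrightarrow> (\<And>b. b \<in> E \<Longrightarrow> v \<bullet> b = 0) \<Longrightarrow> v = 0"
proof -
  obtain B0 where B0: "B0 \<subseteq> D" "independent B0" "D \<subseteq> span B0" "card B0 = dim D" using basis_exists by blast
  obtain B where B: "B0 \<subseteq> B" "B \<subseteq> B0 \<union> Basis" "independent B" "B0 \<union> Basis \<subseteq> span B"
    using maximal_independent_subset_extend[of B0 "B0 \<union> Basis"] B0(2) by blast
  define C where "C = B - B0"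
  define E where "E = Basis - C"
  have fB: "finite B" by (rule independent_imp_finite[OF B(3)])
  have "span Basis \<subseteq> span B" by (rule span_minimal[OF _ subspace_span]) (use B(4) in blast)
  then have spB: "span B = UNIV" by (auto simp: span_Basis)
  then have cB: "card B = DIM('e)" using dim_span_eq_card_independent[OF B(3)] dim_UNIV by simp
  have C: "C \<subseteq> Basis" "card C = DIM('e) - dim D" using B cB B0(4) finite_subset[OF B(1) fB] by (auto simp: C_def card_Diff_subset)
  have dD: "dim D \<le> DIM('e)" by (rule dim_subset_UNIV)
  have cE: "card E = dim D" using C dD by (simp add: E_def card_Diff_subset finite_subset[OF C(1)])
  let ?K = "span C"
  have dK: "dim ?K = DIM('e) - dim D"
    using dim_span_eq_card_independent[OF independent_mono[OF B(3)], of C] C(2) by (auto simp: C_def)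
  have UN: "{x + y |x y. x \<in> D \<and> y \<in> ?K} = UNIV"
  proof -
    have "subspace {x + y |x y. x \<in> D \<and> y \<in> ?K}" by (rule subspace_sums[OF D subspace_span])
    moreover have "B \<subseteq> {x + y |x y. x \<in> D \<and> y \<in> ?K}"
    proof
      fix v assume v: "v \<in> B"
      show "v \<in> {x + y |x y. x \<in> D \<and> y \<in> ?K}"
      proof (cases "v \<in> B0")
        case True
        then show ?thesis using B0(1) span_zero[of C] by force
      next
        case False
        then have "v \<in> ?K" using v by (auto simp: C_def intro: span_base)
        then show ?thesis using subspace_0[OF D] by force
      qed
    qed
    ultimately have "span B \<subseteq> {x + y |x y. x \<in> D \<and> y \<in> ?K}" using span_minimal by blast
    then show ?thesis using spB by blast
  qed
  have "dim (D \<inter> ?K) = 0"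
    using dim_sums_Int[OF D subspace_span[of C]] unfolding UN dK using dD by (simp add: dim_UNIV)
  then have DK: "D \<inter> ?K \<subseteq> {0}" by (simp only: dim_eq_0)
  show thesis
  proof (rule that[OF _ cE])
    show "E \<subseteq> Basis" by (auto simp: E_def)
    fix v assume v: "v \<in> D" "\<And>b. b \<in> E \<Longrightarrow> v \<bullet> b = 0"
    have "v = (\<Sum>b\<in>Basis. (v \<bullet> b) *\<^sub>R b)" by (simp only: euclidean_representation)
    also have "\<dots> = (\<Sum>b\<in>C. (v \<bullet> b) *\<^sub>R b)"
      by (rule sum.mono_neutral_right) (use C v(2) in \<open>auto simp: E_def\<close>)
    also have "\<dots> \<in> ?K" by (intro span_sum span_scale span_base)
    finally show "v = 0" using DK v(1) by blast
  qed
qed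

text \<open>\<open>D x\<close> is a graph over \<open>span E\<close>, and \<open>a b x\<close> is its vector lying above \<open>b\<close>.\<close>

definition adapted_frame :: "'e::euclidean_space set \<Rightarrow> 'e set \<Rightarrow> ('e \<Rightarrow> 'e set) \<Rightarrow> ('e \<Rightarrow> 'e \<Rightarrow> 'e) \<Rightarrow> bool" where
  "adapted_frame E T D a \<longleftrightarrow> E \<subseteq> Basis \<and> (\<forall>b\<in>E. smooth_on T (a b)) \<and>
     (\<forall>x\<in>T. subspace (D x) \<and> (\<forall>b\<in>E. a b x \<in> D x \<and> (\<forall>c\<in>E. a b x \<bullet> c = (if b = c then 1 else 0))) \<and>
        (\<forall>v\<in>D x. (\<forall>b\<in>E. v \<bullet> b = 0) \<longrightarrow> v = 0))"

lemma adapted_frame_representation: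
  assumes a: "adapted_frame E T D a" and x: "x \<in> T" and v: "v \<in> D x"
  shows "v = (\<Sum>b\<in>E. (v \<bullet> b) *\<^sub>R a b x)"
proof -
  have fE: "finite E" using a finite_subset finite_Basis unfolding adapted_frame_def by blast
  have sub: "subspace (D x)" and aD: "\<And>b. b \<in> E \<Longrightarrow> a b x \<in> D x"
    and ab: "\<And>b c. b \<in> E \<Longrightarrow> c \<in> E \<Longrightarrow> a b x \<bullet> c = (if b = c then 1 else 0)"
    and z: "\<And>v. v \<in> D x \<Longrightarrow> (\<And>b. b \<in> E \<Longrightarrow> v \<bullet> b = 0) \<Longrightarrow> v = 0"
    using a x unfolding adapted_frame_def by auto
  let ?w = "\<Sum>b\<in>E. (v \<bullet> b) *\<^sub>R a b x"
  have "?w \<bullet> c = v \<bullet> c" if c: "c \<in> E" for c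
  proof -
    have "?w \<bullet> c = (\<Sum>b\<in>E. if b = c then v \<bullet> c else 0)"
      unfolding inner_sum_left by (rule sum.cong[OF refl]) (use ab c in auto)
    then show ?thesis using c fE by simp
  qed
  moreover have "v - ?w \<in> D x"
    by (intro subspace_diff[OF sub v] subspace_sum[OF sub] subspace_scale[OF sub] aD)
  ultimately have "v - ?w = 0" by (intro z) (simp_all add: inner_diff_left)
  then show ?thesis by simp
qed

text \<open>The matrix of the \<open>E\<close>-coordinates of a given frame has to be inverted.  \<open>M x\<close> is this matrix on \<open>span E\<close>,
  completed by the identity to an endomorphism of the whole space.\<close>

lemma adapted_frame_exists:
  fixes \<xi> :: "nat \<Rightarrow> 'e::euclidean_space \<Rightarrow> 'e"
  assumes W: "open W" "x0 \<in> W" and xi: "\<And>i. i < k \<Longrightarrow> smooth_on W (\<xi> i)"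
    and D: "\<And>x. x \<in> W \<Longrightarrow> D x = span ((\<lambda>i. \<xi> i x) ` {..<k})" "\<And>x. x \<in> W \<Longrightarrow> dim (D x) = k"
  obtains E T a where "open T" "x0 \<in> T" "T \<subseteq> W" "adapted_frame E T D a"
proof -
  have subD: "subspace (D x)" if "x \<in> W" for x unfolding D(1)[OF that] by (rule subspace_span)
  obtain E where E: "E \<subseteq> Basis" "card E = k" "\<And>v. v \<in> D x0 \<Longrightarrow> (\<And>b. b \<in> E \<Longrightarrow> v \<bullet> b = 0) \<Longrightarrow> v = 0"
    using complementary_coordinates[OF subD[OF W(2)]] D(2)[OF W(2)] by metis
  have fE: "finite E" using E(1) finite_Basis finite_subset by blast
  obtain h where h: "bij_betw h E {..<k}" using finite_same_card_bij[OF fE finite_lessThan] E(2) by fastforce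
  have hk: "h b < k" if "b \<in> E" for b using bij_betwE[OF h] that by auto
  have hE: "(\<lambda>i. \<xi> i x) ` {..<k} = (\<lambda>b. \<xi> (h b) x) ` E" for x
    unfolding bij_betw_imp_surj_on[OF h, symmetric] image_image ..
  have DE: "D x = span ((\<lambda>b. \<xi> (h b) x) ` E)" if "x \<in> W" for x using D(1)[OF that] hE by simp
  have indep: "r b = 0" if "x \<in> W" "(\<Sum>b\<in>E. r b *\<^sub>R \<xi> (h b) x) = 0" "b \<in> E" for x r b
    by (rule spanning_family_independent[OF fE _ that(2,3)]) (use D(2)[OF that(1)] DE[OF that(1)] E(2) in simp)
  have comb: "(\<Sum>b\<in>E. r b *\<^sub>R \<xi> (h b) x) \<in> D x" if "x \<in> W" for x r
    unfolding DE[OF that] by (intro span_sum span_scale span_base) blast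
  have reps: "\<exists>r. v = (\<Sum>b\<in>E. r b *\<^sub>R \<xi> (h b) x)" if "x \<in> W" "v \<in> D x" for x v
    using in_span_image_finite[OF fE] that(2) unfolding DE[OF that(1)] by blast
  define M where "M x v = (\<Sum>b\<in>E. (v \<bullet> b) *\<^sub>R (\<Sum>c\<in>E. (\<xi> (h b) x \<bullet> c) *\<^sub>R c)) + (v - (\<Sum>c\<in>E. (v \<bullet> c) *\<^sub>R c))" for x v
  have ic: "(\<Sum>b\<in>E. r b *\<^sub>R b) \<bullet> c = (if c \<in> E then r c else 0)" if "c \<in> Basis" for c and r :: "'e \<Rightarrow> real"
    by (rule Basis_combination_inner[OF E(1) that])
  have Mc: "M x v \<bullet> c = (if c \<in> E then (\<Sum>b\<in>E. (v \<bullet> b) *\<^sub>R \<xi> (h b) x) \<bullet> c else v \<bullet> c)" if "c \<in> Basis" for x v c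
    unfolding M_def inner_add_left inner_diff_left inner_sum_left[of _ E] inner_scaleR_left
    by (simp only: inner_sum_left[symmetric] inner_scaleR_left[symmetric] ic[OF that]) (simp add: inner_sum_left)
  have lin: "linear (M x)" for x
    unfolding M_def
    by (intro linear_compose_add linear_compose_sub linear_compose_sum ballI linear_id[unfolded id_def])
      (auto intro!: linearI simp: inner_add_left scaleR_add_left)
  have sm: "smooth_on W (\<lambda>x. M x v)" for v
    unfolding M_def
    by (intro smooth_on_add smooth_on_diff smooth_on_sum smooth_on_scaleR smooth_on_inner smooth_on_const W(1) xi hk)
  have injD: "u = 0" if x: "x \<in> W" and i: "inj (M x)" and u: "u \<in> D x" "\<And>b. b \<in> E \<Longrightarrow> u \<bullet> b = 0" for x u
  proof -
    obtain r where r: "u = (\<Sum>b\<in>E. r b *\<^sub>R \<xi> (h b) x)" using reps[OF x u(1)] by blast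
    let ?w = "\<Sum>b\<in>E. r b *\<^sub>R b"
    have "(\<Sum>b\<in>E. (?w \<bullet> b) *\<^sub>R \<xi> (h b) x) = u"
      unfolding r by (rule sum.cong[OF refl]) (use E(1) ic in auto)
    then have Mu: "M x ?w \<bullet> c = (if c \<in> E then u \<bullet> c else 0)" if "c \<in> Basis" for c
      using Mc[OF that, of x ?w] ic[OF that, of r] by simp
    have "M x ?w = 0"
    proof (rule euclidean_eqI)
      fix c :: 'e assume "c \<in> Basis"
      then show "M x ?w \<bullet> c = 0 \<bullet> c" using Mu u(2) by simp
    qed
    then have w0: "?w = 0" using i linear_0[OF lin, of x] by (metis injD)
    have "r b = 0" if "b \<in> E" for b
    proof -
      have "b \<in> Basis" using that E(1) by blast
      from ic[OF this, of r] show ?thesis using that unfolding w0 by simp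
    qed
    then show ?thesis unfolding r by simp
  qed
  have inj0: "inj (M x0)"
    unfolding linear_injective_0[OF lin]
  proof (intro allI impI)
    fix v assume v: "M x0 v = 0"
    have "(\<Sum>b\<in>E. (v \<bullet> b) *\<^sub>R \<xi> (h b) x0) = 0"
    proof (rule E(3)[OF comb[OF W(2)]])
      show "(\<Sum>b\<in>E. (v \<bullet> b) *\<^sub>R \<xi> (h b) x0) \<bullet> c = 0" if "c \<in> E" for c
        using Mc[of c x0 v] that E(1) v by auto
    qed
    then have vE: "v \<bullet> b = 0" if "b \<in> E" for b by (rule indep[OF W(2) _ that])
    show "v = 0"
    proof (rule euclidean_eqI)
      fix b :: 'e assume "b \<in> Basis"
      then show "v \<bullet> b = 0 \<bullet> b" using vE[of b] Mc[of b x0 v] v by (cases "b \<in> E") simp_all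
    qed
  qed
  obtain T where T: "open T" "x0 \<in> T" "T \<subseteq> W" "\<And>x. x \<in> T \<Longrightarrow> inj (M x)"
    using injective_near[OF W lin Ck_on_continuous[OF smooth_onD[OF sm]] inj0] by blast
  define a where "a b x = (\<Sum>c\<in>E. (inv (M x) b \<bullet> c) *\<^sub>R \<xi> (h c) x)" for b x
  have "adapted_frame E T D a"
    unfolding adapted_frame_def
  proof (intro conjI ballI impI E(1))
    fix b assume b: "b \<in> E"
    have "smooth_on T (\<lambda>x. inv (M x) b)"
      by (rule linear_family_inverse[OF T(1) lin smooth_on_subset[OF sm T(3)] T(4)])
    then show "smooth_on T (a b)"
      unfolding a_def[abs_def]
      by (intro smooth_on_sum smooth_on_scaleR smooth_on_inner smooth_on_const T(1) smooth_on_subset[OF xi[OF hk] T(3)])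
  next
    fix x assume x: "x \<in> T"
    then have xW: "x \<in> W" using T(3) by blast
    show "subspace (D x)" by (rule subD[OF xW])
    show "a b x \<in> D x" for b unfolding a_def by (rule comb[OF xW])
    show "a b x \<bullet> c = (if b = c then 1 else 0)" if b: "b \<in> E" and c: "c \<in> E" for b c
    proof -
      have "surj (M x)" by (rule linear_injective_imp_surjective[OF lin T(4)[OF x]]) (rule refl)
      then have "M x (inv (M x) b) = b" by (rule surj_f_inv_f)
      then have "a b x \<bullet> c = b \<bullet> c" using Mc[of c x "inv (M x) b"] c E(1) by (auto simp: a_def)
      then show ?thesis using inner_Basis[of b c] subsetD[OF E(1) b] subsetD[OF E(1) c] by simp
    qed
    show "v = 0" if "v \<in> D x" "\<forall>b\<in>E. v \<bullet> b = 0" for v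
      by (rule injD[OF xW T(4)[OF x] that(1)]) (use that(2) in blast)
  qed
  with T(1-3) show thesis by (rule that)
qed

section \<open>Frobenius' theorem\<close>

text \<open>The brackets of an adapted frame have no coordinates in \<open>E\<close>, because those of the frame are constant; by
  involutivity they lie in \<open>D\<close>, so they vanish and the frame commutes.  At the origin \<open>D\<Phi>\<close> maps \<open>E\<close> to the frame
  and fixes the other basis vectors, so \<open>\<Phi>\<close> is a local diffeomorphism straightening \<open>D\<close>.\<close>

lemma frobenius_coordinates:
  fixes D :: "'e::euclidean_space \<Rightarrow> 'e set"
  assumes T: "open T" "x0 \<in> T" and a: "adapted_frame E T D a"
    and inv: "\<And>b c x. b \<in> E \<Longrightarrow> c \<in> E \<Longrightarrow> x \<in> T \<Longrightarrow> ddir (a b x) (a c) x - ddir (a c x) (a b) x \<in> D x"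
  obtains U V \<Phi> \<Psi> where "open U" "open V" "x0 \<in> V" "V \<subseteq> T" "homeomorphism U V \<Phi> \<Psi>"
    "smooth_on U \<Phi>" "smooth_on V \<Psi>" "\<And>b x. b \<in> E \<Longrightarrow> x \<in> U \<Longrightarrow> ddir b \<Phi> x = a b (\<Phi> x)"
    "\<And>x. x \<in> U \<Longrightarrow> inj (frechet_derivative \<Phi> (at x))"
proof -
  have E: "E \<subseteq> Basis" and sa: "\<And>b. b \<in> E \<Longrightarrow> smooth_on T (a b)"
    and ab: "\<And>x b c. x \<in> T \<Longrightarrow> b \<in> E \<Longrightarrow> c \<in> E \<Longrightarrow> a b x \<bullet> c = (if b = c then 1 else 0)"
    and z: "\<And>x v. x \<in> T \<Longrightarrow> v \<in> D x \<Longrightarrow> (\<And>b. b \<in> E \<Longrightarrow> v \<bullet> b = 0) \<Longrightarrow> v = 0"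
    using a unfolding adapted_frame_def by auto
  have da: "ddir v (a b) x \<bullet> c = 0" if "x \<in> T" "b \<in> E" "c \<in> E" for v b c x
  proof -
    have "((\<lambda>x. a b x \<bullet> c) has_derivative (\<lambda>v. ddir v (a b) x \<bullet> c)) (at x)"
      by (rule has_derivative_inner_left[OF smooth_on_has_derivative[OF sa[OF that(2)] that(1)]])
    moreover have "((\<lambda>x. a b x \<bullet> c) has_derivative (\<lambda>v. 0)) (at x)"
      by (rule has_derivative_transform_within_open[OF has_derivative_const T(1) that(1)]) (rule ab[symmetric, OF _ that(2,3)])
    ultimately show ?thesis using has_derivative_unique by metis
  qed
  have comm: "ddir (a b x) (a c) x = ddir (a c x) (a b) x" if "b \<in> E" "c \<in> E" "x \<in> T" for b c x
  proof -
    have "ddir (a b x) (a c) x - ddir (a c x) (a b) x = 0"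
      by (rule z[OF that(3) inv[OF that]]) (simp only: inner_diff_left da[OF that(3,2)] da[OF that(3,1)] diff_0_right)
    then show ?thesis by simp
  qed
  obtain r where r: "0 < r" "ball x0 r \<subseteq> T" using T open_contains_ball by blast
  define a' where "a' b y = a b (x0 + y)" for b y
  have xT: "x0 + y \<in> T" if "y \<in> ball 0 r" for y using r(2) that by (auto simp: dist_norm)
  have tr: "((\<lambda>y. x0 + y) has_derivative (\<lambda>v. v)) (at y)" for y by (auto intro!: derivative_eq_intros)
  have sa': "smooth_on (ball 0 r) (a' b)" if "b \<in> E" for b
    unfolding a'_def[abs_def]
    by (rule smooth_on_compose[OF open_ball sa[OF that] smooth_on_add[OF open_ball smooth_on_const smooth_on_ident]]) (use xT in blast)
  have da': "ddir v (a' b) y = ddir v (a b) (x0 + y)" if "b \<in> E" "y \<in> ball 0 r" for v b y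
    unfolding a'_def[abs_def]
    using ddir_eq[OF diff_chain_at[OF tr smooth_on_has_derivative[OF sa[OF that(1)] xT[OF that(2)]]], of v] by (simp only: o_def)
  have comm': "ddir (a' d y) (a' c) y = ddir (a' c y) (a' d) y" if "c \<in> E" "d \<in> E" "y \<in> ball 0 r" for c d y
    unfolding da'[OF that(1,3)] da'[OF that(2,3)] unfolding a'_def by (rule comm[OF that(2,1) xT[OF that(3)]])
  obtain \<delta> \<Phi>0 where F: "0 < \<delta>" "smooth_on (ball 0 \<delta>) \<Phi>0" "\<Phi>0 ` ball 0 \<delta> \<subseteq> ball 0 r" "\<Phi>0 0 = 0"
    "\<And>c x. c \<in> E \<Longrightarrow> x \<in> ball 0 \<delta> \<Longrightarrow> ddir c \<Phi>0 x = a' c (\<Phi>0 x)"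
    "\<And>b. b \<in> Basis - E \<Longrightarrow> ddir b \<Phi>0 0 = b"
  proof (rule commuting_fields_flow[where a = a', OF E r(1)])
    show "smooth_on (ball 0 r) (a' c)" if "c \<in> E" for c by (rule sa'[OF that])
    show "ddir (a' d y) (a' c) y = ddir (a' c y) (a' d) y" if "c \<in> E" "d \<in> E" "y \<in> ball 0 r" for c d y
      by (rule comm'[OF that])
  qed (rule that)
  define \<Phi> where "\<Phi> y = x0 + \<Phi>0 y" for y
  have zero: "0 \<in> ball (0::'e) \<delta>" using F(1) by simp
  have sF: "smooth_on (ball 0 \<delta>) \<Phi>"
    unfolding \<Phi>_def[abs_def] by (rule smooth_on_add[OF open_ball smooth_on_const F(2)])
  have dF: "ddir v \<Phi> y = ddir v \<Phi>0 y" if "y \<in> ball 0 \<delta>" for v y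
    unfolding \<Phi>_def[abs_def]
    using ddir_eq[OF has_derivative_add[OF has_derivative_const smooth_on_has_derivative[OF F(2) that]], of x0 v] by simp
  have FT: "\<Phi> y \<in> T" if "y \<in> ball 0 \<delta>" for y unfolding \<Phi>_def using F(3) xT that by blast
  have flow: "ddir c \<Phi> y = a c (\<Phi> y)" if "c \<in> E" "y \<in> ball 0 \<delta>" for c y
    unfolding dF[OF that(2)] F(5)[OF that] a'_def \<Phi>_def ..
  have lin0: "linear (frechet_derivative \<Phi> (at 0))"
    by (rule has_derivative_linear[OF smooth_on_has_derivative[OF sF zero]])
  have "inj (frechet_derivative \<Phi> (at 0))"
    unfolding linear_injective_0[OF lin0]
  proof (intro allI impI)
    fix v assume v: "ddir v \<Phi> 0 = 0"
    have "ddir v \<Phi> 0 = (\<Sum>b\<in>Basis. (v \<bullet> b) *\<^sub>R ddir b \<Phi> 0)" by (rule linear_Basis_expansion[OF lin0])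
    also have "\<dots> = (\<Sum>b\<in>Basis. (v \<bullet> b) *\<^sub>R (if b \<in> E then a b (\<Phi> 0) else b))"
      by (rule sum.cong[OF refl]) (use flow zero dF F(6) in auto)
    finally have s: "(\<Sum>b\<in>Basis. (v \<bullet> b) *\<^sub>R (if b \<in> E then a b (\<Phi> 0) else b)) = 0" using v by simp
    have vE: "v \<bullet> c = 0" if c: "c \<in> E" for c
    proof -
      have "(\<Sum>b\<in>Basis. (v \<bullet> b) *\<^sub>R (if b \<in> E then a b (\<Phi> 0) else b)) \<bullet> c = (\<Sum>b\<in>Basis. if b = c then v \<bullet> c else 0)"
        unfolding inner_sum_left
        by (rule sum.cong[OF refl]) (use ab[OF FT[OF zero] _ c] c E in \<open>auto simp: inner_Basis\<close>)
      then show ?thesis using s c E by auto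
    qed
    have "(\<Sum>b\<in>Basis. (v \<bullet> b) *\<^sub>R (if b \<in> E then a b (\<Phi> 0) else b)) = (\<Sum>b\<in>Basis. (v \<bullet> b) *\<^sub>R b)"
      by (rule sum.cong[OF refl]) (use vE in auto)
    then show "v = 0" using s by (simp only: euclidean_representation)
  qed
  from smooth_inverse_function[OF open_ball zero sF this] obtain U V \<Psi> where
    g: "open U" "U \<subseteq> ball 0 \<delta>" "0 \<in> U" "open V" "homeomorphism U V \<Phi> \<Psi>" "smooth_on V \<Psi>"
    "\<And>x. x \<in> U \<Longrightarrow> inj (frechet_derivative \<Phi> (at x))" by metis
  show thesis
  proof (rule that[OF g(1,4) _ _ g(5) smooth_on_subset[OF sF g(2)] g(6) _ g(7)])
    have "\<Phi> 0 \<in> V" using homeomorphism_image1[OF g(5)] g(3) by blast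
    then show "x0 \<in> V" by (simp add: \<Phi>_def F(4))
    show "V \<subseteq> T" using homeomorphism_image1[OF g(5)] g(2) FT by blast
    show "ddir b \<Phi> x = a b (\<Phi> x)" if "b \<in> E" "x \<in> U" for b x using flow that g(2) by blast
  qed
qed

lemma derivative_along_constant_line:
  fixes f :: "'e::euclidean_space \<Rightarrow> 'w::euclidean_space"
  assumes f: "(f has_derivative D) (at x)" and W: "open W" "x \<in> W"
    and const: "\<And>t. x + t *\<^sub>R u \<in> W \<Longrightarrow> f (x + t *\<^sub>R u) \<bullet> b = k"
  shows "D u \<bullet> b = 0"
proof -
  have l: "((\<lambda>t. x + t *\<^sub>R u) has_derivative (\<lambda>t. t *\<^sub>R u)) (at (0::real))" by (auto intro!: derivative_eq_intros)
  have f0: "(f has_derivative D) (at (x + 0 *\<^sub>R u))" using f by simp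
  have d: "((\<lambda>t. f (x + t *\<^sub>R u) \<bullet> b) has_derivative (\<lambda>t. D (t *\<^sub>R u) \<bullet> b)) (at 0)"
    using has_derivative_inner_left[OF diff_chain_at[OF l f0], of b] by (simp only: o_def)
  have cl: "continuous_on UNIV (\<lambda>t. x + t *\<^sub>R u)" by (intro continuous_intros)
  have o: "open ((\<lambda>t. x + t *\<^sub>R u) -` W)" by (rule open_vimage[OF W(1) cl])
  have "((\<lambda>t. f (x + t *\<^sub>R u) \<bullet> b) has_derivative (\<lambda>t. 0)) (at 0)"
    by (rule has_derivative_transform_within_open[OF has_derivative_const[of k] o]) (use W const in auto)
  from has_derivative_unique[OF d this] have "(\<lambda>t. D (t *\<^sub>R u) \<bullet> b) 1 = (\<lambda>t. 0) (1::real)" by (rule fun_cong)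
  then show ?thesis by simp
qed

context smooth_manifold begin

text \<open>A smooth diffeomorphism of the chart image gives a new chart, because the atlas is maximal.\<close>

lemma reparametrized_chart:
  assumes c: "c \<in> A" and V: "open V" "V \<subseteq> cimg c" and U: "open U" and h: "homeomorphism U V \<Phi> \<Psi>"
    and s: "smooth_on U \<Phi>" "smooth_on V \<Psi>"
  shows "(cinv c ` V, \<Psi> \<circ> cmap c) \<in> A"
    "\<And>x. x \<in> U \<Longrightarrow> cinv (cinv c ` V, \<Psi> \<circ> cmap c) x = cinv c (\<Phi> x)"
    "cimg (cinv c ` V, \<Psi> \<circ> cmap c) = U"
proof -
  let ?d = "(cinv c ` V, \<Psi> \<circ> cmap c)"
  have PU: "\<Psi> ` V = U" and PV: "\<Phi> ` U = V" using h by (auto simp: homeomorphism_def)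
  have VP: "\<Phi> (\<Psi> y) = y" if "y \<in> V" for y using homeomorphism_apply2[OF h that] .
  have UP: "\<Psi> (\<Phi> x) = x" if "x \<in> U" for x using homeomorphism_apply1[OF h that] .
  have cV: "cmap c (cinv c y) = y" if "y \<in> V" for y using cmap_cinv[OF c] V(2) that by blast
  have dom: "cinv c ` V = cdom c \<inter> cmap c -` V"
  proof (intro equalityI subsetI)
    fix p assume "p \<in> cinv c ` V"
    then obtain y where y: "y \<in> V" "p = cinv c y" by blast
    then show "p \<in> cdom c \<inter> cmap c -` V" using cinv_in[OF c subsetD[OF V(2) y(1)]] cV[OF y(1)] by simp
  next
    fix p assume p: "p \<in> cdom c \<inter> cmap c -` V"
    then have "p = cinv c (cmap c p)" using cinv_cmap[OF c] by simp
    then show "p \<in> cinv c ` V" using p by blast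
  qed
  show img: "cimg ?d = U"
    unfolding fst_conv snd_conv PU[symmetric] image_image o_apply by (rule image_cong[OF refl]) (simp only: cV)
  have inj: "inj_on (\<Psi> \<circ> cmap c) (cinv c ` V)"
  proof (rule inj_onI)
    fix p q assume "p \<in> cinv c ` V" "q \<in> cinv c ` V" and e: "(\<Psi> \<circ> cmap c) p = (\<Psi> \<circ> cmap c) q"
    then obtain y z where yz: "y \<in> V" "z \<in> V" "p = cinv c y" "q = cinv c z" by blast
    then have "\<Psi> y = \<Psi> z" using e cV by simp
    then have "y = z" using VP yz by metis
    then show "p = q" using yz by simp
  qed
  show inv: "cinv ?d x = cinv c (\<Phi> x)" if x: "x \<in> U" for x
    unfolding fst_conv snd_conv
  proof (rule inv_into_f_eq[OF inj])
    have FV: "\<Phi> x \<in> V" using PV x by blast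
    then show "cinv c (\<Phi> x) \<in> cinv c ` V" by blast
    show "(\<Psi> \<circ> cmap c) (cinv c (\<Phi> x)) = x" by (simp add: cV[OF FV] UP[OF x])
  qed
  have odom: "open (cinv c ` V)"
    unfolding dom by (rule continuous_open_preimage[OF homeomorphism_cont1[OF chart_homeo[OF c]] open_cdom[OF c] V(1)])
  have homeo: "homeomorphism (cdom ?d) (cimg ?d) (cmap ?d) (cinv ?d)"
  proof -
    have c1: "continuous_on (cinv c ` V) (\<Psi> \<circ> cmap c)"
    proof (rule continuous_on_compose)
      show "continuous_on (cinv c ` V) (cmap c)"
        by (rule continuous_on_subset[OF homeomorphism_cont1[OF chart_homeo[OF c]]]) (use dom in blast)
      show "continuous_on (cmap c ` cinv c ` V) \<Psi>"
        by (rule continuous_on_subset[OF homeomorphism_cont2[OF h]]) (use cV in auto)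
    qed
    have "continuous_on U (\<lambda>x. cinv c (\<Phi> x))"
      by (rule continuous_on_compose2[OF homeomorphism_cont2[OF chart_homeo[OF c]] homeomorphism_cont1[OF h]])
        (use PV V(2) in blast)
    then have c2: "continuous_on U (cinv ?d)" by (rule continuous_on_eq) (rule inv[symmetric])
    show ?thesis
      unfolding homeomorphism_def
    proof (intro conjI ballI)
      show "cinv ?d ` cimg ?d = cdom ?d"
      proof -
        have "cinv ?d ` U = (\<lambda>x. cinv c (\<Phi> x)) ` U" by (rule image_cong[OF refl inv])
        then show ?thesis unfolding img by (simp only: image_image[symmetric] PV fst_conv)
      qed
    qed (use c1 c2 img inv_into_f_f[OF inj] f_inv_into_f in auto)
  qed
  have chart: "is_chart ?d" unfolding is_chart_def using homeo odom img U by simp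
  \<comment> \<open>As the atlas is maximal, compatibility with its charts puts the new chart into it.\<close>
  have "compatible_charts ?d e" if e: "e \<in> A" for e
    unfolding compatible_charts_def
  proof
    let ?S = "cmap ?d ` (cdom ?d \<inter> cdom e)"
    have S: "?S \<subseteq> U" using img by auto
    have FS: "\<Phi> x \<in> cmap c ` (cdom c \<inter> cdom e)" if "x \<in> ?S" for x
    proof -
      from that obtain p where p: "p \<in> cinv c ` V" "p \<in> cdom e" "x = (\<Psi> \<circ> cmap c) p"
        unfolding fst_conv snd_conv by blast
      then have pc: "p \<in> cdom c" "cmap c p \<in> V" using dom by auto
      then have "\<Phi> x = cmap c p" using p(3) VP by simp
      then show ?thesis using p(2) pc(1) by blast
    qed
    have oS: "open ?S"
    proof -
      have "?S = U \<inter> \<Phi> -` (cmap c ` (cdom c \<inter> cdom e))"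
      proof (intro equalityI subsetI IntI vimageI2)
        fix x assume x: "x \<in> U \<inter> \<Phi> -` (cmap c ` (cdom c \<inter> cdom e))"
        then obtain p where p: "p \<in> cdom c" "p \<in> cdom e" "\<Phi> x = cmap c p" by auto
        have "\<Phi> x \<in> V" using PV x by auto
        then have pV: "p \<in> cinv c ` V" using p dom by auto
        have "x = (\<Psi> \<circ> cmap c) p" using UP[of x] x p(3) by simp
        then show "x \<in> ?S" unfolding fst_conv snd_conv using pV p(2) by blast
      next
        show "x \<in> U" if "x \<in> ?S" for x using S that by blast
        show "\<Phi> x \<in> cmap c ` (cdom c \<inter> cdom e)" if "x \<in> ?S" for x by (rule FS[OF that])
      qed
      then show ?thesis
        using continuous_open_preimage[OF homeomorphism_cont1[OF h] U open_cmap_image[OF c open_cdom[OF e]]] by simp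
    qed
    have "smooth_on ?S (\<lambda>x. (cmap e \<circ> cinv c) (\<Phi> x))"
      by (rule smooth_on_compose[OF oS transition_smooth[OF c e] smooth_on_subset[OF s(1) S]]) (use FS in blast)
    then show "smooth_on ?S (cmap e \<circ> cinv ?d)"
    proof (rule smooth_on_cong[OF oS, rotated])
      fix x assume "x \<in> ?S"
      then have "x \<in> U" using S by blast
      then show "(cmap e \<circ> cinv c) (\<Phi> x) = (cmap e \<circ> cinv ?d) x" by (simp only: o_apply inv)
    qed
    let ?R = "cmap e ` (cdom ?d \<inter> cdom e)"
    have oR: "open ?R"
      using open_cmap_image[OF e odom] by (simp add: Int_commute)
    have Rc: "?R \<subseteq> cmap e ` (cdom e \<inter> cdom c)" using dom by auto
    have "smooth_on ?R (\<lambda>x. \<Psi> ((cmap c \<circ> cinv e) x))"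
    proof (rule smooth_on_compose[OF oR s(2) smooth_on_subset[OF transition_smooth[OF e c] Rc]])
      show "(cmap c \<circ> cinv e) ` ?R \<subseteq> V" using dom cinv_cmap[OF e] by auto
    qed
    then show "smooth_on ?R (cmap ?d \<circ> cinv e)" by (simp add: o_def)
  qed
  then show "?d \<in> A" using atlas chart unfolding smooth_structure_def by blast
qed

lemma dchart_reparametrized:
  assumes c: "c \<in> A" and V: "open V" "V \<subseteq> cimg c" and U: "open U" and h: "homeomorphism U V \<Phi> \<Psi>"
    and s: "smooth_on U \<Phi>" "smooth_on V \<Psi>" and x: "x \<in> U"
  shows "dchart A c (cinv c (\<Phi> x)) v =
    frechet_derivative \<Phi> (at x) (dchart A (cinv c ` V, \<Psi> \<circ> cmap c) (cinv c (\<Phi> x)) v)"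
proof -
  let ?d = "(cinv c ` V, \<Psi> \<circ> cmap c)"
  note d = reparametrized_chart[OF c V U h s]
  have PV: "\<Phi> ` U = V" using h by (auto simp: homeomorphism_def)
  have px: "\<Phi> x \<in> V" using PV x by blast
  have pd: "cinv c (\<Phi> x) \<in> cdom ?d" using px by simp
  have pc: "cinv c (\<Phi> x) \<in> cdom c" using cinv_in[OF c] px V(2) by blast
  have dx: "cmap ?d (cinv c (\<Phi> x)) = x"
    using cmap_cinv[OF d(1), of x] d(2)[OF x] d(3) x by simp
  have "dchart A c (cinv c (\<Phi> x)) v = frechet_derivative (cmap c \<circ> cinv ?d) (at x) (dchart A ?d (cinv c (\<Phi> x)) v)"
    using dchart_change[OF d(1) pd c pc, of v] unfolding dx .
  also have "frechet_derivative (cmap c \<circ> cinv ?d) (at x) = frechet_derivative \<Phi> (at x)"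
  proof (rule frechet_derivative_cong_open[OF U x])
    fix y assume y: "y \<in> U"
    then have "\<Phi> y \<in> cimg c" using PV V(2) by blast
    then show "(cmap c \<circ> cinv ?d) y = \<Phi> y" using d(2)[OF y] cmap_cinv[OF c] by simp
  qed
  finally show ?thesis .
qed

definition coord_dist :: "('a, 'e) chart \<Rightarrow> ('a \<Rightarrow> 'e set) \<Rightarrow> 'e \<Rightarrow> 'e set" where
  "coord_dist c D x = dchart A c (cinv c x) ` D (cinv c x)"

lemma coord_dist_iff: "c \<in> A \<Longrightarrow> q \<in> cdom c \<Longrightarrow> dchart A c q v \<in> coord_dist c D (cmap c q) \<longleftrightarrow> v \<in> D q"
  unfolding coord_dist_def by (auto simp: cinv_cmap dchart_eq_iff)

lemma coord_vec_in_iff: "c \<in> A \<Longrightarrow> q \<in> cdom c \<Longrightarrow> coord_vec A c u q \<in> D q \<longleftrightarrow> u \<in> coord_dist c D (cmap c q)"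
  using coord_dist_iff[of c q "coord_vec A c u q" D] by (simp add: dchart_coord_vec)

lemma dchart_inj: "c \<in> A \<Longrightarrow> p \<in> cdom c \<Longrightarrow> inj (dchart A c p)"
  by (rule injI) (simp only: dchart_eq_iff)

lemma distribution_adapted_frame:
  assumes D: "distribution A D" and c: "c \<in> A" "p \<in> cdom c"
  obtains T E a where "open T" "cmap c p \<in> T" "T \<subseteq> cimg c" "adapted_frame E T (coord_dist c D) a"
proof -
  obtain U k and X :: "nat \<Rightarrow> 'a \<Rightarrow> 'e" where U: "open U" "p \<in> U" "\<And>i. i < k \<Longrightarrow> X i \<in> vector_fields_on A U"
    "\<And>q. q \<in> U \<Longrightarrow> D q = span ((\<lambda>i. X i q) ` {..<k}) \<and> dim (D q) = k"
    using D unfolding distribution_def by metis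
  define W where "W = cmap c ` (cdom c \<inter> U)"
  have W: "open W" "cmap c p \<in> W" "W \<subseteq> cimg c"
    unfolding W_def using open_cmap_image[OF c(1) U(1)] c U by auto
  have sm: "smooth_on W (vf_coords A c (X i))" if "i < k" for i
    unfolding W_def by (rule vector_fields_on_smooth[OF U(3)[OF that] c(1)])
  have q: "cinv c x \<in> cdom c" "cinv c x \<in> U" if "x \<in> W" for x
    using that cinv_cmap[OF c(1)] unfolding W_def by auto
  have sp: "coord_dist c D x = span ((\<lambda>i. vf_coords A c (X i) x) ` {..<k})" if "x \<in> W" for x
  proof -
    have "D (cinv c x) = span ((\<lambda>i. X i (cinv c x)) ` {..<k})" using U(4)[OF q(2)[OF that]] by blast
    then have "coord_dist c D x = dchart A c (cinv c x) ` span ((\<lambda>i. X i (cinv c x)) ` {..<k})"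
      by (simp only: coord_dist_def)
    also have "\<dots> = span (dchart A c (cinv c x) ` ((\<lambda>i. X i (cinv c x)) ` {..<k}))"
      by (rule linear_span_image[OF dchart_linear[OF c(1) q(1)[OF that]], symmetric])
    finally show ?thesis by (simp only: image_image vf_coords_def)
  qed
  have di: "dim (coord_dist c D x) = k" if "x \<in> W" for x
  proof -
    have "dim (coord_dist c D x) = dim (D (cinv c x))"
      unfolding coord_dist_def by (rule dim_image_eq[OF dchart_linear[OF c(1) q(1)[OF that]]])
        (rule inj_on_subset[OF dchart_inj[OF c(1) q(1)[OF that]] subset_UNIV])
    also have "\<dots> = k" using U(4)[OF q(2)[OF that]] by blast
    finally show ?thesis .
  qed
  show thesis
  proof (rule adapted_frame_exists[where k = k and D = "coord_dist c D", OF W(1,2)])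
    show "smooth_on W (vf_coords A c (X i))" if "i < k" for i by (rule sm[OF that])
    show "coord_dist c D x = span ((\<lambda>i. vf_coords A c (X i) x) ` {..<k})" "dim (coord_dist c D x) = k" if "x \<in> W" for x
      by (rule sp[OF that], rule di[OF that])
    show thesis if "open T" "cmap c p \<in> T" "T \<subseteq> W" "adapted_frame E T (coord_dist c D) a" for E T a
      by (rule \<open>\<And>T E a. open T \<Longrightarrow> cmap c p \<in> T \<Longrightarrow> T \<subseteq> cimg c \<Longrightarrow> adapted_frame E T (coord_dist c D) a \<Longrightarrow> thesis\<close>[OF that(1,2) subset_trans[OF that(3) W(3)] that(4)])
  qed
qed

text \<open>The local field with the coordinates \<open>f\<close>, cut off and extended by zero.  Sections, brackets and
  connections are formed with global fields only, so local frames enter through these extensions.\<close>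

definition bump_field :: "('a, 'e) chart \<Rightarrow> 'e set \<Rightarrow> 'e \<Rightarrow> real \<Rightarrow> ('e \<Rightarrow> 'e) \<Rightarrow> 'a \<Rightarrow> 'e" where
  "bump_field c T x0 r f q =
     (if q \<in> cdom c \<and> cmap c q \<in> T then bump x0 r (cmap c q) *\<^sub>R coord_vec A c (f (cmap c q)) q else 0)"

lemma bump_field_coords:
  assumes "c \<in> A" "T \<subseteq> cimg c" "x \<in> T"
  shows "vf_coords A c (bump_field c T x0 r f) x = bump x0 r x *\<^sub>R f x"
proof -
  have x: "x \<in> cimg c" using assms(2,3) by blast
  have q: "cinv c x \<in> cdom c" "cmap c (cinv c x) = x" by (rule cinv_in[OF assms(1) x], rule cmap_cinv[OF assms(1) x])
  then show ?thesis
    unfolding vf_coords_def bump_field_def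
    using assms(3) by (simp add: linear_scale[OF dchart_linear[OF assms(1)]] dchart_coord_vec[OF assms(1)])
qed

end

text \<open>The support is contained in a compact set, which is closed since the manifold is Hausdorff; so the field is
  smooth outside the chart, too.\<close>

lemma bump_field_smooth:
  fixes A :: "('a::t2_space, 'e::euclidean_space) chart set"
  assumes A: "smooth_manifold A" and c: "c \<in> A" and T: "open T" "T \<subseteq> cimg c" and r: "0 \<le> r" "cball x0 r \<subseteq> T"
    and f: "smooth_on T f"
  shows "smooth_manifold.bump_field A c T x0 r f \<in> vector_fields A"
proof -
  interpret smooth_manifold A by (rule A)
  let ?Y = "bump_field c T x0 r f"
  let ?K = "cinv c ` cball x0 r"
  have "compact ?K"
    by (rule compact_continuous_image[OF continuous_on_subset[OF homeomorphism_cont2[OF chart_homeo[OF c]]] compact_cball])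
      (use r T in blast)
  then have cl: "open (- ?K)" using compact_imp_closed open_Compl by blast
  have zero: "?Y q = 0" if "q \<in> - ?K" for q
  proof (cases "q \<in> cdom c \<and> cmap c q \<in> T")
    case True
    have "cmap c q \<notin> cball x0 r" using that cinv_cmap[OF c, of q] True by (metis ComplD imageI)
    from bump_zero[OF r(1) this] show ?thesis unfolding bump_field_def by simp
  qed (auto simp: bump_field_def)
  show ?thesis
  proof (rule vector_fields_onI)
    fix p
    show "\<exists>d S. d \<in> A \<and> p \<in> cdom d \<and> open S \<and> p \<in> S \<and> smooth_on (cmap d ` (cdom d \<inter> S)) (vf_coords A d ?Y)"
    proof (cases "p \<in> ?K")
      case True
      then obtain x where x: "x \<in> cball x0 r" "p = cinv c x" by blast
      have xT: "x \<in> T" using x r by blast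
      have pc: "p \<in> cdom c" "cmap c p = x" using cinv_in[OF c] cmap_cinv[OF c] xT T x(2) by auto
      let ?S = "cdom c \<inter> cmap c -` T"
      have oS: "open ?S" by (rule continuous_open_preimage[OF homeomorphism_cont1[OF chart_homeo[OF c]] open_cdom[OF c] T(1)])
      have "smooth_on T (\<lambda>x. bump x0 r x *\<^sub>R f x)" by (rule smooth_on_scaleR[OF T(1) smooth_bump[OF T(1)] f])
      then have sT: "smooth_on T (vf_coords A c ?Y)"
        by (rule smooth_on_cong[OF T(1), rotated]) (rule bump_field_coords[OF c T(2), symmetric])
      have "smooth_on (cmap c ` (cdom c \<inter> ?S)) (vf_coords A c ?Y)"
        by (rule smooth_on_subset[OF sT]) auto
      then show ?thesis using c pc oS xT by blast
    next
      case False
      let ?d = "chart_at A p"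
      have o: "open (cmap ?d ` (cdom ?d \<inter> - ?K))" by (rule open_cmap_image[OF chart_at(1) cl])
      have "smooth_on (cmap ?d ` (cdom ?d \<inter> - ?K)) (vf_coords A ?d ?Y)"
      proof (rule smooth_on_cong[OF o _ smooth_on_const[of _ 0]])
        fix x assume "x \<in> cmap ?d ` (cdom ?d \<inter> - ?K)"
        then obtain q where q: "q \<in> cdom ?d" "q \<in> - ?K" "x = cmap ?d q" by blast
        show "0 = vf_coords A ?d ?Y x"
          unfolding q(3) vf_coords_at[OF chart_at(1) q(1)] zero[OF q(2)] linear_0[OF dchart_linear[OF chart_at(1) q(1)]] ..
      qed
      then show ?thesis using chart_at[of p] cl False by blast
    qed
  qed
qed

lemma adapted_frame_subset:
  assumes "adapted_frame E T D a" "S \<subseteq> T"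
  shows "adapted_frame E S D a"
  unfolding adapted_frame_def
proof (intro conjI ballI)
  show "E \<subseteq> Basis" using assms(1) by (simp add: adapted_frame_def)
  show "smooth_on S (a b)" if "b \<in> E" for b
    by (rule smooth_on_subset[OF _ assms(2)]) (use assms(1) that in \<open>simp add: adapted_frame_def\<close>)
  fix x assume "x \<in> S"
  then have "x \<in> T" using assms(2) by blast
  then have x: "subspace (D x)" "\<forall>b\<in>E. a b x \<in> D x \<and> (\<forall>c\<in>E. a b x \<bullet> c = (if b = c then 1 else 0))"
    "\<forall>v\<in>D x. (\<forall>b\<in>E. v \<bullet> b = 0) \<longrightarrow> v = 0"
    using assms(1) unfolding adapted_frame_def by blast+
  show "subspace (D x)" by (rule x(1))
  show "a b x \<in> D x" if "b \<in> E" for b using x(2) that by blast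
  show "a b x \<bullet> c = (if b = c then 1 else 0)" if "b \<in> E" "c \<in> E" for b c using x(2) that by blast
  show "(\<forall>b\<in>E. v \<bullet> b = 0) \<longrightarrow> v = 0" if "v \<in> D x" for v using x(3) that by blast
qed

lemma distribution_subspace: "distribution A D \<Longrightarrow> subspace (D p)"
proof -
  assume "distribution A D"
  then obtain U k and X :: "nat \<Rightarrow> 'a \<Rightarrow> 'b" where "p \<in> U" "\<forall>q\<in>U. D q = span ((\<lambda>i. X i q) ` {..<k}) \<and> dim (D q) = k"
    unfolding distribution_def by metis
  then show ?thesis by (metis subspace_span)
qed

lemma Basis_subset_expansion:
  fixes w :: "'e::euclidean_space"
  assumes "E \<subseteq> Basis" "\<And>b. b \<in> Basis - E \<Longrightarrow> w \<bullet> b = 0"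
  shows "w = (\<Sum>b\<in>E. (w \<bullet> b) *\<^sub>R b)"
  by (rule euclidean_eqI) (use assms in \<open>auto simp: Basis_combination_inner[OF assms(1)]\<close>)

lemma bump_field_section:
  fixes A :: "('a::t2_space, 'e::euclidean_space) chart set"
  assumes A: "smooth_manifold A" and c: "c \<in> A" and T: "open T" "T \<subseteq> cimg c" and r: "0 \<le> r" "cball x0 r \<subseteq> T"
    and f: "smooth_on T f" and D: "distribution A D" and fD: "\<And>x. x \<in> T \<Longrightarrow> f x \<in> smooth_manifold.coord_dist A c D x"
  shows "smooth_manifold.bump_field A c T x0 r f \<in> sections_in (vector_fields A) D"
proof -
  interpret smooth_manifold A by (rule A)
  have "bump_field c T x0 r f q \<in> D q" for q
  proof (cases "q \<in> cdom c \<and> cmap c q \<in> T")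
    case True
    then have "coord_vec A c (f (cmap c q)) q \<in> D q" using coord_vec_in_iff[OF c] fD by blast
    then show ?thesis using True subspace_scale[OF distribution_subspace[OF D]] by (simp add: bump_field_def)
  next
    case False
    then have "bump_field c T x0 r f q = 0" unfolding bump_field_def by (rule if_not_P)
    then show ?thesis using subspace_0[OF distribution_subspace[OF D]] by simp
  qed
  then show ?thesis unfolding sections_in_def using bump_field_smooth[OF A c T r f] by blast
qed

text \<open>Involutivity is assumed for global sections.  It is passed to an adapted frame \<open>a\<close> by means of the cut-off
  fields \<open>\<beta> a\<^sub>b\<close>: the bracket of two of them is \<open>\<beta>\<^sup>2 [a\<^sub>b, a\<^sub>d]\<close> up to a combination of \<open>a\<^sub>b\<close> and \<open>a\<^sub>d\<close>, and \<open>\<beta>\<close> is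
  positive near the given point.  The straightening diffeomorphism then becomes a slice chart.\<close>

theorem frobenius:
  fixes A :: "('a::t2_space, 'e::euclidean_space) chart set"
  assumes A: "smooth_structure A" and D: "distribution A D"
    and inv: "\<And>X Y p. X \<in> sections_in (vector_fields A) D \<Longrightarrow> Y \<in> sections_in (vector_fields A) D \<Longrightarrow> lie_bracket A X Y p \<in> D p"
  shows "integrable_distribution A D"
proof -
  interpret smooth_manifold A by unfold_locales (rule A)
  have M: "smooth_manifold A" by unfold_locales
  have "\<exists>S. p \<in> S \<and> integral_manifold A D S" for p
  proof -
    obtain c where c: "c \<in> A" "p \<in> cdom c" using chart_at by blast
    obtain E T a where T: "open T" "cmap c p \<in> T" "T \<subseteq> cimg c" and a: "adapted_frame E T (coord_dist c D) a"
      by (rule distribution_adapted_frame[OF D c]) (rule that)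
    define x0 where "x0 = cmap c p"
    have x0: "x0 \<in> T" using T(2) by (simp add: x0_def)
    obtain r where r: "0 < r" "cball x0 r \<subseteq> T" using T(1) x0 open_contains_cball by blast
    let ?B = "ball x0 r"
    have BT: "x \<in> T" if "x \<in> ?B" for x using that r by auto
    have E: "E \<subseteq> Basis" and sa: "\<And>b. b \<in> E \<Longrightarrow> smooth_on T (a b)"
      and aD: "\<And>b x. b \<in> E \<Longrightarrow> x \<in> T \<Longrightarrow> a b x \<in> coord_dist c D x"
      and sD: "\<And>x. x \<in> T \<Longrightarrow> subspace (coord_dist c D x)"
      using a unfolding adapted_frame_def by auto
    have aB: "adapted_frame E ?B (coord_dist c D) a"
      by (rule adapted_frame_subset[OF a]) (use BT in blast)
    have Y: "bump_field c T x0 r (a b) \<in> sections_in (vector_fields A) D" if "b \<in> E" for b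
      by (rule bump_field_section[OF M c(1) T(1,3) less_imp_le[OF r(1)] r(2) sa[OF that] D aD[OF that]])
    have invc: "ddir (a b x) (a d) x - ddir (a d x) (a b) x \<in> coord_dist c D x" if b: "b \<in> E" and d: "d \<in> E" and x: "x \<in> ?B" for b d x
    proof -
      let ?q = "cinv c x" and ?\<beta> = "bump x0 r"
      have xT: "x \<in> T" by (rule BT[OF x])
      have xc: "x \<in> cimg c" using xT T(3) by blast
      have q: "?q \<in> cdom c" "cmap c ?q = x" by (rule cinv_in[OF c(1) xc], rule cmap_cinv[OF c(1) xc])
      let ?Y = "\<lambda>b. bump_field c T x0 r (a b)"
      have Yv: "?Y b \<in> vector_fields A" if "b \<in> E" for b using Y[OF that] by (simp add: sections_in_def)
      have Yc: "vf_coords A c (?Y b) y = ?\<beta> y *\<^sub>R a b y" if "y \<in> T" for b y by (rule bump_field_coords[OF c(1) T(3) that])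
      have lin: "linear (frechet_derivative (a b) (at x))" if "b \<in> E" for b
        by (rule has_derivative_linear[OF smooth_on_has_derivative[OF sa[OF that] xT]])
      have dY: "ddir v (vf_coords A c (?Y b)) x = ?\<beta> x *\<^sub>R ddir v (a b) x + ddir v ?\<beta> x *\<^sub>R a b x" if "b \<in> E" for v b
      proof -
        have "ddir v (vf_coords A c (?Y b)) x = ddir v (\<lambda>y. ?\<beta> y *\<^sub>R a b y) x"
          using frechet_derivative_cong_open[OF T(1) xT, of "vf_coords A c (?Y b)" "\<lambda>y. ?\<beta> y *\<^sub>R a b y"] Yc by simp
        also have "\<dots> = ?\<beta> x *\<^sub>R ddir v (a b) x + ddir v ?\<beta> x *\<^sub>R a b x"
          by (rule ddir_eq[OF has_derivative_scaleR[OF smooth_on_has_derivative[OF smooth_bump[OF T(1)] xT]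
                smooth_on_has_derivative[OF sa[OF that] xT]]])
        finally show ?thesis .
      qed
      have "dchart A c ?q (lie_bracket A (?Y b) (?Y d) ?q) \<in> coord_dist c D x"
        using coord_dist_iff[OF c(1) q(1)] inv[OF Y[OF b] Y[OF d]] q(2) by simp
      also have "dchart A c ?q (lie_bracket A (?Y b) (?Y d) ?q)
          = ddir (?\<beta> x *\<^sub>R a b x) (vf_coords A c (?Y d)) x - ddir (?\<beta> x *\<^sub>R a d x) (vf_coords A c (?Y b)) x"
        using dchart_lie_bracket[OF c(1) q(1) open_UNIV UNIV_I Yv[OF b] Yv[OF d]] unfolding q(2) Yc[OF xT] .
      also have "\<dots> = (?\<beta> x * ?\<beta> x) *\<^sub>R (ddir (a b x) (a d) x - ddir (a d x) (a b) x)
          + (ddir (?\<beta> x *\<^sub>R a b x) ?\<beta> x *\<^sub>R a d x - ddir (?\<beta> x *\<^sub>R a d x) ?\<beta> x *\<^sub>R a b x)"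
        unfolding dY[OF b] dY[OF d] linear_scale[OF lin[OF b]] linear_scale[OF lin[OF d]] by (simp add: algebra_simps)
      finally have s: "(?\<beta> x * ?\<beta> x) *\<^sub>R (ddir (a b x) (a d) x - ddir (a d x) (a b) x)
          + (ddir (?\<beta> x *\<^sub>R a b x) ?\<beta> x *\<^sub>R a d x - ddir (?\<beta> x *\<^sub>R a d x) ?\<beta> x *\<^sub>R a b x) \<in> coord_dist c D x" .
      have "ddir (?\<beta> x *\<^sub>R a b x) ?\<beta> x *\<^sub>R a d x - ddir (?\<beta> x *\<^sub>R a d x) ?\<beta> x *\<^sub>R a b x \<in> coord_dist c D x"
        by (intro subspace_diff[OF sD[OF xT]] subspace_scale[OF sD[OF xT]] aD b d xT)
      from subspace_diff[OF sD[OF xT] s this]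
      have "(?\<beta> x * ?\<beta> x) *\<^sub>R (ddir (a b x) (a d) x - ddir (a d x) (a b) x) \<in> coord_dist c D x" by simp
      from subspace_scale[OF sD[OF xT] this, of "1 / (?\<beta> x * ?\<beta> x)"] show ?thesis
        using bump_pos[OF x] by simp
    qed
    have xB: "x0 \<in> ?B" using r by simp
    obtain U V \<Phi> \<Psi> where F: "open U" "open V" "x0 \<in> V" "V \<subseteq> ?B" "homeomorphism U V \<Phi> \<Psi>"
      "smooth_on U \<Phi>" "smooth_on V \<Psi>" "\<And>b x. b \<in> E \<Longrightarrow> x \<in> U \<Longrightarrow> ddir b \<Phi> x = a b (\<Phi> x)"
      "\<And>x. x \<in> U \<Longrightarrow> inj (frechet_derivative \<Phi> (at x))"
    proof (rule frobenius_coordinates[OF open_ball xB aB])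
      show "ddir (a b x) (a d) x - ddir (a d x) (a b) x \<in> coord_dist c D x" if "b \<in> E" "d \<in> E" "x \<in> ?B" for b d x
        by (rule invc[OF that])
    qed (rule that)
    have Vc: "V \<subseteq> cimg c" using F(4) BT T(3) by blast
    let ?d = "(cinv c ` V, \<Psi> \<circ> cmap c)"
    note d = reparametrized_chart[OF c(1) F(2) Vc F(1,5,6,7)]
    have PV: "\<Phi> y \<in> V" if "y \<in> U" for y using homeomorphism_image1[OF F(5)] that by blast
    have pd: "p \<in> cdom ?d" using F(3) cinv_cmap[OF c] by (force simp: x0_def)
    define y0 where "y0 = cmap ?d p"
    define S where "S = {q \<in> cdom ?d. \<forall>b\<in>Basis - E. cmap ?d q \<bullet> b = y0 \<bullet> b}"
    have pS: "p \<in> S" using pd by (simp add: S_def y0_def)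
    have sl: "slice_chart A S ?d E"
      unfolding slice_chart_def
    proof (intro conjI d(1) E exI[of _ y0])
      show "cmap ?d ` (cdom ?d \<inter> S) = {x \<in> cimg ?d. \<forall>b\<in>Basis - E. x \<bullet> b = y0 \<bullet> b}"
        unfolding S_def by blast
    qed
    have tan: "slice_tangent A ?d E q = D q" if "q \<in> S" for q
    proof -
      have qd: "q \<in> cdom ?d" using that by (simp add: S_def)
      define x where "x = cmap ?d q"
      have x: "x \<in> U" using qd d(3) unfolding x_def by blast
      have qx: "q = cinv c (\<Phi> x)" using cinv_cmap[OF d(1) qd] d(2)[OF x] by (simp add: x_def)
      have FT: "\<Phi> x \<in> T" using PV[OF x] F(4) BT by blast
      have Fc: "\<Phi> x \<in> cimg c" using PV[OF x] Vc by blast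
      have qc: "q \<in> cdom c" "cmap c q = \<Phi> x" unfolding qx using cinv_in[OF c(1) Fc] cmap_cinv[OF c(1) Fc] by simp_all
      have lin: "linear (frechet_derivative \<Phi> (at x))" by (rule has_derivative_linear[OF smooth_on_has_derivative[OF F(6) x]])
      have comb: "frechet_derivative \<Phi> (at x) (\<Sum>b\<in>E. r b *\<^sub>R b) = (\<Sum>b\<in>E. r b *\<^sub>R a b (\<Phi> x))" for r
        unfolding linear_sum[OF lin] linear_scale[OF lin] by (rule sum.cong[OF refl]) (simp only: F(8)[OF _ x])
      have "v \<in> slice_tangent A ?d E q \<longleftrightarrow> v \<in> D q" for v
      proof -
        let ?w = "dchart A ?d q v"
        have dc: "dchart A c q v = frechet_derivative \<Phi> (at x) ?w"
          unfolding qx by (rule dchart_reparametrized[OF c(1) F(2) Vc F(1,5,6,7) x])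
        have "(\<forall>b\<in>Basis - E. ?w \<bullet> b = 0) \<longleftrightarrow> frechet_derivative \<Phi> (at x) ?w \<in> coord_dist c D (\<Phi> x)"
        proof
          assume z: "\<forall>b\<in>Basis - E. ?w \<bullet> b = 0"
          have w: "?w = (\<Sum>b\<in>E. (?w \<bullet> b) *\<^sub>R b)" by (rule Basis_subset_expansion[OF E]) (use z in blast)
          have "frechet_derivative \<Phi> (at x) ?w = (\<Sum>b\<in>E. (?w \<bullet> b) *\<^sub>R a b (\<Phi> x))"
            by (subst w) (rule comb)
          also have "\<dots> \<in> coord_dist c D (\<Phi> x)"
            by (intro subspace_sum[OF sD[OF FT]] subspace_scale[OF sD[OF FT]] aD FT)
          finally show "frechet_derivative \<Phi> (at x) ?w \<in> coord_dist c D (\<Phi> x)" .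
        next
          assume "frechet_derivative \<Phi> (at x) ?w \<in> coord_dist c D (\<Phi> x)"
          from adapted_frame_representation[OF a FT this]
          have "frechet_derivative \<Phi> (at x) ?w = frechet_derivative \<Phi> (at x) (\<Sum>b\<in>E. (frechet_derivative \<Phi> (at x) ?w \<bullet> b) *\<^sub>R b)"
            by (simp only: comb)
          then have w: "?w = (\<Sum>b\<in>E. (frechet_derivative \<Phi> (at x) ?w \<bullet> b) *\<^sub>R b)" by (rule injD[OF F(9)[OF x]])
          show "\<forall>b\<in>Basis - E. ?w \<bullet> b = 0"
          proof
            fix b assume "b \<in> Basis - E"
            then show "?w \<bullet> b = 0" by (subst w) (simp add: Basis_combination_inner[OF E])
          qed
        qed
        also have "frechet_derivative \<Phi> (at x) ?w \<in> coord_dist c D (\<Phi> x) \<longleftrightarrow> v \<in> D q"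
          using coord_dist_iff[OF c(1) qc(1), of v D] unfolding qc(2) dc .
        finally show ?thesis unfolding slice_tangent_def by simp
      qed
      then show ?thesis by blast
    qed
    have "integral_manifold A D S"
      unfolding integral_manifold_def
    proof (intro conjI ballI exI)
      show "S \<noteq> {}" using pS by blast
      fix q assume q: "q \<in> S"
      then show "q \<in> cdom ?d" by (simp add: S_def)
      show "slice_chart A S ?d E" by (rule sl)
      show "slice_tangent A ?d E q = D q" by (rule tan[OF q])
    qed
    then show ?thesis using pS by blast
  qed
  then show ?thesis unfolding integrable_distribution_def using D by blast
qed

text \<open>In a slice chart sections of \<open>D\<close> have no coordinates outside \<open>E\<close> at the points of the slice.  Differentiating
  this along the slice, which is the direction of the other section, gives the same for the bracket.\<close>

theorem integrable_imp_involutive: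
  fixes A :: "('a::topological_space, 'e::euclidean_space) chart set"
  assumes A: "smooth_structure A" and D: "integrable_distribution A D"
    and X: "X \<in> sections_in (vector_fields A) D" and Y: "Y \<in> sections_in (vector_fields A) D"
  shows "lie_bracket A X Y p \<in> D p"
proof -
  interpret smooth_manifold A by unfold_locales (rule A)
  obtain S where pS: "p \<in> S" and S: "integral_manifold A D S" using D unfolding integrable_distribution_def by blast
  obtain c E where c: "p \<in> cdom c" "slice_chart A S c E" "slice_tangent A c E p = D p"
    using S pS unfolding integral_manifold_def by blast
  have cA: "c \<in> A" and E: "E \<subseteq> Basis" using c(2) by (auto simp: slice_chart_def)
  obtain a where a: "cmap c ` (cdom c \<inter> S) = {x \<in> cimg c. \<forall>b\<in>Basis - E. x \<bullet> b = a \<bullet> b}"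
    using c(2) unfolding slice_chart_def by blast
  have inS: "cinv c x \<in> S" if "x \<in> cimg c" "\<forall>b\<in>Basis - E. x \<bullet> b = a \<bullet> b" for x
  proof -
    have "x \<in> cmap c ` (cdom c \<inter> S)" using a that by blast
    then show ?thesis using cinv_cmap[OF cA] by auto
  qed
  \<comment> \<open>Each point \<open>q\<close> of \<open>S\<close> brings its own slice chart \<open>d\<close>, possibly with other directions \<open>E'\<close>.  In \<open>d\<close> the
    straight line from \<open>q\<close> in the direction \<open>Z q\<close> stays in \<open>S\<close>; read in \<open>c\<close>, it therefore has constant
    coordinates outside \<open>E\<close>.\<close>
  have tangent: "vf_coords A c Z (cmap c q) \<bullet> b = 0"
    if Z: "Z \<in> sections_in (vector_fields A) D" and q: "q \<in> S" "q \<in> cdom c" and b: "b \<in> Basis - E" for Z q b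
  proof -
    obtain d E' where d: "q \<in> cdom d" "slice_chart A S d E'" "slice_tangent A d E' q = D q"
      using S q(1) unfolding integral_manifold_def by blast
    have dA: "d \<in> A" using d(2) by (simp add: slice_chart_def)
    obtain a' where a': "cmap d ` (cdom d \<inter> S) = {x \<in> cimg d. \<forall>b\<in>Basis - E'. x \<bullet> b = a' \<bullet> b}"
      using d(2) unfolding slice_chart_def by blast
    have "Z q \<in> slice_tangent A d E' q" unfolding d(3) using Z by (simp add: sections_in_def)
    then have u0: "dchart A d q (Z q) \<bullet> b' = 0" if "b' \<in> Basis - E'" for b' using that by (simp add: slice_tangent_def)
    let ?u = "dchart A d q (Z q)" and ?W = "cmap d ` (cdom d \<inter> cdom c)"
    have "cmap d q \<in> cmap d ` (cdom d \<inter> S)" using q d by blast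
    then have qa: "cmap d q \<bullet> b' = a' \<bullet> b'" if "b' \<in> Basis - E'" for b' unfolding a' using that by blast
    have "frechet_derivative (cmap c \<circ> cinv d) (at (cmap d q)) ?u \<bullet> b = 0"
    proof (rule derivative_along_constant_line[OF transition_has_derivative[OF dA cA d(1) q(2)] open_cmap_image[OF dA open_cdom[OF cA]]])
      show "cmap d q \<in> ?W" using d q by blast
      fix t assume W: "cmap d q + t *\<^sub>R ?u \<in> ?W"
      let ?y = "cmap d q + t *\<^sub>R ?u"
      have "?y \<in> cimg d" using W by blast
      moreover have "\<forall>b'\<in>Basis - E'. ?y \<bullet> b' = a' \<bullet> b'" using qa u0 by (simp add: inner_add_left)
      ultimately have "?y \<in> cmap d ` (cdom d \<inter> S)" using a' by blast
      then obtain s where s: "s \<in> S" "s \<in> cdom d" "?y = cmap d s" by blast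
      have "s \<in> cdom c" using W s(2) cinv_cmap[OF dA] unfolding s(3) by (auto dest: arg_cong[where f = "cinv d"])
      then have "cmap c s \<in> cmap c ` (cdom c \<inter> S)" using s(1) by blast
      then have "cmap c s \<bullet> b = a \<bullet> b" unfolding a using b by blast
      then show "(cmap c \<circ> cinv d) ?y \<bullet> b = a \<bullet> b" unfolding s(3) by (simp add: cinv_cmap[OF dA s(2)])
    qed
    then show ?thesis unfolding vf_coords_at[OF cA q(2)] dchart_change[OF dA d(1) cA q(2)] .
  qed
  let ?x = "cmap c p"
  have xa: "?x \<bullet> b = a \<bullet> b" if "b \<in> Basis - E" for b
  proof -
    have "?x \<in> cmap c ` (cdom c \<inter> S)" using c(1) pS by blast
    then show ?thesis unfolding a using that by blast
  qed
  have XY: "X \<in> vector_fields A" "Y \<in> vector_fields A" using X Y by (simp_all add: sections_in_def)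
  have der: "ddir (vf_coords A c Z ?x) (vf_coords A c Z') ?x \<bullet> b = 0"
    if Z: "Z \<in> sections_in (vector_fields A) D" "Z' \<in> sections_in (vector_fields A) D" and b: "b \<in> Basis - E" for Z Z' b
  proof (rule derivative_along_constant_line[OF smooth_on_has_derivative[OF vector_fields_smooth[OF _ cA]] open_cimg[OF cA]])
    show "Z' \<in> vector_fields A" using Z(2) by (simp add: sections_in_def)
    show "?x \<in> cimg c" "?x \<in> cimg c" using c(1) by simp_all
    fix t assume W: "?x + t *\<^sub>R vf_coords A c Z ?x \<in> cimg c"
    let ?y = "?x + t *\<^sub>R vf_coords A c Z ?x"
    have "\<forall>b\<in>Basis - E. ?y \<bullet> b = a \<bullet> b" using xa tangent[OF Z(1) pS c(1)] by (simp add: inner_add_left)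
    then have "cinv c ?y \<in> S" using inS W by blast
    from tangent[OF Z(2) this cinv_in[OF cA W] b] show "vf_coords A c Z' ?y \<bullet> b = 0" by (simp only: cmap_cinv[OF cA W])
  qed
  have "dchart A c p (lie_bracket A X Y p) \<bullet> b = 0" if "b \<in> Basis - E" for b
    unfolding dchart_lie_bracket[OF cA c(1) open_UNIV UNIV_I XY] inner_diff_left der[OF X Y that] der[OF Y X that] by simp
  then have "lie_bracket A X Y p \<in> slice_tangent A c E p" by (simp add: slice_tangent_def)
  then show ?thesis unfolding c(3) .
qed

section \<open>Subbundles and their sections\<close>

text \<open>\<open>M x = R \<circ> T x + (id - R \<circ> T x0)\<close> with a right inverse \<open>R\<close> of \<open>T x0\<close> is near the identity and carries the
  kernel of \<open>T x\<close> onto that of \<open>T x0\<close>; so the inverse of \<open>M x\<close> transports a basis of the latter.\<close>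

lemma kernel_frame:
  fixes T :: "'e::euclidean_space \<Rightarrow> 'e \<Rightarrow> 'w::euclidean_space"
  assumes W: "open W" "x0 \<in> W" and lin: "\<And>x. x \<in> W \<Longrightarrow> linear (T x)" and sm: "\<And>v. smooth_on W (\<lambda>x. T x v)"
    and rng: "\<And>x v. x \<in> W \<Longrightarrow> T x v \<in> range (T x0)"
  obtains S k and \<zeta> :: "nat \<Rightarrow> 'e \<Rightarrow> 'e" where "open S" "x0 \<in> S" "S \<subseteq> W" "\<And>i. i < k \<Longrightarrow> smooth_on S (\<zeta> i)"
    "\<And>x. x \<in> S \<Longrightarrow> {v. T x v = 0} = span ((\<lambda>i. \<zeta> i x) ` {..<k}) \<and> dim {v. T x v = 0} = k"
proof -
  have lin0: "linear (T x0)" by (rule lin[OF W(2)])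
  obtain R where R: "linear R" "\<And>v. v \<in> range (T x0) \<Longrightarrow> T x0 (R v) = v"
    using linear_exists_right_inverse_on[OF lin0 subspace_UNIV] by auto
  define M where "M x v = R (T x v) + (v - R (T x0 v))" for x v
  have linM: "linear (M x)" if "x \<in> W" for x
    unfolding M_def
    by (intro linear_compose_add linear_compose_sub linear_ident
        linear_compose[OF lin[OF that] R(1), unfolded o_def] linear_compose[OF lin0 R(1), unfolded o_def])
  have smM: "smooth_on W (\<lambda>x. M x v)" for v
    unfolding M_def by (intro smooth_on_add smooth_on_const W(1) smooth_on_linear[OF R(1) W(1) sm])
  \<comment> \<open>\<open>M x\<close> carries the kernel of \<open>T x\<close> to the kernel of \<open>T x0\<close>.\<close>
  have TM: "T x0 (M x v) = T x v" if "x \<in> W" for x v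
  proof -
    have "T x0 (M x v) = T x0 (R (T x v)) + (T x0 v - T x0 (R (T x0 v)))"
      unfolding M_def by (simp only: linear_add[OF lin0] linear_diff[OF lin0])
    also have "\<dots> = T x v" using R(2)[OF rng[OF that]] R(2)[of "T x0 v"] by simp
    finally show ?thesis .
  qed
  have "M x0 = id" by (simp add: M_def fun_eq_iff)
  then have inj0: "inj (M x0)" by simp
  obtain S where S: "open S" "x0 \<in> S" "S \<subseteq> W" "\<And>x. x \<in> S \<Longrightarrow> inj (M x)"
    using injective_near[OF W linM Ck_on_continuous[OF smooth_onD[OF smM]] inj0] by blast
  have SW: "x \<in> W" if "x \<in> S" for x using that S(3) by blast
  let ?K = "{v. T x0 v = 0}"
  have sK: "subspace ?K" by (rule linear_subspace_kernel[OF lin0])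
  obtain B where B: "B \<subseteq> ?K" "independent B" "?K \<subseteq> span B" "card B = dim ?K" using basis_exists by blast
  have fB: "finite B" by (rule independent_imp_finite[OF B(2)])
  obtain e where e: "bij_betw e {..<card B} B" using bij_betw_from_nat_into_finite[OF fB] by blast
  have KB: "?K = span B" using B(3) span_minimal[OF B(1) sK] by blast
  define \<zeta> where "\<zeta> i x = inv (M x) (e i)" for i x
  show thesis
  proof (rule that[OF S(1-3)])
    show "smooth_on S (\<zeta> i)" for i
      unfolding \<zeta>_def[abs_def]
      by (rule linear_family_inverse[OF S(1) linM[OF SW] smooth_on_subset[OF smM S(3)] S(4)])
    fix x assume x: "x \<in> S"
    have surj: "surj (M x)" by (rule linear_injective_imp_surjective[OF linM[OF SW[OF x]] S(4)[OF x]]) (rule refl)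
    have bij: "bij (M x)" using surj S(4)[OF x] by (simp add: bij_def)
    obtain N where N: "linear N" "N \<circ> M x = id" using linear_injective_left_inverse[OF linM[OF SW[OF x]] S(4)[OF x]] by blast
    have Ninv: "inv (M x) w = N w" for w
      using fun_cong[OF N(2), of "inv (M x) w"] by (simp add: surj_f_inv_f[OF surj])
    have injN: "inj N"
    proof (rule injI)
      fix v w assume "N v = N w"
      then have "M x (inv (M x) v) = M x (inv (M x) w)" by (simp only: Ninv)
      then show "v = w" by (simp only: surj_f_inv_f[OF surj])
    qed
    have "{v. T x v = 0} = N ` ?K"
    proof (intro equalityI subsetI)
      fix v assume "v \<in> {v. T x v = 0}"
      then have "M x v \<in> ?K" using TM[OF SW[OF x], of v] by simp
      moreover have "v = N (M x v)" using fun_cong[OF N(2), of v] by simp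
      ultimately show "v \<in> N ` ?K" by blast
    next
      fix v assume "v \<in> N ` ?K"
      then obtain w where w: "T x0 w = 0" "v = N w" by blast
      then have "M x v = w" by (simp only: Ninv[symmetric] surj_f_inv_f[OF surj])
      then show "v \<in> {v. T x v = 0}" using TM[OF SW[OF x], of v] w(1) by simp
    qed
    moreover have "N ` ?K = span ((\<lambda>i. \<zeta> i x) ` {..<card B})"
    proof -
      have "(\<lambda>i. \<zeta> i x) ` {..<card B} = N ` (e ` {..<card B})"
        unfolding \<zeta>_def Ninv image_image ..
      also have "e ` {..<card B} = B" by (rule bij_betw_imp_surj_on[OF e])
      finally show ?thesis unfolding KB by (simp only: linear_span_image[OF N(1)])
    qed
    moreover have "dim (N ` ?K) = card B"
      unfolding B(4) by (rule dim_image_eq[OF N(1) inj_on_subset[OF injN subset_UNIV]])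
    ultimately show "{v. T x v = 0} = span ((\<lambda>i. \<zeta> i x) ` {..<card B}) \<and> dim {v. T x v = 0} = card B" by (simp only:)
  qed
qed

context smooth_manifold begin

lemma distributionI_coords:
  assumes "\<And>p. \<exists>c W k \<zeta>. c \<in> A \<and> p \<in> cdom c \<and> open W \<and> cmap c p \<in> W \<and> W \<subseteq> cimg c \<and>
    (\<forall>i<(k::nat). smooth_on W (\<zeta> i)) \<and>
    (\<forall>x\<in>W. coord_dist c D x = span ((\<lambda>i. \<zeta> i x) ` {..<k}) \<and> dim (coord_dist c D x) = k)"
  shows "distribution A D"
  unfolding distribution_def
proof
  fix p
  obtain c W k \<zeta> where c: "c \<in> A" "p \<in> cdom c" and W: "open W" "cmap c p \<in> W" "W \<subseteq> cimg c"
    and sm: "\<And>i. i < k \<Longrightarrow> smooth_on W (\<zeta> i)"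
    and sp: "\<And>x. x \<in> W \<Longrightarrow> coord_dist c D x = span ((\<lambda>i. \<zeta> i x) ` {..<(k::nat)}) \<and> dim (coord_dist c D x) = k"
    using assms[of p] by metis
  define U where "U = cdom c \<inter> cmap c -` W"
  have oU: "open U" unfolding U_def
    by (rule continuous_open_preimage[OF homeomorphism_cont1[OF chart_homeo[OF c(1)]] open_cdom[OF c(1)] W(1)])
  have pU: "p \<in> U" using c W by (simp add: U_def)
  define X where "X i q = coord_vec A c (\<zeta> i (cmap c q)) q" for i q
  have cU: "cmap c ` (cdom c \<inter> U) = W" unfolding U_def cmap_image_eq[OF c(1)] using W(3) cmap_cinv[OF c(1)] cinv_in[OF c(1)] by auto
  have Xc: "vf_coords A c (X i) x = \<zeta> i x" if "x \<in> W" for i x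
  proof -
    have x: "x \<in> cimg c" using that W(3) by blast
    show ?thesis unfolding vf_coords_def X_def cmap_cinv[OF c(1) x] by (rule dchart_coord_vec[OF c(1) cinv_in[OF c(1) x]])
  qed
  have "X i \<in> vector_fields_on A U" if "i < k" for i
  proof (rule vector_fields_onI)
    fix q assume q: "q \<in> U"
    have "smooth_on W (vf_coords A c (X i))"
      by (rule smooth_on_cong[OF W(1) _ sm[OF that]]) (rule Xc[symmetric])
    then have "smooth_on (cmap c ` (cdom c \<inter> U)) (vf_coords A c (X i))" unfolding cU .
    then show "\<exists>c T. c \<in> A \<and> q \<in> cdom c \<and> open T \<and> q \<in> T \<and> smooth_on (cmap c ` (cdom c \<inter> T)) (vf_coords A c (X i))"
      using c(1) oU q unfolding U_def by blast
  qed
  moreover have "D q = span ((\<lambda>i. X i q) ` {..<k}) \<and> dim (D q) = k" if "q \<in> U" for q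
  proof -
    have q: "q \<in> cdom c" "cmap c q \<in> W" using that by (auto simp: U_def)
    have lin: "linear (\<lambda>u. coord_vec A c u q)" by (rule coord_vec_linear[OF c(1) q(1)])
    have inj: "inj (\<lambda>u. coord_vec A c u q)" by (rule injI) (metis dchart_coord_vec[OF c(1) q(1)])
    have Dq: "D q = (\<lambda>u. coord_vec A c u q) ` coord_dist c D (cmap c q)"
      unfolding coord_dist_def cinv_cmap[OF c(1) q(1)] image_image coord_vec_dchart[OF c(1) q(1)] by simp
    have "D q = span ((\<lambda>u. coord_vec A c u q) ` (\<lambda>i. \<zeta> i (cmap c q)) ` {..<k})"
      unfolding linear_span_image[OF lin] using sp[OF q(2)] Dq by simp
    moreover have "dim (D q) = k"
    proof -
      have "dim (D q) = dim (coord_dist c D (cmap c q))"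
        unfolding Dq by (rule dim_image_eq[OF lin inj_on_subset[OF inj subset_UNIV]])
      also have "\<dots> = k" using sp[OF q(2)] by blast
      finally show ?thesis .
    qed
    ultimately show ?thesis unfolding image_image X_def by blast
  qed
  ultimately show "\<exists>U k X. open U \<and> p \<in> U \<and> (\<forall>i<k. X i \<in> vector_fields_on A U) \<and>
      (\<forall>q\<in>U. D q = span ((\<lambda>i. X i q) ` {..<k}) \<and> dim (D q) = k)"
    using oU pU by blast
qed

lemma endo_field_vector_field:
  assumes R: "endo_field A R" and X: "X \<in> vector_fields A"
  shows "(\<lambda>q. R q (X q)) \<in> vector_fields A"
  unfolding vector_fields_on_def
proof (intro CollectI ballI)
  fix c assume c: "c \<in> A"
  let ?L = "\<lambda>x u. dchart A c (cinv c x) (R (cinv c x) (coord_vec A c u (cinv c x)))"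
  have "smooth_on (cimg c) (\<lambda>x. ?L x (vf_coords A c X x))"
  proof (rule smooth_on_linear_family[where L = ?L, OF open_cimg[OF c] _ _ vector_fields_smooth[OF X c]])
    show "smooth_on (cimg c) (\<lambda>x. ?L x b)" for b using R c by (simp add: endo_field_def)
    fix x assume x: "x \<in> cimg c"
    have lR: "linear (R (cinv c x))" using R by (simp add: endo_field_def)
    show "linear (?L x)"
      using linear_compose[OF linear_compose[OF coord_vec_linear[OF c cinv_in[OF c x]] lR] dchart_linear[OF c cinv_in[OF c x]]]
      by (simp only: o_def)
  qed
  then have "smooth_on (cimg c) (vf_coords A c (\<lambda>q. R q (X q)))"
  proof (rule smooth_on_cong[OF open_cimg[OF c], rotated])
    fix x assume "x \<in> cimg c"
    then show "?L x (vf_coords A c X x) = vf_coords A c (\<lambda>q. R q (X q)) x"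
      unfolding vf_coords_def by (simp only: coord_vec_dchart[OF c cinv_in[OF c]])
  qed
  then show "smooth_on (cmap c ` (cdom c \<inter> UNIV)) (vf_coords A c (\<lambda>q. R q (X q)))" by simp
qed

end

text \<open>A constant combination of an adapted frame, cut off by a bump.  The coefficients are divided in
  advance by the value of the bump at \<open>p\<close>.\<close>

lemma section_through:
  fixes A :: "('a::t2_space, 'e::euclidean_space) chart set"
  assumes A: "smooth_structure A" and D: "distribution A D" and v: "v \<in> D p"
  obtains X where "X \<in> sections_in (vector_fields A) D" "X p = v"
proof -
  interpret smooth_manifold A by unfold_locales (rule A)
  have M: "smooth_manifold A" by unfold_locales
  obtain c where c: "c \<in> A" "p \<in> cdom c" using chart_at by blast
  obtain T E a where T: "open T" "cmap c p \<in> T" "T \<subseteq> cimg c" and a: "adapted_frame E T (coord_dist c D) a"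
    by (rule distribution_adapted_frame[OF D c]) (rule that)
  define x0 where "x0 = cmap c p"
  have x0: "x0 \<in> T" using T(2) by (simp add: x0_def)
  obtain r where r: "0 < r" "cball x0 r \<subseteq> T" using T(1) x0 open_contains_cball by blast
  have bp: "0 < bump x0 r x0" by (rule bump_pos) (use r in simp)
  define u where "u = (1 / bump x0 r x0) *\<^sub>R dchart A c p v"
  define f where "f x = (\<Sum>b\<in>E. (u \<bullet> b) *\<^sub>R a b x)" for x
  have sa: "\<And>b. b \<in> E \<Longrightarrow> smooth_on T (a b)" and aD: "\<And>b x. b \<in> E \<Longrightarrow> x \<in> T \<Longrightarrow> a b x \<in> coord_dist c D x"
    and sD: "\<And>x. x \<in> T \<Longrightarrow> subspace (coord_dist c D x)"
    using a unfolding adapted_frame_def by auto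
  have f: "smooth_on T f" unfolding f_def[abs_def] by (intro smooth_on_sum smooth_on_scaleR smooth_on_const T(1) sa)
  have fD: "f x \<in> coord_dist c D x" if "x \<in> T" for x
    unfolding f_def by (intro subspace_sum[OF sD[OF that]] subspace_scale[OF sD[OF that]] aD that)
  have "u \<in> coord_dist c D x0"
    unfolding u_def x0_def by (rule subspace_scale[OF sD[OF T(2)]]) (use coord_dist_iff[OF c] v in blast)
  then have "f x0 = u" unfolding f_def by (rule adapted_frame_representation[OF a x0, symmetric])
  then have "bump_field c T x0 r f p = bump x0 r x0 *\<^sub>R coord_vec A c u p"
    using c(2) x0 by (simp add: bump_field_def x0_def)
  also have "\<dots> = v"
    unfolding u_def using bp by (simp add: linear_scale[OF coord_vec_linear[OF c]] coord_vec_dchart[OF c])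
  finally show thesis
    by (intro that[of "bump_field c T x0 r f"] bump_field_section[OF M c(1) T(1,3) less_imp_le[OF r(1)] r(2) f D fD])
qed

section \<open>The differential of a smooth map\<close>

locale smooth_mapping = M: smooth_manifold A + N: smooth_manifold B
  for A :: "('a::topological_space, 'e::euclidean_space) chart set"
    and B :: "('b::topological_space, 'f::euclidean_space) chart set" +
  fixes F :: "'a \<Rightarrow> 'b"
  assumes smooth: "smooth_map A B F"
begin

lemma open_domain: "c \<in> A \<Longrightarrow> d \<in> B \<Longrightarrow> open (cmap c ` (cdom c \<inter> F -` cdom d))"
proof (rule M.open_cmap_image)
  show "d \<in> B \<Longrightarrow> open (F -` cdom d)"
    using open_vimage[OF N.open_cdom, of d F] smooth by (simp add: smooth_map_def)
qed

lemma coords_smooth: "c \<in> A \<Longrightarrow> d \<in> B \<Longrightarrow> smooth_on (cmap c ` (cdom c \<inter> F -` cdom d)) (cmap d \<circ> F \<circ> cinv c)"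
  using smooth by (simp add: smooth_map_def)

lemma coords_has_derivative:
  assumes "c \<in> A" "p \<in> cdom c" "d \<in> B" "F p \<in> cdom d"
  shows "((cmap d \<circ> F \<circ> cinv c) has_derivative frechet_derivative (cmap d \<circ> F \<circ> cinv c) (at (cmap c p))) (at (cmap c p))"
  by (rule smooth_on_has_derivative[OF coords_smooth[OF assms(1,3)]]) (use assms in blast)

lemma differential_coords:
  assumes c: "c \<in> A" "p \<in> cdom c" and d: "d \<in> B" "F p \<in> cdom d"
  shows "dchart B d (F p) (differential A B F p v) = frechet_derivative (cmap d \<circ> F \<circ> cinv c) (at (cmap c p)) (dchart A c p v)"
proof -
  let ?c = "chart_at A p" and ?d = "chart_at B (F p)"
  note c0 = M.chart_at[of p] and d0 = N.chart_at[of "F p"]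
  have e: "(cmap ?d \<circ> F \<circ> cinv ?c) (cmap ?c p) = cmap ?d (F p)" by (simp add: M.cinv_cmap[OF c0])
  have "((cmap d \<circ> cinv ?d) \<circ> (cmap ?d \<circ> F \<circ> cinv ?c) has_derivative
      frechet_derivative (cmap d \<circ> cinv ?d) (at (cmap ?d (F p))) \<circ> frechet_derivative (cmap ?d \<circ> F \<circ> cinv ?c) (at (cmap ?c p))) (at (cmap ?c p))"
    by (rule diff_chain_at[OF coords_has_derivative[OF c0 d0]])
      (simp only: e N.transition_has_derivative[OF d0(1) d(1) d0(2) d(2)])
  then have 1: "(cmap d \<circ> F \<circ> cinv ?c has_derivative
      frechet_derivative (cmap d \<circ> cinv ?d) (at (cmap ?d (F p))) \<circ> frechet_derivative (cmap ?d \<circ> F \<circ> cinv ?c) (at (cmap ?c p))) (at (cmap ?c p))"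
  proof (rule has_derivative_transform_within_open[OF _ open_domain[OF c0(1) d0(1)]])
    show "cmap ?c p \<in> cmap ?c ` (cdom ?c \<inter> F -` cdom ?d)" using c0 d0 by blast
    fix x assume "x \<in> cmap ?c ` (cdom ?c \<inter> F -` cdom ?d)"
    then obtain q where q: "q \<in> cdom ?c" "F q \<in> cdom ?d" "x = cmap ?c q" by blast
    show "((cmap d \<circ> cinv ?d) \<circ> (cmap ?d \<circ> F \<circ> cinv ?c)) x = (cmap d \<circ> F \<circ> cinv ?c) x"
      unfolding q(3) by (simp add: M.cinv_cmap[OF c0(1) q(1)] N.cinv_cmap[OF d0(1) q(2)])
  qed
  have 2: "(cmap d \<circ> F \<circ> cinv ?c has_derivative
      (\<lambda>v. frechet_derivative (cmap d \<circ> F \<circ> cinv c) (at (cmap c p)) (frechet_derivative (cmap c \<circ> cinv ?c) (at (cmap ?c p)) v))) (at (cmap ?c p))"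
    by (rule M.transition_chain[OF c0 c coords_has_derivative[OF c d]])
  have "dchart B d (F p) (differential A B F p v)
      = (frechet_derivative (cmap d \<circ> cinv ?d) (at (cmap ?d (F p))) \<circ> frechet_derivative (cmap ?d \<circ> F \<circ> cinv ?c) (at (cmap ?c p))) v"
    unfolding dchart_def differential_def by (rule o_apply[symmetric])
  also have "\<dots> = frechet_derivative (cmap d \<circ> F \<circ> cinv c) (at (cmap c p)) (dchart A c p v)"
    using fun_cong[OF has_derivative_unique[OF 1 2], of v] unfolding dchart_def .
  finally show ?thesis .
qed

lemma zero_section: "(\<lambda>q. 0) \<in> pullback_sections A B F"
  unfolding pullback_sections_def
proof (intro CollectI ballI)
  fix c d assume c: "c \<in> A" and d: "d \<in> B"
  show "smooth_on (cmap c ` (cdom c \<inter> F -` cdom d)) (\<lambda>x. dchart B d (F (cinv c x)) 0)"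
  proof (rule smooth_on_cong[OF open_domain[OF c d] _ smooth_on_const[of _ 0]])
    fix x assume "x \<in> cmap c ` (cdom c \<inter> F -` cdom d)"
    then have "F (cinv c x) \<in> cdom d" using M.cinv_cmap[OF c] by auto
    from linear_0[OF N.dchart_linear[OF d this]] show "0 = dchart B d (F (cinv c x)) 0" by (rule sym)
  qed
qed

lemma linear_differential: "linear (differential A B F p)"
  unfolding differential_def[abs_def]
  using has_derivative_linear[OF coords_has_derivative[OF M.chart_at N.chart_at]] .

lemma vertical_coords:
  assumes c: "c \<in> A" "p \<in> cdom c" and d: "d \<in> B" "F p \<in> cdom d"
  shows "v \<in> vertical A B F p \<longleftrightarrow> frechet_derivative (cmap d \<circ> F \<circ> cinv c) (at (cmap c p)) (dchart A c p v) = 0"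
  unfolding differential_coords[OF c d, symmetric] vertical_def
  using N.dchart_eq_iff[OF d, of _ 0] linear_0[OF N.dchart_linear[OF d]] by simp

text \<open>Vertical fields have a vertical bracket: differentiate \<open>DF(X) = 0\<close> along \<open>Y\<close> and antisymmetrize.\<close>

lemma lie_bracket_vertical:
  assumes X: "X \<in> vector_fields A" "\<And>q. X q \<in> vertical A B F q" and Y: "Y \<in> vector_fields A" "\<And>q. Y q \<in> vertical A B F q"
  shows "lie_bracket A X Y p \<in> vertical A B F p"
proof -
  obtain c where c: "c \<in> A" "p \<in> cdom c" using M.chart_at by blast
  obtain d where d: "d \<in> B" "F p \<in> cdom d" using N.chart_at by blast
  let ?f = "cmap d \<circ> F \<circ> cinv c" and ?x = "cmap c p"
  define W where "W = cmap c ` (cdom c \<inter> F -` cdom d)"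
  have W: "open W" "?x \<in> W" unfolding W_def using open_domain[OF c(1) d(1)] c d by auto
  have f: "smooth_on W ?f" unfolding W_def by (rule coords_smooth[OF c(1) d(1)])
  have lf: "linear (frechet_derivative ?f (at y))" if "y \<in> W" for y
    by (rule has_derivative_linear[OF smooth_on_has_derivative[OF f that]])
  have Wc: "W \<subseteq> cimg c" unfolding W_def by blast
  have zero: "ddir (vf_coords A c Z y) ?f y = 0" if Z: "\<And>q. Z q \<in> vertical A B F q" and y: "y \<in> W" for Z y
  proof -
    obtain q where q: "q \<in> cdom c" "F q \<in> cdom d" "y = cmap c q" using y unfolding W_def by blast
    show ?thesis unfolding q(3) M.vf_coords_at[OF c(1) q(1)] using vertical_coords[OF c(1) q(1) d(1) q(2)] Z by blast
  qed
  have key: "(\<Sum>i\<in>Basis. (vf_coords A c Z ?x \<bullet> i) *\<^sub>R ddir w (ddir i ?f) ?x) + ddir (ddir w (vf_coords A c Z) ?x) ?f ?x = 0"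
    if Z: "Z \<in> vector_fields A" "\<And>q. Z q \<in> vertical A B F q" for Z w
  proof -
    have "ddir w (\<lambda>y. ddir (vf_coords A c Z y) ?f y) ?x
        = (\<Sum>i\<in>Basis. (vf_coords A c Z ?x \<bullet> i) *\<^sub>R ddir w (ddir i ?f) ?x) + ddir (ddir w (vf_coords A c Z) ?x) ?f ?x"
      by (rule ddir_linear_family[OF W(1) lf smooth_onD[OF smooth_on_ddir[OF f]]
            smooth_onD[OF smooth_on_subset[OF M.vector_fields_smooth[OF Z(1) c(1)] Wc]] W(2)])
    moreover have "ddir w (\<lambda>y. ddir (vf_coords A c Z y) ?f y) ?x = 0"
      using frechet_derivative_cong_open[OF W, of "\<lambda>y. ddir (vf_coords A c Z y) ?f y" "\<lambda>y. 0"] zero[OF Z(2)] by simp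
    ultimately show ?thesis by simp
  qed
  let ?X = "vf_coords A c X ?x" and ?Y = "vf_coords A c Y ?x"
  have "ddir (ddir ?X (vf_coords A c Y) ?x) ?f ?x - ddir (ddir ?Y (vf_coords A c X) ?x) ?f ?x = 0"
    using key[OF X, of ?Y] key[OF Y, of ?X] second_derivative_symmetric[OF W f, of ?X ?Y]
    by (simp add: add_eq_0_iff2)
  then have "ddir (dchart A c p (lie_bracket A X Y p)) ?f ?x = 0"
    unfolding M.dchart_lie_bracket[OF c open_UNIV UNIV_I X(1) Y(1)] by (simp only: linear_diff[OF lf[OF W(2)]])
  then show ?thesis unfolding vertical_coords[OF c d] .
qed

end

section \<open>Semi-invariant submersions\<close>

text \<open>The three complex structures of a hyperkaehler manifold enter one at a time; \<open>R\<close> is one of them, with the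
  part of the hypotheses that concerns it.\<close>

locale semi_invariant = smooth_mapping A B F
  for A :: "('a::t2_space, 'e::euclidean_space) chart set"
    and B :: "('b::topological_space, 'f::euclidean_space) chart set" and F :: "'a \<Rightarrow> 'b" +
  fixes g :: "'a \<Rightarrow> 'e \<Rightarrow> 'e \<Rightarrow> real" and nab :: "('a \<Rightarrow> 'e) \<Rightarrow> ('a \<Rightarrow> 'e) \<Rightarrow> 'a \<Rightarrow> 'e"
    and R :: "'a \<Rightarrow> 'e \<Rightarrow> 'e" and D1 :: "'a \<Rightarrow> 'e set"
  assumes metric: "riemannian_metric A g" and lc: "levi_civita A g nab"
    and R_endo: "endo_field A R" and R_sq: "\<And>p v. R p (R p v) = - v"
    and R_isom: "\<And>p u v. g p (R p u) (R p v) = g p u v" and R_parallel: "parallel_endo A nab R"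
    and submersive: "\<And>p. surj (differential A B F p)"
    and D1_dist: "distribution A D1" and D1_vertical: "\<And>p. D1 p \<subseteq> vertical A B F p"
    and decomposition: "\<And>p v. v \<in> vertical A B F p \<Longrightarrow> \<exists>u w. u \<in> D1 p \<and> w \<in> D2 A g B F D1 p \<and> v = u + w"
    and R_D1: "\<And>p v. v \<in> D1 p \<Longrightarrow> R p v \<in> D1 p"
    and R_D2: "\<And>p v. v \<in> D2 A g B F D1 p \<Longrightarrow> R p v \<in> horizontal A B g F p"
begin

abbreviation "perp \<equiv> D2 A g B F D1"

lemma g_bilinear: "bilinear (g p)" and g_sym: "g p u v = g p v u" and g_pos: "v \<noteq> 0 \<Longrightarrow> 0 < g p v v"
  using metric by (simp_all add: riemannian_metric_def)

lemmas g_add_right = bilinear_radd[OF g_bilinear] and g_diff_left = bilinear_lsub[OF g_bilinear]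
  and g_zero_left = bilinear_lzero[OF g_bilinear] and g_minus_left = bilinear_lneg[OF g_bilinear]

lemma g_linear_right: "linear (g p u)" and g_linear_left: "linear (\<lambda>u. g p u v)"
  using g_bilinear by (simp_all add: bilinear_def)

lemma g_self_eq_0: "g p v v = 0 \<Longrightarrow> v = 0"
  using g_pos[of v p] by force

lemma perp_vertical: "v \<in> perp p \<Longrightarrow> v \<in> vertical A B F p"
  by (simp add: orth_compl_in_def)

lemma horizontal_vertical: "v \<in> horizontal A B g F p \<Longrightarrow> u \<in> vertical A B F p \<Longrightarrow> g p v u = 0"
  by (simp add: orth_compl_in_def)

lemma R_vf: "X \<in> vector_fields A \<Longrightarrow> (\<lambda>q. R q (X q)) \<in> vector_fields A"
  by (rule M.endo_field_vector_field[OF R_endo])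

lemma nab_R:
  "X \<in> vector_fields A \<Longrightarrow> Y \<in> vector_fields A \<Longrightarrow> nab X (\<lambda>q. R q (Y q)) p = R p (nab X Y p)"
  using R_parallel by (simp add: parallel_endo_def)

lemma torsion_free:
  "X \<in> vector_fields A \<Longrightarrow> Y \<in> vector_fields A \<Longrightarrow> nab X Y p - nab Y X p = lie_bracket A X Y p"
  using lc by (simp add: levi_civita_def)

lemma nab_orthogonal:
  assumes "X \<in> vector_fields A" "Y \<in> vector_fields A" "Z \<in> vector_fields A" and "\<And>q. g q (Y q) (Z q) = 0"
  shows "g p (nab X Y p) (Z p) = - g p (Y p) (nab X Z p)"
proof -
  have "dir_deriv A p (X p) (\<lambda>q. g q (Y q) (Z q)) = g p (nab X Y p) (Z p) + g p (Y p) (nab X Z p)"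
    using lc assms(1-3) by (simp add: levi_civita_def)
  moreover have "dir_deriv A p (X p) (\<lambda>q. g q (Y q) (Z q)) = 0"
    unfolding assms(4) dir_deriv_def by (simp add: o_def)
  ultimately show ?thesis by simp
qed

text \<open>\<open>RX\<close> is vertical and \<open>RW\<close> horizontal, so
  \<open>g(\<nabla>\<^sub>ZW, X) = g(\<nabla>\<^sub>Z RW, RX) = - g(RW, \<nabla>\<^sub>Z RX) = - g(RW, \<nabla>\<^sub>R\<^sub>X Z)\<close>; in the last step the vertical bracket
  \<open>[Z, RX]\<close> drops out.\<close>

lemma nab_perp_D1:
  assumes Z: "Z \<in> sections_in (vector_fields A) perp" and W: "W \<in> sections_in (vector_fields A) perp"
    and X: "X \<in> sections_in (vector_fields A) D1"
  shows "g p (nab Z W p) (X p) = - g p (R p (W p)) (nab (\<lambda>q. R q (X q)) Z p)"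
proof -
  let ?RX = "\<lambda>q. R q (X q)" and ?RW = "\<lambda>q. R q (W q)"
  have vf: "Z \<in> vector_fields A" "W \<in> vector_fields A" "X \<in> vector_fields A"
    using Z W X by (simp_all add: sections_in_def)
  have D: "\<And>q. Z q \<in> perp q" "\<And>q. W q \<in> perp q" "\<And>q. X q \<in> D1 q"
    using Z W X unfolding sections_in_def by blast+
  have RXv: "?RX q \<in> vertical A B F q" for q using R_D1[OF D(3)] D1_vertical by blast
  have "g p (nab Z W p) (X p) = g p (nab Z ?RW p) (?RX p)"
    unfolding nab_R[OF vf(1,2)] R_isom ..
  also have "\<dots> = - g p (?RW p) (nab Z ?RX p)"
    by (rule nab_orthogonal[OF vf(1) R_vf[OF vf(2)] R_vf[OF vf(3)]]) (rule horizontal_vertical[OF R_D2[OF D(2)] RXv])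
  also have "nab Z ?RX p = nab ?RX Z p + lie_bracket A Z ?RX p"
    using torsion_free[OF vf(1) R_vf[OF vf(3)], of p] by (simp add: algebra_simps)
  also have "g p (?RW p) (nab ?RX Z p + lie_bracket A Z ?RX p) = g p (?RW p) (nab ?RX Z p)"
    unfolding g_add_right
    using horizontal_vertical[OF R_D2[OF D(2)] lie_bracket_vertical[OF vf(1) perp_vertical[OF D(1)] R_vf[OF vf(3)] RXv]] by simp
  finally show ?thesis .
qed

text \<open>\<open>g(RW, \<nabla>\<^sub>R\<^sub>X Z) = - g(W, \<nabla>\<^sub>R\<^sub>X RZ) = g(\<nabla>\<^sub>R\<^sub>X W, RZ)\<close> is symmetric in \<open>Z\<close> and \<open>W\<close>, so \<open>\<nabla>\<^sub>ZW - \<nabla>\<^sub>WZ = [Z, W]\<close> is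
  orthogonal to every \<open>X\<close> in \<open>D1\<close>.  The bracket is vertical as \<open>Z\<close> and \<open>W\<close> are.\<close>

lemma perp_involutive:
  assumes Z: "Z \<in> sections_in (vector_fields A) perp" and W: "W \<in> sections_in (vector_fields A) perp"
  shows "lie_bracket A Z W p \<in> perp p"
proof -
  have vf: "Z \<in> vector_fields A" "W \<in> vector_fields A" using Z W by (simp_all add: sections_in_def)
  have D: "\<And>q. Z q \<in> perp q" "\<And>q. W q \<in> perp q" using Z W unfolding sections_in_def by blast+
  have "g p (lie_bracket A Z W p) w = 0" if w: "w \<in> D1 p" for w
  proof -
    obtain X where X: "X \<in> sections_in (vector_fields A) D1" "X p = w"
      by (rule section_through[OF M.atlas D1_dist w]) (rule that)
    let ?RX = "\<lambda>q. R q (X q)"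
    have Xv: "X \<in> vector_fields A" and XD: "\<And>q. X q \<in> D1 q" using X(1) unfolding sections_in_def by blast+
    have RXv: "?RX q \<in> vertical A B F q" for q using R_D1[OF XD] D1_vertical by blast
    have "g p (R p (W p)) (nab ?RX Z p) = g p (R p (R p (W p))) (R p (nab ?RX Z p))" by (rule R_isom[symmetric])
    also have "\<dots> = - g p (W p) (nab ?RX (\<lambda>q. R q (Z q)) p)"
      unfolding R_sq g_minus_left nab_R[OF R_vf[OF Xv] vf(1)] ..
    also have "\<dots> = g p (nab ?RX W p) (R p (Z p))"
      using nab_orthogonal[OF R_vf[OF Xv] vf(2) R_vf[OF vf(1)], of p]
        horizontal_vertical[OF R_D2[OF D(1)] perp_vertical[OF D(2)]] by (simp add: g_sym[of _ "W _"])
    also have "\<dots> = g p (R p (Z p)) (nab ?RX W p)" by (rule g_sym)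
    finally have "g p (nab Z W p) (X p) = g p (nab W Z p) (X p)"
      unfolding nab_perp_D1[OF Z W X(1)] nab_perp_D1[OF W Z X(1)] by simp
    then show ?thesis unfolding X(2)[symmetric] torsion_free[OF vf, symmetric] g_diff_left by simp
  qed
  then show ?thesis
    using lie_bracket_vertical[OF vf(1) perp_vertical[OF D(1)] vf(2) perp_vertical[OF D(2)]]
    by (simp add: orth_compl_in_def)
qed

text \<open>In coordinates the complement of \<open>D1\<close> in the vertical space is the kernel of a smooth family of linear maps
  \<open>T\<close>: the derivative of \<open>F\<close> together with the inner products with a frame of \<open>D1\<close>.  The second component takes
  values in the coordinate form of \<open>D1\<close> at \<open>p\<close>, with the frame at \<open>p\<close> as a basis, because the number \<open>k\<close> of inner
  products is not fixed by the types.\<close>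

lemma perp_distribution: "distribution A perp"
proof (rule M.distributionI_coords)
  fix p
  obtain c where c: "c \<in> A" "p \<in> cdom c" using M.chart_at by blast
  obtain d where d: "d \<in> B" "F p \<in> cdom d" using N.chart_at by blast
  obtain U k and X :: "nat \<Rightarrow> 'a \<Rightarrow> 'e" where U: "open U" "p \<in> U" "\<And>i. i < k \<Longrightarrow> X i \<in> vector_fields_on A U"
    "\<And>q. q \<in> U \<Longrightarrow> D1 q = span ((\<lambda>i. X i q) ` {..<k}) \<and> dim (D1 q) = k"
    using D1_dist unfolding distribution_def by metis
  let ?f = "cmap d \<circ> F \<circ> cinv c"
  define x0 where "x0 = cmap c p"
  define W where "W = cmap c ` (cdom c \<inter> U) \<inter> cmap c ` (cdom c \<inter> F -` cdom d)"
  have W: "open W" "x0 \<in> W" unfolding W_def x0_def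
    using open_Int[OF M.open_cmap_image[OF c(1) U(1)] open_domain[OF c(1) d(1)]] c d U by auto
  have Wc: "x \<in> cimg c" if "x \<in> W" for x using that unfolding W_def by blast
  have qc: "cinv c x \<in> cdom c" "cmap c (cinv c x) = x" if "x \<in> W" for x
    by (rule M.cinv_in[OF c(1) Wc[OF that]], rule M.cmap_cinv[OF c(1) Wc[OF that]])
  have qU: "cinv c x \<in> U" "F (cinv c x) \<in> cdom d" if x: "x \<in> W" for x
  proof -
    obtain q where q: "x = cmap c q" "q \<in> cdom c" "q \<in> U" using x unfolding W_def by blast
    then show "cinv c x \<in> U" using M.cinv_cmap[OF c(1) q(2)] by simp
    obtain q where q: "x = cmap c q" "q \<in> cdom c" "F q \<in> cdom d" using x unfolding W_def by blast
    then show "F (cinv c x) \<in> cdom d" using M.cinv_cmap[OF c(1) q(2)] by simp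
  qed
  have f: "smooth_on W ?f"
    by (rule smooth_on_subset[OF coords_smooth[OF c(1) d(1)]]) (simp add: W_def)
  let ?\<xi> = "\<lambda>i. vf_coords A c (X i)"
  have xi: "smooth_on W (?\<xi> i)" if "i < k" for i
    by (rule smooth_on_subset[OF M.vector_fields_on_smooth[OF U(3)[OF that] c(1)]]) (simp add: W_def)
  let ?G = "\<lambda>i x v. g (cinv c x) (X i (cinv c x)) (coord_vec A c v (cinv c x))"
  define T where "T x v = (ddir v ?f x, \<Sum>i<k. ?G i x v *\<^sub>R ?\<xi> i x0)" for x v
  have linG: "linear (?G i x)" if "x \<in> W" for i x
    using linear_compose[OF M.coord_vec_linear[OF c(1) qc(1)[OF that]] g_linear_right] by (simp only: o_def)
  have linf: "linear (frechet_derivative ?f (at x))" if "x \<in> W" for x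
    by (rule has_derivative_linear[OF smooth_on_has_derivative[OF f that]])
  have linT: "linear (T x)" if "x \<in> W" for x
    unfolding T_def
    by (rule linearI) (simp_all add: linear_add[OF linf[OF that]] linear_scale[OF linf[OF that]] linear_add[OF linG[OF that]]
        linear_scale[OF linG[OF that]] scaleR_add_left sum.distrib scaleR_sum_right)
  have smG: "smooth_on W (\<lambda>x. ?G i x v)" if "i < k" for i v
  proof -
    have "smooth_on W (\<lambda>x. g (cinv c x) (coord_vec A c (?\<xi> i x) (cinv c x)) (coord_vec A c v (cinv c x)))"
    proof (rule smooth_on_linear_family[where L = "\<lambda>x u. g (cinv c x) (coord_vec A c u (cinv c x)) (coord_vec A c v (cinv c x))",
          OF W(1) _ _ xi[OF that]])
      show "linear (\<lambda>u. g (cinv c x) (coord_vec A c u (cinv c x)) (coord_vec A c v (cinv c x)))" if "x \<in> W" for x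
        using linear_compose[OF M.coord_vec_linear[OF c(1) qc(1)[OF that]] g_linear_left] by (simp only: o_def)
      show "smooth_on W (\<lambda>x. g (cinv c x) (coord_vec A c b (cinv c x)) (coord_vec A c v (cinv c x)))" for b
        by (rule smooth_on_subset[of "cimg c"]) (use metric c(1) Wc in \<open>auto simp: riemannian_metric_def\<close>)
    qed
    then show ?thesis
    proof (rule smooth_on_cong[OF W(1), rotated])
      fix x assume "x \<in> W"
      then show "g (cinv c x) (coord_vec A c (?\<xi> i x) (cinv c x)) (coord_vec A c v (cinv c x)) = ?G i x v"
        unfolding vf_coords_def by (simp only: M.coord_vec_dchart[OF c(1) qc(1)])
    qed
  qed
  have smT: "smooth_on W (\<lambda>x. T x v)" for v
    unfolding T_def
    by (intro smooth_on_Pair W(1) smooth_on_ddir f smooth_on_sum smooth_on_scaleR smooth_on_const smG) simp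
  have indep: "\<forall>i<k. r i = 0" if z: "(\<Sum>i<k. r i *\<^sub>R ?\<xi> i x0) = 0" for r
  proof -
    have "dchart A c p (\<Sum>i<k. r i *\<^sub>R X i p) = 0"
      using z unfolding x0_def M.vf_coords_at[OF c] linear_sum[OF M.dchart_linear[OF c]] linear_scale[OF M.dchart_linear[OF c]] .
    then have "(\<Sum>i<k. r i *\<^sub>R X i p) = 0"
      using M.dchart_eq_iff[OF c, of _ 0] linear_0[OF M.dchart_linear[OF c]] by simp
    have dk: "dim (span ((\<lambda>i. X i p) ` {..<k})) = card {..<k}"
      unfolding conjunct1[OF U(4)[OF U(2)], symmetric] card_lessThan by (rule conjunct2[OF U(4)[OF U(2)]])
    show ?thesis
    proof (intro allI impI)
      fix i assume "i < k"
      then have "i \<in> {..<k}" by simp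
      then show "r i = 0"
        by (rule spanning_family_independent[OF finite_lessThan dk \<open>(\<Sum>i<k. r i *\<^sub>R X i p) = 0\<close>])
    qed
  qed
  have kerT: "M.coord_dist c perp x = {v. T x v = 0}" if x: "x \<in> W" for x
  proof (intro set_eqI)
    fix u
    let ?q = "cinv c x" and ?v = "coord_vec A c u (cinv c x)"
    have "u \<in> M.coord_dist c perp x \<longleftrightarrow> ?v \<in> perp ?q"
      using M.coord_vec_in_iff[OF c(1) qc(1)[OF x], of u perp] unfolding qc(2)[OF x] by simp
    also have "\<dots> \<longleftrightarrow> ?v \<in> vertical A B F ?q \<and> (\<forall>w\<in>D1 ?q. g ?q ?v w = 0)"
      by (simp add: orth_compl_in_def)
    also have "?v \<in> vertical A B F ?q \<longleftrightarrow> ddir u ?f x = 0"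
      unfolding vertical_coords[OF c(1) qc(1)[OF x] d(1) qU(2)[OF x]] qc(2)[OF x] M.dchart_coord_vec[OF c(1) qc(1)[OF x]] ..
    also have "(\<forall>w\<in>D1 ?q. g ?q ?v w = 0) \<longleftrightarrow> (\<forall>i<k. ?G i x u = 0)"
    proof
      assume a: "\<forall>w\<in>D1 ?q. g ?q ?v w = 0"
      have "X i ?q \<in> D1 ?q" if "i < k" for i using U(4)[OF qU(1)[OF x]] that by (auto intro: span_base)
      then show "\<forall>i<k. ?G i x u = 0" using a g_sym by simp
    next
      assume a: "\<forall>i<k. ?G i x u = 0"
      show "\<forall>w\<in>D1 ?q. g ?q ?v w = 0"
      proof
        fix w assume "w \<in> D1 ?q"
        then have "w \<in> span ((\<lambda>i. X i ?q) ` {..<k})" using U(4)[OF qU(1)[OF x]] by simp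
        from in_span_image_finite[OF finite_lessThan this] obtain r where w: "w = (\<Sum>i<k. r i *\<^sub>R X i ?q)" by blast
        show "g ?q ?v w = 0"
          unfolding w linear_sum[OF g_linear_right] linear_scale[OF g_linear_right]
          by (rule sum.neutral) (use a g_sym[of ?q ?v] in auto)
      qed
    qed
    also have "(\<forall>i<k. ?G i x u = 0) \<longleftrightarrow> (\<Sum>i<k. ?G i x u *\<^sub>R ?\<xi> i x0) = 0"
      using indep[of "\<lambda>i. ?G i x u"] by auto
    finally show "u \<in> M.coord_dist c perp x \<longleftrightarrow> u \<in> {v. T x v = 0}" by (simp only: T_def mem_Collect_eq zero_prod_def prod.inject)
  qed
  \<comment> \<open>At \<open>p\<close> the rank of \<open>T\<close> is as large as possible: \<open>DF\<close> is onto, and on \<open>D1\<close>, where \<open>DF\<close> vanishes,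
    the second component is injective because \<open>g\<close> is positive definite, hence onto the span of the \<open>\<xi> i x0\<close>.\<close>
  have rng: "T x v \<in> range (T x0)" if x: "x \<in> W" for x v
  proof -
    let ?Y = "span ((\<lambda>i. ?\<xi> i x0) ` {..<k})"
    have q0: "cinv c x0 = p" unfolding x0_def by (rule M.cinv_cmap[OF c])
    let ?P = "\<lambda>w. \<Sum>i<k. ?G i x0 w *\<^sub>R ?\<xi> i x0"
    let ?D = "M.coord_dist c D1 x0"
    have linP: "linear ?P"
      by (rule linearI) (simp_all add: linear_add[OF linG[OF W(2)]] linear_scale[OF linG[OF W(2)]] scaleR_add_left sum.distrib scaleR_sum_right)
    have DY: "?D = ?Y"
      unfolding M.coord_dist_def q0 conjunct1[OF U(4)[OF U(2)]] linear_span_image[OF M.dchart_linear[OF c], symmetric] image_image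
      unfolding x0_def M.vf_coords_at[OF c] ..
    have D1_coord: "coord_vec A c w p \<in> D1 p" if "w \<in> ?Y" for w
    proof -
      have "w \<in> M.coord_dist c D1 (cmap c p)" using that DY unfolding x0_def by simp
      then show ?thesis unfolding M.coord_vec_in_iff[OF c] .
    qed
    have P0: "w = 0" if w: "w \<in> ?Y" "?P w = 0" for w
    proof -
      have G0: "?G i x0 w = 0" if "i < k" for i using indep[OF w(2)] that by blast
      have "coord_vec A c w p \<in> D1 p" by (rule D1_coord[OF w(1)])
      then have "coord_vec A c w p \<in> span ((\<lambda>i. X i p) ` {..<k})" using U(4)[OF U(2)] by simp
      from in_span_image_finite[OF finite_lessThan this] obtain r where r: "coord_vec A c w p = (\<Sum>i<k. r i *\<^sub>R X i p)" by blast
      have "g p (coord_vec A c w p) (coord_vec A c w p) = (\<Sum>i<k. r i * g p (X i p) (coord_vec A c w p))"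
        by (subst r) (simp only: linear_sum[OF g_linear_left] linear_scale[OF g_linear_left] real_scaleR_def)
      also have "\<dots> = 0" using G0 unfolding q0 by simp
      finally have "coord_vec A c w p = 0" by (rule g_self_eq_0)
      then show "w = 0" using M.dchart_coord_vec[OF c, of w] linear_0[OF M.dchart_linear[OF c]] by simp
    qed
    have Pimg: "?P ` ?Y = ?Y"
    proof (rule subspace_dim_equal)
      show "subspace (?P ` ?Y)" by (rule linear_subspace_image[OF linP subspace_span])
      show "?P ` ?Y \<subseteq> ?Y" by (rule image_subsetI) (intro span_sum span_scale span_base imageI)
      have "inj_on ?P ?Y"
        using linear_inj_on_iff_eq_0[OF linP subspace_span] P0 by blast
      then show "dim ?Y \<le> dim (?P ` ?Y)"
        using dim_image_eq[OF linP, of ?Y] by (simp add: span_span)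
    qed (rule subspace_span)
    obtain v' where v': "differential A B F p v' = coord_vec B d (ddir v ?f x) (F p)"
      using submersive[of p] by (metis surjD)
    let ?v1 = "dchart A c p v'"
    have f1: "ddir ?v1 ?f x0 = ddir v ?f x"
      using differential_coords[OF c d, of v'] unfolding v' N.dchart_coord_vec[OF d] x0_def by simp
    have "(\<Sum>i<k. ?G i x v *\<^sub>R ?\<xi> i x0) - ?P ?v1 \<in> ?Y"
      by (intro span_diff span_sum span_scale span_base) auto
    then obtain w where w: "w \<in> ?Y" "?P w = (\<Sum>i<k. ?G i x v *\<^sub>R ?\<xi> i x0) - ?P ?v1" using Pimg by (metis (no_types, lifting) imageE)
    have "coord_vec A c w p \<in> vertical A B F p"
      using D1_coord[OF w(1)] D1_vertical by blast
    then have f2: "ddir w ?f x0 = 0" unfolding vertical_coords[OF c d] M.dchart_coord_vec[OF c] x0_def .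
    have "T x0 (?v1 + w) = T x v"
      unfolding T_def linear_add[OF linf[OF W(2)]] linear_add[OF linP] f1 f2 w(2) by simp
    then show ?thesis by (metis rangeI)
  qed
  obtain S m and \<zeta> :: "nat \<Rightarrow> 'e \<Rightarrow> 'e" where S: "open S" "x0 \<in> S" "S \<subseteq> W" "\<And>i. i < m \<Longrightarrow> smooth_on S (\<zeta> i)"
    "\<And>x. x \<in> S \<Longrightarrow> {v. T x v = 0} = span ((\<lambda>i. \<zeta> i x) ` {..<m}) \<and> dim {v. T x v = 0} = m"
    using kernel_frame[OF W linT smT rng] by metis
  show "\<exists>c W k \<zeta>. c \<in> A \<and> p \<in> cdom c \<and> open W \<and> cmap c p \<in> W \<and> W \<subseteq> cimg c \<and>
    (\<forall>i<(k::nat). smooth_on W (\<zeta> i)) \<and>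
    (\<forall>x\<in>W. M.coord_dist c perp x = span ((\<lambda>i. \<zeta> i x) ` {..<k}) \<and> dim (M.coord_dist c perp x) = k)"
  proof (intro exI conjI)
    show "c \<in> A" "p \<in> cdom c" "open S" "cmap c p \<in> S" using c S by (simp_all add: x0_def)
    show "S \<subseteq> cimg c" using S(3) Wc by blast
    show "\<forall>i<m. smooth_on S (\<zeta> i)" using S(4) by blast
    show "\<forall>x\<in>S. M.coord_dist c perp x = span ((\<lambda>i. \<zeta> i x) ` {..<m}) \<and> dim (M.coord_dist c perp x) = m"
    proof
      fix x assume x: "x \<in> S"
      then have "x \<in> W" using S(3) by blast
      show "M.coord_dist c perp x = span ((\<lambda>i. \<zeta> i x) ` {..<m}) \<and> dim (M.coord_dist c perp x) = m"
        unfolding kerT[OF \<open>x \<in> W\<close>] by (rule S(5)[OF x])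
    qed
  qed
qed

theorem perp_integrable: "integrable_distribution A perp"
  by (rule frobenius[OF M.atlas perp_distribution perp_involutive])

text \<open>\<open>RV\<close> and \<open>RW\<close> are vertical, so \<open>F\<^sub>*(RV) = F\<^sub>*(RW) = 0\<close> and only \<open>F\<^sub>*(R(\<nabla>\<^sub>VW - \<nabla>\<^sub>WV))\<close> is left of the second
  fundamental forms.\<close>

lemma sff_difference:
  assumes conn: "connection A (pullback_sections A B F) nabF"
    and V: "V \<in> sections_in (vector_fields A) D1" and W: "W \<in> sections_in (vector_fields A) D1"
  shows "second_fundamental_form A B F nab nabF W (\<lambda>q. R q (V q)) p -
      second_fundamental_form A B F nab nabF V (\<lambda>q. R q (W q)) p = differential A B F p (R p (lie_bracket A V W p))"
proof -
  have vf: "V \<in> vector_fields A" "W \<in> vector_fields A" using V W by (simp_all add: sections_in_def)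
  have linR: "linear (R p)" using R_endo by (simp add: endo_field_def)
  have z: "(\<lambda>q. differential A B F q (R q (Y q))) = (\<lambda>q. 0)" if "Y \<in> sections_in (vector_fields A) D1" for Y
  proof
    fix q
    have "R q (Y q) \<in> vertical A B F q" using that R_D1 D1_vertical unfolding sections_in_def by blast
    then show "differential A B F q (R q (Y q)) = 0" by (simp add: vertical_def)
  qed
  have zs: "(\<lambda>q. 0) \<in> pullback_sections A B F" by (rule zero_section)
  have n0: "nabF X (\<lambda>q. 0) p = 0" if "X \<in> vector_fields A" for X
  proof -
    have "\<forall>X\<in>vector_fields A. \<forall>s\<in>pullback_sections A B F. \<forall>t\<in>pullback_sections A B F. \<forall>p.
        nabF X (\<lambda>q. s q + t q) p = nabF X s p + nabF X t p"
      using conn unfolding connection_def by blast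
    from this[rule_format, OF that zs zs, of p] show ?thesis by simp
  qed
  have "second_fundamental_form A B F nab nabF W (\<lambda>q. R q (V q)) p -
      second_fundamental_form A B F nab nabF V (\<lambda>q. R q (W q)) p
    = differential A B F p (R p (nab V W p)) - differential A B F p (R p (nab W V p))"
    unfolding second_fundamental_form_def z[OF V] z[OF W] n0[OF vf(1)] n0[OF vf(2)] nab_R[OF vf] nab_R[OF vf(2,1)] by simp
  also have "\<dots> = differential A B F p (R p (nab V W p - nab W V p))"
    by (simp only: linear_diff[OF linear_differential] linear_diff[OF linR])
  finally show ?thesis unfolding torsion_free[OF vf] .
qed

text \<open>Write \<open>[V, W] = u + w\<close> with \<open>u\<close> in \<open>D1\<close> and \<open>w\<close> in \<open>D2\<close>.  Then \<open>F\<^sub>*(R[V, W]) = F\<^sub>*(Rw)\<close>, and \<open>F\<^sub>*\<close> is injective on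
  horizontal vectors, so this lies in \<open>F\<^sub>*\<mu>\<^sup>R\<close> if and only if the element \<open>Rw\<close> of \<open>R D2\<close> is orthogonal to \<open>R D2\<close>,
  that is, \<open>w = 0\<close>.\<close>

lemma sff_condition_iff_integrable:
  assumes conn: "connection A (pullback_sections A B F) nabF"
  shows "integrable_distribution A D1 \<longleftrightarrow> sff_condition A g B F nab nabF D1 R"
proof
  assume D: "integrable_distribution A D1"
  show "sff_condition A g B F nab nabF D1 R"
    unfolding sff_condition_def
  proof (intro ballI)
    fix V W assume V: "V \<in> sections_in (vector_fields A) D1" and W: "W \<in> sections_in (vector_fields A) D1"
    have z: "differential A B F p (R p (lie_bracket A V W p)) = 0" for p
      using R_D1[OF integrable_imp_involutive[OF M.atlas D V W]] D1_vertical unfolding vertical_def by blast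
    have "0 \<in> mu_bundle A g B F D1 R p" for p
      by (simp add: mu_bundle_def orth_compl_in_def g_zero_left)
    then have "0 \<in> push_mu_bundle A g B F D1 R p" for p
      unfolding push_mu_bundle_def using linear_0[OF linear_differential] by (metis imageI)
    then show "(\<lambda>p. second_fundamental_form A B F nab nabF W (\<lambda>q. R q (V q)) p -
        second_fundamental_form A B F nab nabF V (\<lambda>q. R q (W q)) p)
      \<in> sections_in (pullback_sections A B F) (push_mu_bundle A g B F D1 R)"
      unfolding sff_difference[OF conn V W] z sections_in_def using zero_section by blast
  qed
next
  assume s: "sff_condition A g B F nab nabF D1 R"
  show "integrable_distribution A D1"
  proof (rule frobenius[OF M.atlas D1_dist])
    fix V W p assume V: "V \<in> sections_in (vector_fields A) D1" and W: "W \<in> sections_in (vector_fields A) D1"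
    let ?b = "lie_bracket A V W p"
    have vf: "V \<in> vector_fields A" "W \<in> vector_fields A" using V W by (simp_all add: sections_in_def)
    have ver: "V q \<in> vertical A B F q" "W q \<in> vertical A B F q" for q
      using V W D1_vertical unfolding sections_in_def by blast+
    have "(\<lambda>p. differential A B F p (R p (lie_bracket A V W p))) \<in> sections_in (pullback_sections A B F) (push_mu_bundle A g B F D1 R)"
      using s V W unfolding sff_condition_def sff_difference[OF conn V W, symmetric] by blast
    then have "differential A B F p (R p ?b) \<in> push_mu_bundle A g B F D1 R p" unfolding sections_in_def by blast
    then obtain m where m: "m \<in> mu_bundle A g B F D1 R p" "differential A B F p (R p ?b) = differential A B F p m"
      unfolding push_mu_bundle_def by blast
    obtain u w where uw: "u \<in> D1 p" "w \<in> perp p" "?b = u + w"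
      using decomposition[OF lie_bracket_vertical[OF vf(1) ver(1) vf(2) ver(2)], of p] by blast
    have linR: "linear (R p)" using R_endo by (simp add: endo_field_def)
    have mh: "m \<in> horizontal A B g F p" and mperp: "g p m (R p w) = 0"
      using m(1) uw(2) by (auto simp: mu_bundle_def orth_compl_in_def)
    have Rw: "R p w \<in> horizontal A B g F p" by (rule R_D2[OF uw(2)])
    \<comment> \<open>\<open>R w - m\<close> is both horizontal and vertical, hence zero; but \<open>m\<close> is orthogonal to \<open>R w\<close>.\<close>
    have "differential A B F p (R p u) = 0" using R_D1[OF uw(1)] D1_vertical unfolding vertical_def by blast
    then have "differential A B F p (R p w) = differential A B F p m"
      using m(2) unfolding uw(3) linear_add[OF linR] linear_add[OF linear_differential] by simp
    then have "R p w - m \<in> vertical A B F p" by (simp add: vertical_def linear_diff[OF linear_differential])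
    then have "g p (R p w - m) (R p w - m) = 0"
      using horizontal_vertical[OF Rw] horizontal_vertical[OF mh] by (simp add: g_diff_left)
    then have "R p w = m" using g_self_eq_0 by fastforce
    then have "g p w w = 0" using mperp R_isom[of p w w] by simp
    then have "w = 0" by (rule g_self_eq_0)
    then show "?b \<in> D1 p" using uw by simp
  qed
qed

end

theorem lemma3p6:
  fixes A :: "('a::{t2_space, second_countable_topology}, 'e::euclidean_space) chart set"
    and B :: "('b::{t2_space, second_countable_topology}, 'f::euclidean_space) chart set"
    and gM :: "'a \<Rightarrow> 'e \<Rightarrow> 'e \<Rightarrow> real" and gN :: "'b \<Rightarrow> 'f \<Rightarrow> 'f \<Rightarrow> real"
    and nabM :: "('a \<Rightarrow> 'e) \<Rightarrow> ('a \<Rightarrow> 'e) \<Rightarrow> 'a \<Rightarrow> 'e"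
    and nabN :: "('b \<Rightarrow> 'f) \<Rightarrow> ('b \<Rightarrow> 'f) \<Rightarrow> 'b \<Rightarrow> 'f"
    and nabF :: "('a \<Rightarrow> 'e) \<Rightarrow> ('a \<Rightarrow> 'f) \<Rightarrow> 'a \<Rightarrow> 'f"
    and I J K :: "'a \<Rightarrow> 'e \<Rightarrow> 'e"
    and F :: "'a \<Rightarrow> 'b" and lam :: "'a \<Rightarrow> real" and D1 :: "'a \<Rightarrow> 'e set"
  assumes "hyperkaehler A gM nabM I J K"
    and "riemannian_manifold B gN"
    and "levi_civita B gN nabN"
    and "pullback_connection A B F nabN nabF"
    and "h_conformal_semi_invariant A gM B gN F lam I J K D1"
  shows "integrable_distribution A (D2 A gM B F D1) \<and>
    (integrable_distribution A D1 \<longleftrightarrow> sff_condition A gM B F nabM nabF D1 I) \<and>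
    (integrable_distribution A D1 \<longleftrightarrow> sff_condition A gM B F nabM nabF D1 J) \<and>
    (integrable_distribution A D1 \<longleftrightarrow> sff_condition A gM B F nabM nabF D1 K)"
proof -
  have hk: "smooth_structure A" "riemannian_metric A gM" "levi_civita A gM nabM"
    and str: "\<And>R. R \<in> {I, J, K} \<Longrightarrow> endo_field A R \<and> (\<forall>p v. R p (R p v) = - v) \<and>
      (\<forall>p u v. gM p (R p u) (R p v) = gM p u v) \<and> parallel_endo A nabM R"
    using assms(1) unfolding hyperkaehler_def riemannian_manifold_def by blast+
  have B: "smooth_structure B" using assms(2) unfolding riemannian_manifold_def by blast
  have conn: "connection A (pullback_sections A B F) nabF" using assms(4) unfolding pullback_connection_def by blast
  note h = assms(5)[unfolded h_conformal_semi_invariant_def horizontally_conformal_submersion_def]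
  have F: "smooth_map A B F" using h by (elim conjE)
  have D1: "distribution A D1" using h by (elim conjE)
  have sur: "\<forall>p. surj (differential A B F p)" using h by (elim conjE)
  have D1v: "\<forall>p. D1 p \<subseteq> vertical A B F p" using h by (elim conjE)
  have dec: "\<forall>p. vertical A B F p = {u + v |u v. u \<in> D1 p \<and> v \<in> D2 A gM B F D1 p} \<and>
      D1 p \<inter> D2 A gM B F D1 p = {0}" using h by (elim conjE)
  have inv: "\<forall>R\<in>{I, J, K}. \<forall>p. R p ` D1 p = D1 p \<and> R p ` D2 A gM B F D1 p \<subseteq> horizontal A B gM F p"
    using h by (elim conjE)
  have loc: "semi_invariant A B F gM nabM R D1" if R: "R \<in> {I, J, K}" for R
  proof (intro semi_invariant.intro smooth_mapping.intro smooth_manifold.intro smooth_mapping_axioms.intro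
      semi_invariant_axioms.intro)
    show "smooth_structure A" "smooth_structure B" "smooth_map A B F" "riemannian_metric A gM" "levi_civita A gM nabM"
      "surj (differential A B F p)" "distribution A D1" "D1 p \<subseteq> vertical A B F p" for p
      by (fact hk B F D1 spec[OF sur] spec[OF D1v])+
    show "endo_field A R" "parallel_endo A nabM R" "R p (R p v) = - v" "gM p (R p u) (R p v) = gM p u v" for p u v
      using str[OF R] by simp_all
    show "\<exists>u w. u \<in> D1 p \<and> w \<in> D2 A gM B F D1 p \<and> v = u + w" if "v \<in> vertical A B F p" for p v
      using that unfolding conjunct1[OF spec[OF dec, of p]] by blast
    show "R p v \<in> D1 p" if "v \<in> D1 p" for p v using spec[OF bspec[OF inv R], of p] that by blast
    show "R p v \<in> horizontal A B gM F p" if "v \<in> D2 A gM B F D1 p" for p v using spec[OF bspec[OF inv R], of p] that by blast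
  qed
  have "integrable_distribution A (D2 A gM B F D1)" by (rule semi_invariant.perp_integrable[OF loc[of I]]) simp
  then show ?thesis using semi_invariant.sff_condition_iff_integrable[OF loc conn] by simp
qed

end
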